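(* Let $n\in\{2,3\}$ and $\delta>0$. There exist no functions $G(t,\beta)$ and $H(t,\gamma)$ with the following two properties: (i) whenever $(u,B)$ is a solution on $\mathbb{R}^n\times[0,\infty)$ of the magnetohydrodynamics equations $$\partial_t u+(u\cdot\nabla)u-(B\cdot\nabla)B+\nabla p=\Delta u,\qquad \partial_t B+(u\cdot\nabla)B-(B\cdot\nabla)u=\delta\Delta B,$$ $$\nabla\cdot u=0,\qquad \nabla\cdot B=0,\qquad u(x,0)=u_0(x),\qquad B(x,0)=B_0(x),$$ with data $(u_0,B_0)\in(L^2(\mathbb{R}^n))^2$, one has $\|u(t)\|_{L^2}\le G(t,\|u_0\|_{L^2})$ and $\|B(t)\|_{L^2}\le H(t,\|B_0\|_{L^2})$ for all $t>0$; (ii) $\lim_{t\to\infty}G(t,\beta)=0$ for all $\beta>0$, and $\lim_{t\to\infty}H(t,\gamma)=0$ for all $\gamma>0$.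
   Context: Here $u,B:\mathbb{R}^n\times[0,\infty)\to\mathbb{R}^n$ are the velocity and magnetic field and $p$ is the scalar total pressure; the data $u_0,B_0$ are divergence free. $G$ and $H$ are real-valued functions on $(0,\infty)\times[0,\infty)$. "Solution" means Leray–Hopf weak solution: $u,B\in L^\infty(0,\infty;L^2)$ with $\nabla u,\nabla B\in L^2(0,\infty;L^2)$, both divergence free and weakly continuous in time with values in $L^2$, attaining the initial data, satisfying the equations in the sense of distributions, and satisfying the energy inequality $$\|u(t)\|_2^2+\|B(t)\|_2^2+2\int_s^t\left(\|\nabla u(\tau)\|_2^2+\delta\|\nabla B(\tau)\|_2^2\right)d\tau\le\|u(s)\|_2^2+\|B(s)\|_2^2$$ for $s=0$ and almost all $s>0$, and all $t\ge s$. *)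

theory Defs
  imports "HOL-Analysis.Analysis"
begin

section \<open>Square-integrable functions\<close>

definition L2_on :: "'a::euclidean_space set \<Rightarrow> ('a \<Rightarrow> 'b::euclidean_space) set" where
  "L2_on S = {f. f \<in> borel_measurable (lebesgue_on S) \<and>
                 integrable (lebesgue_on S) (\<lambda>x. (norm (f x))\<^sup>2)}"

abbreviation L2 :: "('a::euclidean_space \<Rightarrow> 'b::euclidean_space) set" where
  "L2 \<equiv> L2_on UNIV"

text \<open>On matrices the norm is the Frobenius norm, so for a matrix-valued gradient
  \<open>(L2_norm G)\<^sup>2\<close> is the integral of the sum of the squares of all entries.\<close>

definition L2_norm :: "('a::euclidean_space \<Rightarrow> 'b::euclidean_space) \<Rightarrow> real" where
  "L2_norm f = sqrt (\<integral>x. (norm (f x))\<^sup>2 \<partial>lebesgue)"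


section \<open>Test functions\<close>

definition dir_deriv :: "'a::euclidean_space \<Rightarrow> ('a \<Rightarrow> real) \<Rightarrow> 'a \<Rightarrow> real" where
  "dir_deriv v f z = frechet_derivative f (at z) v"

primrec iter_dir_deriv :: "'a::euclidean_space list \<Rightarrow> ('a \<Rightarrow> real) \<Rightarrow> 'a \<Rightarrow> real" where
  "iter_dir_deriv [] f = f"
| "iter_dir_deriv (v # vs) f = dir_deriv v (iter_dir_deriv vs f)"

text \<open>A function is \<open>C\<^sup>\<infinity>\<close> iff all its iterated partial derivatives exist and are
  differentiable everywhere; their continuity is a consequence of differentiability.\<close>

definition smooth :: "('a::euclidean_space \<Rightarrow> real) \<Rightarrow> bool" where
  "smooth f \<longleftrightarrow> (\<forall>vs \<in> lists Basis. \<forall>z. iter_dir_deriv vs f differentiable (at z))"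

text \<open>For open \<open>U\<close>, this is \<open>C\<^sub>c\<^sup>\<infinity>(U)\<close>, each function being extended by zero.\<close>

definition test_functions :: "'a::euclidean_space set \<Rightarrow> ('a \<Rightarrow> real) set" where
  "test_functions U =
     {\<phi>. smooth \<phi> \<and> compact (closure {z. \<phi> z \<noteq> 0}) \<and> closure {z. \<phi> z \<noteq> 0} \<subseteq> U}"


section \<open>Distributional divergence and gradient of vector fields\<close>

definition partial :: "'n::finite \<Rightarrow> (real^'n \<Rightarrow> real) \<Rightarrow> real^'n \<Rightarrow> real" where
  "partial j = dir_deriv (axis j 1)"

definition div_free :: "(real^'n \<Rightarrow> real^'n::finite) \<Rightarrow> bool" where
  "div_free f \<longleftrightarrow>
     (\<forall>\<phi> \<in> test_functions UNIV. (\<integral>x. (\<Sum>j\<in>UNIV. f x $ j * partial j \<phi> x) \<partial>lebesgue) = 0)"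

text \<open>The entry \<open>D x $ i $ j\<close> is the \<open>j\<close>-th partial derivative of the \<open>i\<close>-th component,
  so that \<open>D x *v w\<close> is \<open>(w \<cdot> \<nabla>) f\<close> at \<open>x\<close>.\<close>

definition weak_gradient ::
  "(real^'n \<Rightarrow> real^'n::finite) \<Rightarrow> (real^'n \<Rightarrow> real^'n^'n) \<Rightarrow> bool" where
  "weak_gradient f D \<longleftrightarrow>
     (\<forall>\<phi> \<in> test_functions UNIV. \<forall>i j.
        (\<integral>x. f x $ i * partial j \<phi> x \<partial>lebesgue) = - (\<integral>x. D x $ i $ j * \<phi> x \<partial>lebesgue))"


section \<open>Space-time\<close>

text \<open>Time-dependent fields are curried functions \<open>u t x\<close>; their values at \<open>t < 0\<close> are
  irrelevant.  Space-time points are pairs \<open>(t, x)\<close>.\<close>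

definition spacetime :: "(real \<times> (real^'n::finite)) set" where
  "spacetime = {0<..} \<times> UNIV"

definition time_deriv ::
  "(real \<times> (real^'n) \<Rightarrow> real) \<Rightarrow> real \<times> (real^'n::finite) \<Rightarrow> real" where
  "time_deriv = dir_deriv (1, 0)"

definition space_deriv ::
  "'n \<Rightarrow> (real \<times> (real^'n) \<Rightarrow> real) \<Rightarrow> real \<times> (real^'n::finite) \<Rightarrow> real" where
  "space_deriv j = dir_deriv (0, axis j 1)"

definition space_laplacian ::
  "(real \<times> (real^'n) \<Rightarrow> real) \<Rightarrow> real \<times> (real^'n::finite) \<Rightarrow> real" where
  "space_laplacian \<phi> z = (\<Sum>j\<in>UNIV. space_deriv j (space_deriv j \<phi>) z)"

definition locally_integrable ::
  "'a::euclidean_space set \<Rightarrow> ('a \<Rightarrow> real) \<Rightarrow> bool" where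
  "locally_integrable U f \<longleftrightarrow> (\<forall>K. compact K \<and> K \<subseteq> U \<longrightarrow> integrable (lebesgue_on K) f)"

definition weakly_continuous_L2 :: "(real \<Rightarrow> real^'n \<Rightarrow> real^'n::finite) \<Rightarrow> bool" where
  "weakly_continuous_L2 u \<longleftrightarrow>
     (\<forall>t\<ge>0. u t \<in> L2) \<and>
     (\<forall>w\<in>L2. continuous_on {0..} (\<lambda>t. \<integral>x. u t x \<bullet> w x \<partial>lebesgue))"


section \<open>Leray--Hopf weak solutions of the MHD equations\<close>

definition leray_hopf_field ::
  "(real \<Rightarrow> real^'n \<Rightarrow> real^'n::finite) \<Rightarrow> (real \<Rightarrow> real^'n \<Rightarrow> real^'n^'n) \<Rightarrow>
   (real^'n \<Rightarrow> real^'n) \<Rightarrow> bool" where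
  "leray_hopf_field u Du u0 \<longleftrightarrow>
     (\<lambda>(t, x). u t x) \<in> borel_measurable (lebesgue_on spacetime) \<and>
     (\<exists>C. AE t in lebesgue_on {0<..}. L2_norm (u t) \<le> C) \<and>
     (\<lambda>(t, x). Du t x) \<in> L2_on spacetime \<and>
     (AE t in lebesgue_on {0<..}. weak_gradient (u t) (Du t)) \<and>
     (\<forall>t\<ge>0. div_free (u t)) \<and>
     weakly_continuous_L2 u \<and>
     (AE x in lebesgue. u 0 x = u0 x)"

definition momentum_equation ::
  "(real \<Rightarrow> real^'n \<Rightarrow> real^'n::finite) \<Rightarrow> (real \<Rightarrow> real^'n \<Rightarrow> real^'n) \<Rightarrow>
   (real \<Rightarrow> real^'n \<Rightarrow> real^'n^'n) \<Rightarrow> (real \<Rightarrow> real^'n \<Rightarrow> real^'n^'n) \<Rightarrow>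
   (real \<Rightarrow> real^'n \<Rightarrow> real) \<Rightarrow> bool" where
  "momentum_equation u B Du DB p \<longleftrightarrow>
     (\<forall>\<phi> \<in> test_functions spacetime. \<forall>i.
        (\<integral>(t, x). - (u t x $ i * time_deriv \<phi> (t, x))
                  + (Du t x *v u t x - DB t x *v B t x) $ i * \<phi> (t, x)
                  - p t x * space_deriv i \<phi> (t, x) \<partial>lebesgue_on spacetime)
        = (\<integral>(t, x). u t x $ i * space_laplacian \<phi> (t, x) \<partial>lebesgue_on spacetime))"

definition induction_equation ::
  "real \<Rightarrow> (real \<Rightarrow> real^'n \<Rightarrow> real^'n::finite) \<Rightarrow> (real \<Rightarrow> real^'n \<Rightarrow> real^'n) \<Rightarrow>
   (real \<Rightarrow> real^'n \<Rightarrow> real^'n^'n) \<Rightarrow> (real \<Rightarrow> real^'n \<Rightarrow> real^'n^'n) \<Rightarrow> bool" where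
  "induction_equation \<delta> u B Du DB \<longleftrightarrow>
     (\<forall>\<phi> \<in> test_functions spacetime. \<forall>i.
        (\<integral>(t, x). - (B t x $ i * time_deriv \<phi> (t, x))
                  + (DB t x *v u t x - Du t x *v B t x) $ i * \<phi> (t, x) \<partial>lebesgue_on spacetime)
        = \<delta> * (\<integral>(t, x). B t x $ i * space_laplacian \<phi> (t, x) \<partial>lebesgue_on spacetime))"

definition energy_inequality_from ::
  "real \<Rightarrow> (real \<Rightarrow> real^'n \<Rightarrow> real^'n::finite) \<Rightarrow> (real \<Rightarrow> real^'n \<Rightarrow> real^'n) \<Rightarrow>
   (real \<Rightarrow> real^'n \<Rightarrow> real^'n^'n) \<Rightarrow> (real \<Rightarrow> real^'n \<Rightarrow> real^'n^'n) \<Rightarrow> real \<Rightarrow> bool" where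
  "energy_inequality_from \<delta> u B Du DB s \<longleftrightarrow>
     (\<forall>t\<ge>s. (L2_norm (u t))\<^sup>2 + (L2_norm (B t))\<^sup>2
            + 2 * (\<integral>\<tau>. (L2_norm (Du \<tau>))\<^sup>2 + \<delta> * (L2_norm (DB \<tau>))\<^sup>2 \<partial>lebesgue_on {s..t})
          \<le> (L2_norm (u s))\<^sup>2 + (L2_norm (B s))\<^sup>2)"

definition mhd_solution ::
  "real \<Rightarrow> (real^'n \<Rightarrow> real^'n::finite) \<Rightarrow> (real^'n \<Rightarrow> real^'n) \<Rightarrow>
   (real \<Rightarrow> real^'n \<Rightarrow> real^'n) \<Rightarrow> (real \<Rightarrow> real^'n \<Rightarrow> real^'n) \<Rightarrow> bool" where
  "mhd_solution \<delta> u0 B0 u B \<longleftrightarrow>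
     (\<exists>Du DB p.
        leray_hopf_field u Du u0 \<and> leray_hopf_field B DB B0 \<and>
        locally_integrable spacetime (\<lambda>(t, x). p t x) \<and>
        momentum_equation u B Du DB p \<and>
        induction_equation \<delta> u B Du DB \<and>
        energy_inequality_from \<delta> u B Du DB 0 \<and>
        (AE s in lebesgue_on {0<..}. energy_inequality_from \<delta> u B Du DB s))"

end

theory Submission
  imports Defs "HOL-Probability.Probability"
begin

text \<open>Take \<open>B = 0\<close>, so that the system becomes the Navier--Stokes system, and look for odd velocity
  fields \<open>u t x = \<integral> c t \<xi> sin (\<xi> \<bullet> x) d\<xi>\<close>. The equation then is the real integral equation
  \<open>c' = - (norm \<xi>)\<^sup>2 c - P (\<integral> (\<xi> \<bullet> c (\<xi> - \<eta>)) c \<eta> d\<eta>)\<close> with \<open>P\<close> the projection orthogonal to \<open>\<xi>\<close>,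
  and \<open>L\<^sup>2\<close> norms are read off from \<open>c\<close> by Plancherel's theorem. If the data are concentrated at low
  frequencies, of size \<open>\<lambda>\<close>, while their \<open>L\<^sup>2\<close> norm is kept fixed, the solution keeps half of its
  norm up to any given time once \<open>\<lambda>\<close> is small enough, so no function of the time and of the initial
  norm alone can bound it and tend to zero.

  In the plane a Gaussian vortex solves the heat and the Navier--Stokes equations simultaneously. In
  space the nonlinearity is controlled by the weight \<open>w \<xi> = (norm \<xi>)\<^sup>-\<^sup>1 (1 + (norm \<xi>)\<^sup>2)\<^sup>-\<^sup>7\<close>: it satisfies
  \<open>w * w \<le> C (norm \<xi>) w\<close>, which is what the Picard iteration needs to contract in the norm
  \<open>sup norm (c t \<xi>) / w \<xi>\<close> for small data, uniformly in time, and \<open>C\<close> improves under dilation.\<close>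

section \<open>Integration with respect to Lebesgue measure\<close>

text \<open>Heat flow damps the amplitude at \<open>\<xi>\<close> by
  \<open>exp (- t * (norm \<xi>)^2)\<close>, so energy placed at low frequency outlives any given
  time; the danger is that the nonlinearity destroys it earlier. In dimension n, data
  \<open>A * a (\<xi> / l)\<close> keep their energy if \<open>A = l powr (- n / 2)\<close>, while
  the constant in \<open>w * w \<le> C * norm \<xi> * w\<close> scales like
  \<open>l ^ (n - 1)\<close>. The iteration needs \<open>A * C\<close> small, and this product
  scales like \<open>l powr (n / 2 - 1)\<close>. For n = 3 it tends to zero with l. For n = 2
  dilation gains nothing, and \<open>1 / norm \<xi>\<close> is not even square integrable at the
  origin, which is why the plane is settled by an explicit solution. The singularity of the weight
  is forced: \<open>w * w\<close> is positive at the origin, so \<open>norm \<xi> * w \<xi>\<close>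
  cannot tend to zero there. Uniformity in time comes from the heat kernel, whose time integral
  times \<open>(norm \<xi>)^2\<close> is at most one: it pays for two powers of
  \<open>norm \<xi>\<close>, one carried by the nonlinearity and one left by the convolution
  inequality.\<close>

lemma integral_lebesgue_lborel:
  fixes f :: "'a::euclidean_space \<Rightarrow> 'b::{banach,second_countable_topology}"
  assumes "f \<in> borel_measurable borel"
  shows "integral\<^sup>L lebesgue f = integral\<^sup>L lborel f"
  using assms by (intro integral_completion) simp

text \<open>The weak equations integrate over \<open>lebesgue_on spacetime\<close>. Their integrands
  contain a test function and vanish off that set, so the restriction and the completion can both be
  dropped and the computations, Fubini in particular, take place in \<open>lborel\<close>.\<close>

lemma integral_lebesgue_on_lborel:
  fixes f :: "'a::euclidean_space \<Rightarrow> 'b::{banach,second_countable_topology}"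
  assumes "S \<in> sets borel" "f \<in> borel_measurable borel" "\<And>x. x \<notin> S \<Longrightarrow> f x = 0"
  shows "integral\<^sup>L (lebesgue_on S) f = integral\<^sup>L lborel f"
proof -
  have "S \<in> sets lebesgue" using assms(1) by auto
  then have "integral\<^sup>L (lebesgue_on S) f = (\<integral>x. indicator S x *\<^sub>R f x \<partial>lebesgue)"
    by (subst integral_restrict_space) (auto simp: Int_absorb1 set_lebesgue_integral_def)
  also have "(\<lambda>x. indicator S x *\<^sub>R f x) = f"
    using assms(3) by (auto simp: fun_eq_iff indicator_def)
  finally show ?thesis using integral_lebesgue_lborel[OF assms(2)] by simp
qed

lemma borel_measurable_lebesgue_on_lborel:
  fixes f :: "'a::euclidean_space \<Rightarrow> 'b::{banach,second_countable_topology}"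
  assumes "f \<in> borel_measurable borel"
  shows "f \<in> borel_measurable (lebesgue_on S)"
  using assms by (intro measurable_restrict_space1 measurable_completion) simp

lemma lborel_integral_affine:
  fixes f :: "'a::euclidean_space \<Rightarrow> 'b::{banach,second_countable_topology}"
  assumes f[measurable]: "f \<in> borel_measurable borel" and c: "c \<noteq> 0"
  shows "integral\<^sup>L lborel f = \<bar>c\<bar>^DIM('a) *\<^sub>R (\<integral>x. f (t + c *\<^sub>R x) \<partial>lborel)"
  by (subst lborel_affine[OF c, of t]) (simp add: integral_density integral_distr)

lemma lborel_integrable_affine_iff:
  fixes f :: "'a::euclidean_space \<Rightarrow> 'b::{banach,second_countable_topology}"
  assumes f[measurable]: "f \<in> borel_measurable borel" and c: "c \<noteq> 0"
  shows "integrable lborel (\<lambda>x. f (t + c *\<^sub>R x)) \<longleftrightarrow> integrable lborel f"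
proof -
  have "integrable lborel f \<longleftrightarrow> integrable (density (distr lborel borel (\<lambda>x. t + c *\<^sub>R x)) (\<lambda>_. ennreal (\<bar>c\<bar>^DIM('a)))) f"
    using lborel_affine[OF c, of t] by (simp add: ennreal_power)
  also have "\<dots> \<longleftrightarrow> integrable lborel (\<lambda>x. f (t + c *\<^sub>R x))"
    using c integrable_scaleR_right[of "inverse (\<bar>c\<bar>^DIM('a))" lborel "\<lambda>x. \<bar>c\<bar>^DIM('a) *\<^sub>R f (t + c *\<^sub>R x)"]
    by (subst integrable_density) (auto simp: integrable_distr_eq)
  finally show ?thesis by simp
qed

lemma lborel_integral_reflect:
  fixes f :: "'a::euclidean_space \<Rightarrow> 'b::{banach,second_countable_topology}"
  assumes f[measurable]: "f \<in> borel_measurable borel"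
  shows "(\<integral>x. f (a - x) \<partial>lborel) = integral\<^sup>L lborel f"
    and "integrable lborel (\<lambda>x. f (a - x)) \<longleftrightarrow> integrable lborel f"
  using lborel_integral_affine[OF f, of "-1" a] lborel_integrable_affine_iff[OF f, of "-1" a]
  by simp_all

lemma lborel_integral_translate:
  fixes f :: "'a::euclidean_space \<Rightarrow> 'b::{banach,second_countable_topology}"
  assumes f[measurable]: "f \<in> borel_measurable borel"
  shows "(\<integral>x. f (a + x) \<partial>lborel) = integral\<^sup>L lborel f"
    and "integrable lborel (\<lambda>x. f (a + x)) \<longleftrightarrow> integrable lborel f"
  using lborel_integral_affine[OF f, of "1" a] lborel_integrable_affine_iff[OF f, of "1" a]
  by simp_all

text \<open>Parity replaces complex Fourier analysis: it removes the cosine transform of odd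
  amplitudes, the sine transform of even ones, and the odd half of the vortex integral.\<close>

lemma integral_odd_eq_0:
  fixes f :: "'a::euclidean_space \<Rightarrow> 'b::{banach,second_countable_topology}"
  assumes f[measurable]: "f \<in> borel_measurable borel" and odd: "\<And>x. f (- x) = - f x"
  shows "integral\<^sup>L lborel f = 0"
proof -
  have "integral\<^sup>L lborel f = - integral\<^sup>L lborel f"
    using lborel_integral_reflect(1)[OF f, of 0] by (simp add: odd)
  then have "2 *\<^sub>R integral\<^sup>L lborel f = 0" 
    by (simp add: scaleR_2 eq_neg_iff_add_eq_0)
  then show ?thesis by simp
qed

lemma integrable_lborel_pair_mult:
  fixes f :: "'a::euclidean_space \<Rightarrow> real" and g :: "'b::euclidean_space \<Rightarrow> real"
  assumes f: "integrable lborel f" and g: "integrable lborel g"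
  shows "integrable (lborel \<Otimes>\<^sub>M lborel) (\<lambda>(x, y). f x * g y)"
proof -
  note [measurable] = f[THEN borel_measurable_integrable] g[THEN borel_measurable_integrable]
  show ?thesis
    by (intro lborel_pair.Fubini_integrable) (auto simp: f g abs_mult)
qed

text \<open>Interchanges of frequency integrals with integrals over space or time are justified by a
  separable majorant: an amplitude bound in one variable, a Gaussian, a test function or an
  indicator in the other.\<close>

lemma dominated_Fubini:
  fixes F :: "'a::euclidean_space \<Rightarrow> 'b::euclidean_space \<Rightarrow> real"
  assumes F[measurable]: "case_prod F \<in> borel_measurable (borel \<Otimes>\<^sub>M borel)"
    and W: "integrable lborel W" and V: "integrable lborel V"
    and le: "\<And>x y. \<bar>F x y\<bar> \<le> W x * V y"
  shows "(\<integral>y. (\<integral>x. F x y \<partial>lborel) \<partial>lborel) = (\<integral>x. (\<integral>y. F x y \<partial>lborel) \<partial>lborel)"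
    and "integrable lborel (\<lambda>y. \<integral>x. F x y \<partial>lborel)"
    and "integrable lborel (\<lambda>x. \<integral>y. F x y \<partial>lborel)"
proof -
  have i: "integrable (lborel \<Otimes>\<^sub>M lborel) (case_prod F)"
    by (rule Bochner_Integration.integrable_bound[OF integrable_lborel_pair_mult[OF W V]])
       (use le in \<open>auto intro!: AE_I2 order_trans[OF le]\<close>)
  show "(\<integral>y. (\<integral>x. F x y \<partial>lborel) \<partial>lborel) = (\<integral>x. (\<integral>y. F x y \<partial>lborel) \<partial>lborel)"
    using lborel_pair.Fubini_integral[OF i] .
  show "integrable lborel (\<lambda>y. \<integral>x. F x y \<partial>lborel)"
    using lborel_pair.integrable_snd[OF i] .
  show "integrable lborel (\<lambda>x. \<integral>y. F x y \<partial>lborel)"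
    using lborel_pair.integrable_fst[OF i] .
qed

lemma integrable_convolution_pair:
  fixes f g :: "'a::euclidean_space \<Rightarrow> real"
  assumes f: "integrable lborel f" and g: "integrable lborel g"
  shows "integrable (lborel \<Otimes>\<^sub>M lborel) (\<lambda>(x, y). f (x - y) * g y)"
proof -
  note [measurable] = f[THEN borel_measurable_integrable] g[THEN borel_measurable_integrable]
  have tr: "(\<integral>x. norm (f (x - y)) \<partial>lborel) = (\<integral>x. norm (f x) \<partial>lborel)"
     and tri: "integrable lborel (\<lambda>x. f (x - y))" for y
    using lborel_integral_translate(1)[of "\<lambda>x. norm (f x)" "-y"]
      lborel_integral_translate(2)[of "f" "-y"] f by auto
  have "integrable (lborel \<Otimes>\<^sub>M lborel) (\<lambda>(y, x). f (x - y) * g y)"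
    by (intro lborel_pair.Fubini_integrable)
       (use tr tri g in \<open>auto simp: abs_mult\<close>)
  from lborel_pair.integrable_product_swap[OF this] show ?thesis by (simp add: case_prod_unfold)
qed

lemma integrable_convolution:
  fixes f g :: "'a::euclidean_space \<Rightarrow> real"
  assumes f: "integrable lborel f" and g: "integrable lborel g"
  shows "integrable lborel (\<lambda>x. \<integral>y. f (x - y) * g y \<partial>lborel)"
  using lborel_pair.integrable_fst[OF integrable_convolution_pair[OF assms]] by simp

text \<open>For fixed \<open>y\<close> the shift by \<open>y\<close> makes the sum
  \<open>x + y\<close> the new variable. With \<open>h\<close> a sine this is the convolution
  theorem: in a product of waves the frequencies add.\<close>

lemma integral_convolution:
  fixes f g h :: "'a::euclidean_space \<Rightarrow> real"
  assumes f: "integrable lborel f" and g: "integrable lborel g"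
    and h[measurable]: "h \<in> borel_measurable borel" and hB: "\<And>x. \<bar>h x\<bar> \<le> B"
  shows "(\<integral>y. (\<integral>x. h (x + y) * f x * g y \<partial>lborel) \<partial>lborel) =
         (\<integral>x. h x * (\<integral>y. f (x - y) * g y \<partial>lborel) \<partial>lborel)"
proof -
  note [measurable] = f[THEN borel_measurable_integrable] g[THEN borel_measurable_integrable]
  have i: "integrable (lborel \<Otimes>\<^sub>M lborel) (\<lambda>(x, y). h x * (f (x - y) * g y))"
    by (rule Bochner_Integration.integrable_bound[OF integrable_mult_right[OF integrable_convolution_pair[OF f g], of B]])
       (use order_trans[OF hB abs_ge_self] in \<open>auto intro!: AE_I2 mult_mono simp: abs_mult mult.assoc\<close>)
  have "(\<integral>x. h (x + y) * f x * g y \<partial>lborel) = (\<integral>x. h x * (f (x - y) * g y) \<partial>lborel)" for y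
    using lborel_integral_translate(1)[of "\<lambda>x. h x * (f (x - y) * g y)" y]
    by (simp add: mult.assoc add.commute)
  then have "(\<integral>y. (\<integral>x. h (x + y) * f x * g y \<partial>lborel) \<partial>lborel) =
        (\<integral>y. (\<integral>x. h x * (f (x - y) * g y) \<partial>lborel) \<partial>lborel)"
    by simp
  also have "\<dots> = (\<integral>x. (\<integral>y. h x * (f (x - y) * g y) \<partial>lborel) \<partial>lborel)"
    using lborel_pair.Fubini_integral[OF i] .
  finally show ?thesis by simp
qed

lemma integrable_bounded_mult:
  fixes f h :: "'a::euclidean_space \<Rightarrow> real"
  assumes f: "integrable lborel f" and h[measurable]: "h \<in> borel_measurable borel"
    and hB: "\<And>x. \<bar>h x\<bar> \<le> B"
  shows "integrable lborel (\<lambda>x. h x * f x)"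
proof -
  note [measurable] = f[THEN borel_measurable_integrable]
  show ?thesis
    by (rule Bochner_Integration.integrable_bound[OF integrable_mult_right[OF f, of B]])
       (use order_trans[OF hB abs_ge_self] in \<open>auto intro!: mult_mono simp: abs_mult\<close>)
qed

lemma integrable_dominated:
  fixes f :: "'a::euclidean_space \<Rightarrow> 'b::{banach,second_countable_topology}"
  assumes "integrable lborel g" "f \<in> borel_measurable borel" "\<And>x. norm (f x) \<le> g x"
  shows "integrable lborel f"
  using assms(2) by (intro Bochner_Integration.integrable_bound[OF assms(1)])
    (auto intro!: AE_I2 order_trans[OF assms(3)])

lemma integrable_mult_of_square:
  fixes f g :: "'a::euclidean_space \<Rightarrow> real"
  assumes "f \<in> borel_measurable borel" "g \<in> borel_measurable borel"
    "integrable lborel (\<lambda>x. (f x)\<^sup>2)" "integrable lborel (\<lambda>x. (g x)\<^sup>2)"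
  shows "integrable lborel (\<lambda>x. f x * g x)"
proof (rule integrable_dominated[of "\<lambda>x. (f x)\<^sup>2 + (g x)\<^sup>2"])
  fix x show "norm (f x * g x) \<le> (f x)\<^sup>2 + (g x)\<^sup>2"
    using sum_squares_bound[of "\<bar>f x\<bar>" "\<bar>g x\<bar>"] mult_nonneg_nonneg[of "\<bar>f x\<bar>" "\<bar>g x\<bar>"]
    by (simp add: abs_mult mult.assoc del: mult_nonneg_nonneg)
qed (use assms in auto)

text \<open>The arithmetic-geometric form of Cauchy-Schwarz. It loses nothing for a convolution of
  \<open>W\<close> with itself, where both square integrals agree by reflection.\<close>

lemma integral_mult_le_square:
  fixes f g :: "'a::euclidean_space \<Rightarrow> real"
  assumes "f \<in> borel_measurable borel" "g \<in> borel_measurable borel"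
    "integrable lborel (\<lambda>x. (f x)\<^sup>2)" "integrable lborel (\<lambda>x. (g x)\<^sup>2)"
  shows "2 * (\<integral>x. f x * g x \<partial>lborel) \<le> (\<integral>x. (f x)\<^sup>2 \<partial>lborel) + (\<integral>x. (g x)\<^sup>2 \<partial>lborel)"
proof -
  have "(\<integral>x. 2 * f x * g x \<partial>lborel) \<le> (\<integral>x. (f x)\<^sup>2 + (g x)\<^sup>2 \<partial>lborel)"
    using integrable_mult_of_square[OF assms] assms sum_squares_bound
    by (intro integral_mono) (auto simp: mult.assoc)
  then show ?thesis using assms by (simp add: mult.assoc)
qed


section \<open>Integration by parts against test functions\<close>

text \<open>Difference quotients of an integrable function have integral zero by translation
  invariance; they converge to \<open>g'\<close> and are dominated thanks to the bound
  \<open>M\<close> and the compact support. Only the derivative in direction \<open>b\<close>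
  enters, so time and space directions are treated alike.\<close>

lemma integral_directional_derivative_eq_0:
  fixes g g' :: "'a::euclidean_space \<Rightarrow> real"
  assumes g: "integrable lborel g" and g'[measurable]: "g' \<in> borel_measurable borel"
    and K: "compact K" "\<And>x. x \<notin> K \<Longrightarrow> g x = 0"
    and der: "\<And>z. ((\<lambda>h. g (z + h *\<^sub>R b)) has_real_derivative g' z) (at 0)"
    and M: "\<And>z. \<bar>g' z\<bar> \<le> M"
  shows "(\<integral>z. g' z \<partial>lborel) = 0"
proof -
  note [measurable] = g[THEN borel_measurable_integrable]
  define F where "F n z = real (Suc n) * (g (z + (1 / real (Suc n)) *\<^sub>R b) - g z)" for n z
  \<comment> \<open>All points from which some \<open>s\<close> in \<open>{0..1}\<close> leads into
    \<open>K\<close> along \<open>b\<close>. The increments \<open>1 / (n + 1)\<close> lie in that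
    interval, so every difference quotient vanishes outside \<open>K'\<close>.\<close>
  define K' where "K' = (\<lambda>(x, s). x - s *\<^sub>R b) ` (K \<times> {0..1::real})"
  have M0: "0 \<le> M" using M[of 0] by (rule order_trans[OF abs_ge_zero])
  have K': "compact K'"
    unfolding K'_def case_prod_unfold
    by (intro compact_continuous_image continuous_intros compact_Times K compact_Icc)
  have der2: "((\<lambda>h. g (z + h *\<^sub>R b)) has_real_derivative g' (z + t *\<^sub>R b)) (at t)" for z t
  proof -
    have "((\<lambda>h. g ((z + t *\<^sub>R b) + (h - t) *\<^sub>R b)) has_real_derivative g' (z + t *\<^sub>R b) * (1 - 0)) (at t)"
      by (rule DERIV_chain2[where g = "\<lambda>h. h - t"]) (use der[of "z + t *\<^sub>R b"] in \<open>auto intro!: derivative_eq_intros\<close>)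
    then show ?thesis by (simp add: algebra_simps)
  qed
  have bound: "norm (F n z) \<le> M * indicator K' z" for n z
  proof (cases "z \<in> K'")
    case True
    define e where "e = 1 / real (Suc n)"
    have e: "e > 0" unfolding e_def by simp
    obtain s where "g (z + e *\<^sub>R b) - g (z + 0 *\<^sub>R b) = (e - 0) * g' (z + s *\<^sub>R b)"
      using MVT2[OF e, of "\<lambda>h. g (z + h *\<^sub>R b)" "\<lambda>t. g' (z + t *\<^sub>R b)"] der2 by blast
    then have "F n z = g' (z + s *\<^sub>R b)" unfolding F_def e_def by simp
    then show ?thesis using M True by simp
  next
    case False
    have "z + s *\<^sub>R b \<notin> K" if "s \<in> {0..1}" for s
    proof
      assume "z + s *\<^sub>R b \<in> K"
      then have "(\<lambda>(x, s). x - s *\<^sub>R b) (z + s *\<^sub>R b, s) \<in> K'"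
        unfolding K'_def using that by (intro imageI) simp
      then show False using False by simp
    qed
    from this[of 0] this[of "1 / real (Suc n)"] have "F n z = 0"
      unfolding F_def using K(2) by simp
    then show ?thesis using False by simp
  qed
  have lim: "(\<lambda>n. F n z) \<longlonglongrightarrow> g' z" for z
  proof -
    have "((\<lambda>h. (g (z + h *\<^sub>R b) - g z) / h) \<longlongrightarrow> g' z) (at 0)"
      using der[of z] by (simp add: DERIV_def)
    moreover have "filterlim (\<lambda>n. 1 / real (Suc n)) (at 0) sequentially"
      by (intro filterlim_atI LIMSEQ_Suc lim_1_over_n) auto
    ultimately have "(\<lambda>n. (g (z + (1 / real (Suc n)) *\<^sub>R b) - g z) / (1 / real (Suc n))) \<longlonglongrightarrow> g' z"
      by (rule filterlim_compose)
    then show ?thesis unfolding F_def by (simp add: mult.commute)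
  qed
  have "(\<lambda>n. \<integral>z. F n z \<partial>lborel) \<longlonglongrightarrow> (\<integral>z. g' z \<partial>lborel)"
  proof (rule integral_dominated_convergence[where w = "\<lambda>z. M * indicator K' z"])
    show "integrable lborel (\<lambda>z. M * indicator K' z)"
      using K' emeasure_compact_finite[OF K'] by (intro integrable_mult_right integrable_real_indicator)
        (auto simp: borel_compact)
  qed (use bound lim in \<open>auto simp: F_def[abs_def]\<close>)
  moreover have "(\<integral>z. F n z \<partial>lborel) = 0" for n
  proof -
    have gm: "g \<in> borel_measurable borel" by simp
    have *: "integrable lborel (\<lambda>z. g (z + (1 / real (Suc n)) *\<^sub>R b))"
      "(\<integral>z. g (z + (1 / real (Suc n)) *\<^sub>R b) \<partial>lborel) = integral\<^sup>L lborel g"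
      using lborel_integral_translate[OF gm, of "(1 / real (Suc n)) *\<^sub>R b"] g by (simp_all add: add.commute)
    show ?thesis unfolding F_def using * g by simp
  qed
  ultimately show ?thesis by (simp add: LIMSEQ_const_iff)
qed

lemma dir_deriv_has_real_derivative:
  assumes "f differentiable (at z)"
  shows "((\<lambda>h. f (z + h *\<^sub>R b)) has_real_derivative dir_deriv b f z) (at 0)"
proof -
  have 1: "(f has_derivative frechet_derivative f (at z)) (at (z + 0 *\<^sub>R b))"
    using assms frechet_derivative_works by auto
  have "((\<lambda>h. f (z + h *\<^sub>R b)) has_derivative (\<lambda>h. frechet_derivative f (at z) (h *\<^sub>R b))) (at 0)"
    by (rule has_derivative_compose[where f = "\<lambda>h. z + h *\<^sub>R b" and g = f, OF _ 1])
      (auto intro!: derivative_eq_intros)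
  then show ?thesis
    using linear_frechet_derivative[OF assms]
    by (simp add: has_field_derivative_def dir_deriv_def linear_cmul mult_commute_abs)
qed

text \<open>The recursion strips the outermost derivative, whereas smoothness of a derivative of
  \<open>f\<close> needs the innermost one split off.\<close>

lemma iter_dir_deriv_snoc: "iter_dir_deriv (vs @ [v]) f = iter_dir_deriv vs (dir_deriv v f)"
  by (induction vs) auto

lemma test_functions_dir_deriv:
  assumes "\<phi> \<in> test_functions U" "b \<in> Basis"
  shows "dir_deriv b \<phi> \<in> test_functions U"
proof -
  have sm: "smooth (dir_deriv b \<phi>)"
    unfolding smooth_def
  proof (intro ballI allI)
    fix vs z assume "vs \<in> lists (Basis :: 'a set)"
    then have "vs @ [b] \<in> lists Basis" using assms(2) by auto
    then show "iter_dir_deriv vs (dir_deriv b \<phi>) differentiable at z"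
      using assms(1) by (auto simp only: test_functions_def smooth_def mem_Collect_eq simp flip: iter_dir_deriv_snoc)
  qed
  let ?S = "closure {z. \<phi> z \<noteq> 0}"
  have "{z. dir_deriv b \<phi> z \<noteq> 0} \<subseteq> ?S"
  proof
    fix z assume *: "z \<in> {z. dir_deriv b \<phi> z \<noteq> 0}"
    show "z \<in> ?S"
    proof (rule ccontr)
      assume z: "z \<notin> ?S"
      have "(\<phi> has_derivative (\<lambda>_. 0)) (at z)"
      proof (rule has_derivative_transform_within_open[where f = "\<lambda>_. 0" and s = "- ?S"])
        show "0 = \<phi> x" if "x \<in> - ?S" for x
          using that closure_subset[of "{z. \<phi> z \<noteq> 0}"] by auto
      qed (use z in auto)
      then have "frechet_derivative \<phi> (at z) = (\<lambda>_. 0)"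
        by (rule frechet_derivative_at[symmetric])
      then show False using * by (simp add: dir_deriv_def)
    qed
  qed
  then have sub: "closure {z. dir_deriv b \<phi> z \<noteq> 0} \<subseteq> ?S"
    by (simp add: closure_minimal)
  then have "compact (closure {z. dir_deriv b \<phi> z \<noteq> 0})"
    using assms(1) compact_Int_closed[of ?S "closure {z. dir_deriv b \<phi> z \<noteq> 0}"]
    by (simp add: test_functions_def Int_absorb1)
  then show ?thesis using sm sub assms(1) unfolding test_functions_def by auto
qed

lemma test_functions_differentiable:
  assumes "\<phi> \<in> test_functions U" shows "\<phi> differentiable (at z)"
proof -
  have "iter_dir_deriv [] \<phi> differentiable (at z)"
    using assms by (auto simp only: test_functions_def smooth_def mem_Collect_eq)
  then show ?thesis by simp
qed

lemma test_functions_continuous: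
  assumes "\<phi> \<in> test_functions U" shows "continuous_on UNIV \<phi>"
  using test_functions_differentiable[OF assms]
  by (simp add: continuous_at_imp_continuous_on differentiable_imp_continuous_within)

lemma test_functions_measurable:
  assumes "\<phi> \<in> test_functions U" shows "\<phi> \<in> borel_measurable borel"
  using test_functions_continuous[OF assms] by (rule borel_measurable_continuous_onI)

lemma test_functions_eq_0:
  assumes "\<phi> \<in> test_functions U" "x \<notin> closure {z. \<phi> z \<noteq> 0}" shows "\<phi> x = 0"
  using assms(2) closure_subset[of "{z. \<phi> z \<noteq> 0}"] by auto

lemma test_functions_eq_0_outside:
  assumes "\<phi> \<in> test_functions U" "x \<notin> U" shows "\<phi> x = 0"
  using assms test_functions_eq_0[OF assms(1), of x] unfolding test_functions_def by auto

lemma test_functions_integrable: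
  assumes "\<phi> \<in> test_functions U" shows "integrable lborel \<phi>"
proof -
  define S where "S = closure {z. \<phi> z \<noteq> 0}"
  have S: "compact S" using assms by (simp add: test_functions_def S_def)
  have "\<phi> x = 0" if "x \<notin> S" for x
    using test_functions_eq_0[OF assms, of x] that unfolding S_def by blast
  then have "(\<lambda>x. indicator S x *\<^sub>R \<phi> x) = \<phi>"
    by (auto simp: fun_eq_iff indicator_def)
  then show ?thesis
    using borel_integrable_compact[OF S continuous_on_subset[OF test_functions_continuous[OF assms] subset_UNIV]]
    by (simp only:)
qed

lemma test_functions_bounded:
  assumes "\<phi> \<in> test_functions U" shows "\<exists>M. \<forall>x. \<bar>\<phi> x\<bar> \<le> M"
proof -
  let ?S = "closure {z. \<phi> z \<noteq> 0}"
  have "compact (\<phi> ` ?S)"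
    using assms
    by (intro compact_continuous_image continuous_on_subset[OF test_functions_continuous[OF assms] subset_UNIV])
      (auto simp: test_functions_def)
  then have "bounded (\<phi> ` ?S)" by (rule compact_imp_bounded)
  then obtain M where M: "\<And>y. y \<in> \<phi> ` ?S \<Longrightarrow> \<bar>y\<bar> \<le> M"
    unfolding bounded_iff real_norm_def by auto
  have "\<bar>\<phi> x\<bar> \<le> max 0 M" for x
    using M[of "\<phi> x"] test_functions_eq_0[OF assms, of x] by (cases "x \<in> ?S") auto
  then show ?thesis by blast
qed

text \<open>The derivative of \<open>f\<close> is asked for on \<open>U\<close> alone, because the
  amplitudes satisfy their differential equation only for positive times. Off the support of
  \<open>\<phi>\<close> the product vanishes in a neighbourhood and has derivative zero for that
  reason.\<close>

lemma integration_by_parts_test_functions: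
  fixes f f' :: "'a::euclidean_space \<Rightarrow> real"
  assumes \<phi>: "\<phi> \<in> test_functions U" and b: "b \<in> Basis"
    and f[measurable]: "f \<in> borel_measurable borel" and f'[measurable]: "f' \<in> borel_measurable borel"
    and der: "\<And>z. z \<in> U \<Longrightarrow> ((\<lambda>h. f (z + h *\<^sub>R b)) has_real_derivative f' z) (at 0)"
    and M: "\<And>z. \<bar>f z\<bar> \<le> M" and M': "\<And>z. \<bar>f' z\<bar> \<le> M'"
  shows "(\<integral>z. f z * dir_deriv b \<phi> z \<partial>lborel) = - (\<integral>z. f' z * \<phi> z \<partial>lborel)"
proof -
  let ?S = "closure {z. \<phi> z \<noteq> 0}"
  note \<phi>' = test_functions_dir_deriv[OF \<phi> b]
  note [measurable] = test_functions_measurable[OF \<phi>] test_functions_measurable[OF \<phi>']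
  obtain A where A: "\<And>x. \<bar>\<phi> x\<bar> \<le> A" using test_functions_bounded[OF \<phi>] by auto
  obtain A' where A': "\<And>x. \<bar>dir_deriv b \<phi> x\<bar> \<le> A'" using test_functions_bounded[OF \<phi>'] by auto
  have i1: "integrable lborel (\<lambda>z. f z * dir_deriv b \<phi> z)"
    and i2: "integrable lborel (\<lambda>z. f' z * \<phi> z)"
    and i3: "integrable lborel (\<lambda>z. f z * \<phi> z)"
    by (rule integrable_bounded_mult[OF test_functions_integrable[OF \<phi>'] f M],
        rule integrable_bounded_mult[OF test_functions_integrable[OF \<phi>] f' M'],
        rule integrable_bounded_mult[OF test_functions_integrable[OF \<phi>] f M])
  have S: "compact ?S" "?S \<subseteq> U" using \<phi> by (auto simp: test_functions_def)
  have "(\<integral>z. f' z * \<phi> z + f z * dir_deriv b \<phi> z \<partial>lborel) = 0"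
  proof (rule integral_directional_derivative_eq_0[OF i3 _ S(1), where M = "M' * A + M * A'"])
    fix z
    show "((\<lambda>h. f (z + h *\<^sub>R b) * \<phi> (z + h *\<^sub>R b)) has_real_derivative f' z * \<phi> z + f z * dir_deriv b \<phi> z) (at 0)"
    proof (cases "z \<in> ?S")
      case True
      then have "z \<in> U" using S(2) by blast
      from DERIV_mult[OF der[OF this] dir_deriv_has_real_derivative[OF test_functions_differentiable[OF \<phi>, of z], of b]]
      show ?thesis by (simp add: mult.commute)
    next
      case False
      have z0: "\<phi> z = 0" using test_functions_eq_0[OF \<phi> False] .
      have d0: "dir_deriv b \<phi> z = 0"
      proof (rule ccontr)
        assume "dir_deriv b \<phi> z \<noteq> 0"
        have "\<forall>\<^sub>F h in nhds 0. (z + h *\<^sub>R b) \<in> - ?S"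
        proof (rule topological_tendstoD)
          show "((\<lambda>h. z + h *\<^sub>R b) \<longlongrightarrow> z) (nhds 0)"
            by (rule tendsto_eq_rhs, (rule tendsto_intros filterlim_ident)+) simp
        qed (use False in auto)
        then have "\<forall>\<^sub>F h in nhds 0. \<phi> (z + h *\<^sub>R b) = 0"
          by (rule eventually_mono) (rule test_functions_eq_0[OF \<phi>], blast)
        then have "((\<lambda>h. \<phi> (z + h *\<^sub>R b)) has_real_derivative 0) (at 0)"
          by (subst DERIV_cong_ev[OF refl, where g = "\<lambda>_. 0"]) auto
        then show False
          using DERIV_unique dir_deriv_has_real_derivative[OF test_functions_differentiable[OF \<phi>], of z b]
            \<open>dir_deriv b \<phi> z \<noteq> 0\<close> by blast
      qed
      have "\<forall>\<^sub>F h in nhds 0. (z + h *\<^sub>R b) \<in> - ?S"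
      proof (rule topological_tendstoD)
        show "((\<lambda>h. z + h *\<^sub>R b) \<longlongrightarrow> z) (nhds 0)"
          by (rule tendsto_eq_rhs, (rule tendsto_intros filterlim_ident)+) simp
      qed (use False in auto)
      then have "\<forall>\<^sub>F h in nhds 0. f (z + h *\<^sub>R b) * \<phi> (z + h *\<^sub>R b) = 0"
        by (rule eventually_mono) (metis ComplD mult_zero_right test_functions_eq_0[OF \<phi>])
      then have "((\<lambda>h. f (z + h *\<^sub>R b) * \<phi> (z + h *\<^sub>R b)) has_real_derivative 0) (at 0)"
        by (subst DERIV_cong_ev[OF refl, where g = "\<lambda>_. 0"]) auto
      then show ?thesis using z0 d0 by simp
    qed
    have "\<bar>f' z * \<phi> z\<bar> \<le> M' * A"
      unfolding abs_mult using M'[of z] A[of z] by (rule mult_mono') simp_all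
    moreover have "\<bar>f z * dir_deriv b \<phi> z\<bar> \<le> M * A'"
      unfolding abs_mult using M[of z] A'[of z] by (rule mult_mono') simp_all
    ultimately show "\<bar>f' z * \<phi> z + f z * dir_deriv b \<phi> z\<bar> \<le> M' * A + M * A'" by linarith
  next
    show "f x * \<phi> x = 0" if "x \<notin> ?S" for x
      using test_functions_eq_0[OF \<phi> that] by (simp only: mult_zero_right)
  next
    show "(\<lambda>z. f' z * \<phi> z + f z * dir_deriv b \<phi> z) \<in> borel_measurable borel"
      by measurable
  qed
  then have "(\<integral>z. f' z * \<phi> z \<partial>lborel) + (\<integral>z. f z * dir_deriv b \<phi> z \<partial>lborel) = 0"
    using Bochner_Integration.integral_add[OF i2 i1] by simp
  then show ?thesis by linarith
qed


section \<open>Plancherel's theorem\<close>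

lemma lborel_integral_prod_Basis:
  fixes f :: "'a::euclidean_space \<Rightarrow> real \<Rightarrow> 'b::{real_normed_field,banach,second_countable_topology}"
  assumes f: "\<And>b. b \<in> Basis \<Longrightarrow> integrable lborel (f b)"
  shows "integrable lborel (\<lambda>x::'a. \<Prod>b\<in>Basis. f b (x \<bullet> b))"
    and "(\<integral>x. (\<Prod>b\<in>Basis. f b (x \<bullet> b)) \<partial>(lborel :: 'a measure)) = (\<Prod>b\<in>Basis. \<integral>x. f b x \<partial>lborel)"
proof -
  interpret product_sigma_finite "\<lambda>_::'a. lborel :: real measure" ..
  have m[measurable]: "b \<in> Basis \<Longrightarrow> f b \<in> borel_measurable borel" for b
    using f[THEN borel_measurable_integrable] by simp
  have m1: "(\<lambda>x::'a. \<Prod>b\<in>Basis. f b (x \<bullet> b)) \<in> borel_measurable borel"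
    by (intro borel_measurable_prod) measurable
  have m2: "(\<lambda>f. \<Sum>b\<in>(Basis::'a set). f b *\<^sub>R b) \<in> (\<Pi>\<^sub>M b\<in>Basis. lborel :: real measure) \<rightarrow>\<^sub>M borel"
    by measurable
  have eq: "(\<Prod>b\<in>Basis. f b ((\<Sum>b\<in>Basis. y b *\<^sub>R b) \<bullet> b)) = (\<Prod>b\<in>Basis. f b (y b))" for y :: "'a \<Rightarrow> real"
    by (intro prod.cong refl) (simp add: inner_sum_left_Basis)
  show "integrable lborel (\<lambda>x::'a. \<Prod>b\<in>Basis. f b (x \<bullet> b))"
    unfolding lborel_eq[where 'a = 'a]
    using product_integrable_prod[OF finite_Basis f] m1 m2
    by (subst integrable_distr_eq) (auto simp: eq)
  show "(\<integral>x. (\<Prod>b\<in>Basis. f b (x \<bullet> b)) \<partial>(lborel :: 'a measure)) = (\<Prod>b\<in>Basis. \<integral>x. f b x \<partial>lborel)"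
    unfolding lborel_eq[where 'a = 'a]
    using product_integral_prod[OF finite_Basis f] m1 m2
    by (subst integral_distr) (auto simp: eq simp flip: lborel_eq)
qed

definition gauss :: "'a::euclidean_space \<Rightarrow> real" where
  "gauss x = exp (- (norm x)\<^sup>2 / 2)"

text \<open>The square of this constant, \<open>(2 * pi) ^ n\<close>, is the Plancherel constant for
  transforms without a prefactor.\<close>

definition gauss_mass :: "'a::euclidean_space itself \<Rightarrow> real" where
  "gauss_mass _ = sqrt (2 * pi) ^ DIM('a)"

lemma gauss_mass_pos: "gauss_mass TYPE('a::euclidean_space) > 0"
  by (simp add: gauss_mass_def)

lemma gauss_measurable: "gauss \<in> borel_measurable borel"
  unfolding gauss_def[abs_def] by measurable

lemma gauss_nonneg: "0 \<le> gauss x" and gauss_le_1: "gauss x \<le> 1"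
  by (auto simp: gauss_def)

lemma gauss_eq_prod: "gauss x = (\<Prod>b\<in>Basis. exp (- (x \<bullet> b)\<^sup>2 / 2))"
proof -
  have "(norm x)\<^sup>2 = (\<Sum>b\<in>Basis. (x \<bullet> b)\<^sup>2)"
    by (subst norm_eq_sqrt_inner, subst euclidean_inner) (simp add: sum_nonneg power2_eq_square)
  then show ?thesis
    by (simp add: gauss_def exp_sum[symmetric] sum_negf sum_divide_distrib)
qed

text \<open>Up to normalisation this is the characteristic function of the standard normal
  distribution.\<close>

lemma gauss_fourier_real:
  "integrable lborel (\<lambda>x. complex_of_real (exp (- x\<^sup>2 / 2)) * cis (t * x))"
  "(\<integral>x. complex_of_real (exp (- x\<^sup>2 / 2)) * cis (t * x) \<partial>lborel) = complex_of_real (sqrt (2 * pi) * exp (- t\<^sup>2 / 2))"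
proof -
  have e: "complex_of_real (exp (- x\<^sup>2 / 2)) * cis (t * x) =
     complex_of_real (sqrt (2 * pi)) * (std_normal_density x *\<^sub>R cis (t * x))" for x
    unfolding std_normal_density_def by (simp add: scaleR_conv_of_real real_sqrt_mult)
  have i: "integrable lborel (\<lambda>x. std_normal_density x *\<^sub>R cis (t * x))"
  proof (rule Bochner_Integration.integrable_bound[OF integrable_std_normal_moment[of 0]])
    have [measurable]: "(\<lambda>x. cis (t * x)) \<in> borel_measurable borel"
      by (intro borel_measurable_continuous_onI) (auto simp: cis_conv_exp intro!: continuous_intros)
    show "(\<lambda>x. std_normal_density x *\<^sub>R cis (t * x)) \<in> borel_measurable lborel"
      by simp
  qed auto
  then show "integrable lborel (\<lambda>x. complex_of_real (exp (- x\<^sup>2 / 2)) * cis (t * x))"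
    unfolding e by (rule integrable_mult_right)
  have "(\<integral>x. std_normal_density x *\<^sub>R cis (t * x) \<partial>lborel) = char std_normal_distribution t"
    unfolding char_def by (subst integral_density) (auto simp: cis_conv_exp)
  then show "(\<integral>x. complex_of_real (exp (- x\<^sup>2 / 2)) * cis (t * x) \<partial>lborel) = complex_of_real (sqrt (2 * pi) * exp (- t\<^sup>2 / 2))"
    unfolding e integral_mult_right_zero char_std_normal_distribution by simp
qed

text \<open>The cosine of a sum does not factor over the coordinates, the exponential does; hence
  the detour through \<open>cis\<close>, whose real part is taken at the end.\<close>

lemma gauss_fourier:
  fixes t :: "'a::euclidean_space"
  shows "integrable lborel (\<lambda>x::'a. gauss x * cos (t \<bullet> x))"
    and "(\<integral>x. gauss x * cos (t \<bullet> x) \<partial>lborel) = gauss_mass TYPE('a) * gauss t"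
proof -
  have e: "(\<Prod>b\<in>Basis. complex_of_real (exp (- (x \<bullet> b)\<^sup>2 / 2)) * cis ((t \<bullet> b) * (x \<bullet> b))) =
     complex_of_real (gauss x) * cis (t \<bullet> x)" for x
  proof -
    have "(\<Prod>b\<in>Basis. cis ((t \<bullet> b) * (x \<bullet> b))) = cis (t \<bullet> x)"
      by (subst euclidean_inner) (simp add: cis_conv_exp exp_sum[symmetric] sum_distrib_left)
    then show ?thesis unfolding gauss_eq_prod by (simp add: prod.distrib)
  qed
  note * = lborel_integral_prod_Basis[of "\<lambda>b x. complex_of_real (exp (- x\<^sup>2 / 2)) * cis ((t \<bullet> b) * x)", OF gauss_fourier_real(1), unfolded e gauss_fourier_real(2)]
  have re: "gauss x * cos (t \<bullet> x) = Re (complex_of_real (gauss x) * cis (t \<bullet> x))" for x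
    by simp
  show "integrable lborel (\<lambda>x::'a. gauss x * cos (t \<bullet> x))"
    unfolding re by (intro integrable_Re *(1))
  have "(\<integral>x. gauss x * cos (t \<bullet> x) \<partial>lborel) = Re (\<integral>x. complex_of_real (gauss x) * cis (t \<bullet> x) \<partial>lborel)"
    unfolding re by (intro integral_Re *(1))
  also have "\<dots> = gauss_mass TYPE('a) * gauss t"
    unfolding *(2) gauss_mass_def gauss_eq_prod[of t] by (simp add: prod.distrib flip: of_real_prod)
  finally show "(\<integral>x. gauss x * cos (t \<bullet> x) \<partial>lborel) = gauss_mass TYPE('a) * gauss t" .
qed

lemma gauss_integral:
  shows "integrable lborel (gauss :: 'a::euclidean_space \<Rightarrow> real)"
    and "(\<integral>x. gauss (x::'a) \<partial>lborel) = gauss_mass TYPE('a)"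
  using gauss_fourier[of "0::'a"] by (simp_all add: gauss_def[of "0::'a"])

lemma gauss_fourier_scaled:
  fixes t :: "'a::euclidean_space"
  assumes s: "s > 0"
  shows "(\<integral>x. gauss (s *\<^sub>R x) * cos (t \<bullet> x) \<partial>lborel) = gauss_mass TYPE('a) * gauss (t /\<^sub>R s) / s ^ DIM('a)"
proof -
  have "gauss_mass TYPE('a) * gauss (t /\<^sub>R s) = (\<integral>x. gauss x * cos ((t /\<^sub>R s) \<bullet> x) \<partial>lborel)"
    by (rule gauss_fourier(2)[symmetric])
  also have "\<dots> = s ^ DIM('a) * (\<integral>x. gauss (s *\<^sub>R x) * cos (t \<bullet> x) \<partial>lborel)"
  proof -
    note [measurable] = gauss_measurable[where 'a = 'a]
    have "(\<lambda>x. gauss x * cos ((t /\<^sub>R s) \<bullet> x)) \<in> borel_measurable borel" by measurable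
    then show ?thesis using s by (subst lborel_integral_affine[of _ s 0]) (simp_all add: mult.assoc[symmetric])
  qed
  finally show ?thesis using s by simp
qed

section \<open>Sine and cosine transforms and their energy identity\<close>

definition cos_tr :: "('a::euclidean_space \<Rightarrow> real) \<Rightarrow> 'a \<Rightarrow> real" where
  "cos_tr f x = (\<integral>\<xi>. f \<xi> * cos (\<xi> \<bullet> x) \<partial>lborel)"

definition sin_tr :: "('a::euclidean_space \<Rightarrow> real) \<Rightarrow> 'a \<Rightarrow> real" where
  "sin_tr f x = (\<integral>\<xi>. f \<xi> * sin (\<xi> \<bullet> x) \<partial>lborel)"

lemma cos_tr_measurable:
  assumes [measurable]: "f \<in> borel_measurable borel"
  shows "cos_tr f \<in> borel_measurable borel"
  unfolding cos_tr_def[abs_def] by measurable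

lemma sin_tr_measurable:
  assumes [measurable]: "f \<in> borel_measurable borel"
  shows "sin_tr f \<in> borel_measurable borel"
  unfolding sin_tr_def[abs_def] by measurable

lemma integrable_mult_cos_sin:
  fixes f :: "'a::euclidean_space \<Rightarrow> real"
  assumes f: "integrable lborel f"
  shows "integrable lborel (\<lambda>\<xi>. f \<xi> * cos (\<xi> \<bullet> x))" "integrable lborel (\<lambda>\<xi>. f \<xi> * sin (\<xi> \<bullet> x))"
  using integrable_bounded_mult[OF f, of "\<lambda>\<xi>. cos (\<xi> \<bullet> x)" 1] integrable_bounded_mult[OF f, of "\<lambda>\<xi>. sin (\<xi> \<bullet> x)" 1]
  by (simp_all add: mult.commute)

text \<open>For real \<open>f\<close> this is the squared modulus of its Fourier transform. As a
  double integral it depends on \<open>x\<close> only through one cosine of the difference of two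
  frequencies, and against a Gaussian in \<open>x\<close> that cosine can be integrated
  explicitly.\<close>

lemma cos_sin_tr_square:
  fixes f :: "'a::euclidean_space \<Rightarrow> real"
  assumes f: "integrable lborel f"
  shows "(cos_tr f x)\<^sup>2 + (sin_tr f x)\<^sup>2 =
     (\<integral>z. f (fst z) * f (snd z) * cos ((fst z - snd z) \<bullet> x) \<partial>lborel)"
proof -
  note [measurable] = f[THEN borel_measurable_integrable, simplified] gauss_measurable[where 'a = 'a]
  have i: "integrable (lborel \<Otimes>\<^sub>M lborel) (\<lambda>(x, y). f x * f y)"
    by (rule integrable_lborel_pair_mult[OF f f])
  have "integrable (lborel \<Otimes>\<^sub>M lborel) (\<lambda>z. f (fst z) * f (snd z) * cos ((fst z - snd z) \<bullet> x))"
    by (rule Bochner_Integration.integrable_bound[OF i]) (auto simp: case_prod_unfold abs_mult mult_left_le)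
  note 1 = lborel_pair.integral_fst'[OF this]
  have e: "f \<xi> * f \<eta> * cos ((\<xi> - \<eta>) \<bullet> x) = 
     (f \<xi> * cos (\<xi> \<bullet> x)) * (f \<eta> * cos (\<eta> \<bullet> x)) + (f \<xi> * sin (\<xi> \<bullet> x)) * (f \<eta> * sin (\<eta> \<bullet> x))" for \<xi> \<eta>
    by (simp add: inner_diff_left cos_diff algebra_simps)
  note ii = integrable_mult_cos_sin[OF f]
  have "(\<integral>z. f (fst z) * f (snd z) * cos ((fst z - snd z) \<bullet> x) \<partial>(lborel \<Otimes>\<^sub>M lborel)) =
     (\<integral>\<xi>. (\<integral>\<eta>. f \<xi> * f \<eta> * cos ((\<xi> - \<eta>) \<bullet> x) \<partial>lborel) \<partial>lborel)"
    using 1 by simp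
  also have "\<dots> = (\<integral>\<xi>. (f \<xi> * cos (\<xi> \<bullet> x)) * cos_tr f x + (f \<xi> * sin (\<xi> \<bullet> x)) * sin_tr f x \<partial>lborel)"
    unfolding e cos_tr_def sin_tr_def
    by (intro Bochner_Integration.integral_cong refl) (simp only: Bochner_Integration.integral_add integral_mult_right_zero integrable_mult_right ii)
  also have "\<dots> = cos_tr f x * cos_tr f x + sin_tr f x * sin_tr f x"
    by (simp add: ii cos_tr_def[of f x] sin_tr_def[of f x])
  finally show ?thesis by (simp add: lborel_prod power2_eq_square)
qed

text \<open>The Gaussian cut-off makes the square integrable before anything is known about it.
  Integrating over \<open>x\<close> first produces a Gaussian of width \<open>s\<close> in the
  difference of the frequencies, an approximate identity; the substitution
  \<open>\<xi> = \<eta> + s *\<^sub>R \<zeta>\<close> then absorbs the singular power of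
  \<open>s\<close>.\<close>

lemma fourier_gauss_weighted:
  fixes f :: "'a::euclidean_space \<Rightarrow> real"
  assumes f: "integrable lborel f" and s: "s > 0"
  shows "integrable lborel (\<lambda>x. gauss (s *\<^sub>R x) * ((cos_tr f x)\<^sup>2 + (sin_tr f x)\<^sup>2))"
    and "(\<integral>x. gauss (s *\<^sub>R x) * ((cos_tr f x)\<^sup>2 + (sin_tr f x)\<^sup>2) \<partial>lborel) =
         gauss_mass TYPE('a) * (\<integral>\<eta>. (\<integral>\<zeta>. f \<eta> * f (\<eta> + s *\<^sub>R \<zeta>) * gauss \<zeta> \<partial>lborel) \<partial>lborel)"
proof -
  note [measurable] = f[THEN borel_measurable_integrable, simplified] gauss_measurable[where 'a = 'a]
  let ?Z = "gauss_mass TYPE('a)"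
  define F where "F z x = gauss (s *\<^sub>R x) * (f (fst z) * f (snd z) * cos ((fst z - snd z) \<bullet> x))"
    for z :: "'a \<times> 'a" and x :: 'a
  have ff: "integrable lborel (\<lambda>z :: 'a \<times> 'a. \<bar>f (fst z) * f (snd z)\<bar>)"
    using integrable_abs[OF integrable_lborel_pair_mult[OF f f]] by (simp add: lborel_prod case_prod_unfold)
  have gs: "integrable lborel (\<lambda>x::'a. gauss (s *\<^sub>R x))"
    using lborel_integrable_affine_iff[of gauss s "0::'a"] gauss_measurable[where 'a = 'a] gauss_integral(1)[where 'a = 'a] s by simp
  have F_le: "\<bar>F z x\<bar> \<le> \<bar>f (fst z) * f (snd z)\<bar> * gauss (s *\<^sub>R x)" for z x
  proof -
    have "\<bar>F z x\<bar> = (\<bar>f (fst z) * f (snd z)\<bar> * gauss (s *\<^sub>R x)) * \<bar>cos ((fst z - snd z) \<bullet> x)\<bar>"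
      by (simp add: F_def abs_mult gauss_nonneg mult_ac)
    also have "\<dots> \<le> \<bar>f (fst z) * f (snd z)\<bar> * gauss (s *\<^sub>R x)"
      by (intro mult_left_le) (auto simp: gauss_nonneg)
    finally show ?thesis .
  qed
  have F_meas: "case_prod F \<in> borel_measurable (borel \<Otimes>\<^sub>M borel)"
    unfolding F_def[abs_def] borel_prod[symmetric] by measurable
  note Fub = dominated_Fubini[OF F_meas ff gs F_le]
  have P: "(\<integral>z. F z x \<partial>lborel) = gauss (s *\<^sub>R x) * ((cos_tr f x)\<^sup>2 + (sin_tr f x)\<^sup>2)" for x
    unfolding cos_sin_tr_square[OF f] F_def by simp
  show "integrable lborel (\<lambda>x. gauss (s *\<^sub>R x) * ((cos_tr f x)\<^sup>2 + (sin_tr f x)\<^sup>2))"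
    using Fub(2) unfolding P .
  have inner: "(\<integral>x. F z x \<partial>lborel) = ?Z / s ^ DIM('a) * (f (fst z) * f (snd z) * gauss ((fst z - snd z) /\<^sub>R s))" for z
  proof -
    have "(\<integral>x. F z x \<partial>lborel) = (\<integral>x. f (fst z) * f (snd z) * (gauss (s *\<^sub>R x) * cos ((fst z - snd z) \<bullet> x)) \<partial>lborel)"
      unfolding F_def by (simp add: mult_ac)
    also have "\<dots> = f (fst z) * f (snd z) * (\<integral>x. gauss (s *\<^sub>R x) * cos ((fst z - snd z) \<bullet> x) \<partial>lborel)"
      by (rule integral_mult_right_zero)
    also have "(\<integral>x. gauss (s *\<^sub>R x) * cos ((fst z - snd z) \<bullet> x) \<partial>lborel) = ?Z * gauss ((fst z - snd z) /\<^sub>R s) / s ^ DIM('a)"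
      by (rule gauss_fourier_scaled[OF s])
    finally show ?thesis by (simp add: mult_ac)
  qed
  have i2: "integrable (lborel \<Otimes>\<^sub>M lborel) (\<lambda>z :: 'a \<times> 'a. f (fst z) * f (snd z) * gauss ((fst z - snd z) /\<^sub>R s))"
    by (rule Bochner_Integration.integrable_bound[OF integrable_lborel_pair_mult[OF f f]])
       (auto simp: case_prod_unfold abs_mult gauss_nonneg gauss_le_1 mult_left_le)
  have "(\<integral>x. gauss (s *\<^sub>R x) * ((cos_tr f x)\<^sup>2 + (sin_tr f x)\<^sup>2) \<partial>lborel) = (\<integral>z. (\<integral>x. F z x \<partial>lborel) \<partial>lborel)"
    using Fub(1) unfolding P .
  also have "\<dots> = ?Z / s ^ DIM('a) * (\<integral>z. f (fst z) * f (snd z) * gauss ((fst z - snd z) /\<^sub>R s) \<partial>lborel)"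
    unfolding inner by (rule integral_mult_right_zero)
  also have "(\<integral>z. f (fst z) * f (snd z) * gauss ((fst z - snd z) /\<^sub>R s) \<partial>(lborel :: ('a \<times> 'a) measure)) =
      (\<integral>\<eta>. (\<integral>\<xi>. f \<eta> * f \<xi> * gauss ((\<eta> - \<xi>) /\<^sub>R s) \<partial>lborel) \<partial>lborel)"
    using lborel_pair.integral_fst'[OF i2] by (simp add: lborel_prod)
  also have "\<dots> = (\<integral>\<eta>. s ^ DIM('a) * (\<integral>\<zeta>. f \<eta> * f (\<eta> + s *\<^sub>R \<zeta>) * gauss \<zeta> \<partial>lborel) \<partial>lborel)"
  proof (intro Bochner_Integration.integral_cong refl)
    fix \<eta> :: 'a
    show "(\<integral>\<xi>. f \<eta> * f \<xi> * gauss ((\<eta> - \<xi>) /\<^sub>R s) \<partial>lborel) = s ^ DIM('a) * (\<integral>\<zeta>. f \<eta> * f (\<eta> + s *\<^sub>R \<zeta>) * gauss \<zeta> \<partial>lborel)"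
      using s by (subst lborel_integral_affine[of _ s \<eta>]) (auto simp: gauss_def)
  qed
  finally show "(\<integral>x. gauss (s *\<^sub>R x) * ((cos_tr f x)\<^sup>2 + (sin_tr f x)\<^sup>2) \<partial>lborel) =
         gauss_mass TYPE('a) * (\<integral>\<eta>. (\<integral>\<zeta>. f \<eta> * f (\<eta> + s *\<^sub>R \<zeta>) * gauss \<zeta> \<partial>lborel) \<partial>lborel)"
    using s by simp
qed

lemma lborel_integral_translate_right:
  fixes f :: "'a::euclidean_space \<Rightarrow> 'b::{banach,second_countable_topology}"
  assumes "f \<in> borel_measurable borel"
  shows "(\<integral>x. f (x + a) \<partial>lborel) = integral\<^sup>L lborel f"
    and "integrable lborel (\<lambda>x. f (x + a)) \<longleftrightarrow> integrable lborel f"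
  unfolding add.commute[of _ a] by (rule lborel_integral_translate[OF assms])+

text \<open>For each fixed \<open>\<zeta>\<close> the shift leaves the integral over
  \<open>\<eta>\<close> unchanged. The case \<open>s = 0\<close> is the plain product, so both
  squares in the estimate below are covered.\<close>

lemma integral_shear:
  fixes h g :: "'a::euclidean_space \<Rightarrow> real"
  assumes h: "integrable lborel h" and g: "integrable lborel g"
  shows "integrable (lborel \<Otimes>\<^sub>M lborel) (\<lambda>(\<eta>, \<zeta>). h (\<eta> + s *\<^sub>R \<zeta>) * g \<zeta>)"
    and "(\<integral>\<eta>. (\<integral>\<zeta>. h (\<eta> + s *\<^sub>R \<zeta>) * g \<zeta> \<partial>lborel) \<partial>lborel) = integral\<^sup>L lborel h * integral\<^sup>L lborel g"
proof -
  note [measurable] = h[THEN borel_measurable_integrable, simplified] g[THEN borel_measurable_integrable, simplified]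
  have tr: "(\<integral>x. norm (h (x + a)) \<partial>lborel) = (\<integral>x. norm (h x) \<partial>lborel)"
    "(\<integral>x. h (x + a) \<partial>lborel) = (\<integral>x. h x \<partial>lborel)" for a
    by (rule lborel_integral_translate_right, measurable)+
  have tri: "integrable lborel (\<lambda>x. h (x + a))" for a
    by (subst lborel_integral_translate_right(2)) (use h in \<open>simp_all only:\<close>, measurable)
  have m: "(\<lambda>(\<zeta>, \<eta>). h (\<eta> + s *\<^sub>R \<zeta>) * g \<zeta>) \<in> borel_measurable (lborel \<Otimes>\<^sub>M lborel)"
    by measurable
  have i: "integrable (lborel \<Otimes>\<^sub>M lborel) (\<lambda>(\<zeta>, \<eta>). h (\<eta> + s *\<^sub>R \<zeta>) * g \<zeta>)"
  proof (rule lborel_pair.Fubini_integrable)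
    show "integrable lborel (\<lambda>\<zeta>. \<integral>\<eta>. norm (case (\<zeta>, \<eta>) of (\<zeta>, \<eta>) \<Rightarrow> h (\<eta> + s *\<^sub>R \<zeta>) * g \<zeta>) \<partial>lborel)"
      unfolding prod.case norm_mult integral_mult_left_zero tr(1)
      by (intro integrable_mult_right integrable_norm g)
    show "AE \<zeta> in lborel. integrable lborel (\<lambda>\<eta>. case (\<zeta>, \<eta>) of (\<zeta>, \<eta>) \<Rightarrow> h (\<eta> + s *\<^sub>R \<zeta>) * g \<zeta>)"
      unfolding prod.case by (intro AE_I2 integrable_mult_left tri)
  qed (rule m)
  from lborel_pair.integrable_product_swap[OF i]
  show i': "integrable (lborel \<Otimes>\<^sub>M lborel) (\<lambda>(\<eta>, \<zeta>). h (\<eta> + s *\<^sub>R \<zeta>) * g \<zeta>)"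
    by (simp add: case_prod_unfold)
  have "(\<integral>\<eta>. (\<integral>\<zeta>. h (\<eta> + s *\<^sub>R \<zeta>) * g \<zeta> \<partial>lborel) \<partial>lborel) = (\<integral>\<zeta>. (\<integral>\<eta>. h (\<eta> + s *\<^sub>R \<zeta>) * g \<zeta> \<partial>lborel) \<partial>lborel)"
    using lborel_pair.Fubini_integral[OF i'] by simp
  also have "\<dots> = integral\<^sup>L lborel h * integral\<^sup>L lborel g"
    unfolding integral_mult_left_zero tr(2) integral_mult_right_zero ..
  finally show "(\<integral>\<eta>. (\<integral>\<zeta>. h (\<eta> + s *\<^sub>R \<zeta>) * g \<zeta> \<partial>lborel) \<partial>lborel) = integral\<^sup>L lborel h * integral\<^sup>L lborel g" .
qed

text \<open>Twice the product \<open>f \<eta> * f (\<eta> + s *\<^sub>R \<zeta>)\<close> is at most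
  the sum of the squares, and both squares have the same integral against the Gaussian for every
  \<open>s\<close>. The bound is therefore uniform in the cut-off.\<close>

lemma fourier_gauss_weighted_le:
  fixes f :: "'a::euclidean_space \<Rightarrow> real"
  assumes f: "integrable lborel f" and f2: "integrable lborel (\<lambda>x. (f x)\<^sup>2)" and s: "s > 0"
  shows "(\<integral>x. gauss (s *\<^sub>R x) * ((cos_tr f x)\<^sup>2 + (sin_tr f x)\<^sup>2) \<partial>lborel) \<le>
         (gauss_mass TYPE('a))\<^sup>2 * (\<integral>x. (f x)\<^sup>2 \<partial>lborel)"
proof -
  note [measurable] = f[THEN borel_measurable_integrable, simplified] gauss_measurable[where 'a = 'a]
  let ?Z = "gauss_mass TYPE('a)"
  have i1: "integrable (lborel \<Otimes>\<^sub>M lborel) (\<lambda>(\<eta>, \<zeta>). (f (\<eta> + s *\<^sub>R \<zeta>))\<^sup>2 * gauss (\<zeta>::'a))"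
    and e1: "(\<integral>\<eta>. (\<integral>\<zeta>. (f (\<eta> + s *\<^sub>R \<zeta>))\<^sup>2 * gauss \<zeta> \<partial>lborel) \<partial>lborel) = (\<integral>x. (f x)\<^sup>2 \<partial>lborel) * ?Z"
    using integral_shear[OF f2 gauss_integral(1)[where 'a = 'a]] by (simp_all add: gauss_integral(2))
  have i2: "integrable (lborel \<Otimes>\<^sub>M lborel) (\<lambda>(\<eta>, \<zeta>). (f \<eta>)\<^sup>2 * gauss (\<zeta>::'a))"
    and e2: "(\<integral>\<eta>. (\<integral>\<zeta>. (f \<eta>)\<^sup>2 * gauss (\<zeta>::'a) \<partial>lborel) \<partial>lborel) = (\<integral>x. (f x)\<^sup>2 \<partial>lborel) * ?Z"
    using integral_shear[OF f2 gauss_integral(1)[where 'a = 'a], of 0] by (simp_all add: gauss_integral(2))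
  define A where "A = (\<lambda>(\<eta>, \<zeta>). f \<eta> * f (\<eta> + s *\<^sub>R \<zeta>) * gauss \<zeta>)"
  define D where "D = (\<lambda>z. ((\<lambda>(\<eta>, \<zeta>). (f (\<eta> + s *\<^sub>R \<zeta>))\<^sup>2 * gauss \<zeta>) z + (\<lambda>(\<eta>, \<zeta>). (f \<eta>)\<^sup>2 * gauss (\<zeta>::'a)) z) / 2)"
  have iD: "integrable (lborel \<Otimes>\<^sub>M lborel) D"
    unfolding D_def using i1 i2 by simp
  have AD: "\<bar>A z\<bar> \<le> D z" for z
  proof -
    obtain \<eta> \<zeta> where z: "z = (\<eta>, \<zeta>)" by force
    have "2 * \<bar>f \<eta>\<bar> * \<bar>f (\<eta> + s *\<^sub>R \<zeta>)\<bar> \<le> (f (\<eta> + s *\<^sub>R \<zeta>))\<^sup>2 + (f \<eta>)\<^sup>2"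
      using sum_squares_bound[of "\<bar>f \<eta>\<bar>" "\<bar>f (\<eta> + s *\<^sub>R \<zeta>)\<bar>"] by simp
    from mult_right_mono[OF this gauss_nonneg[of \<zeta>]] show ?thesis
      unfolding A_def D_def z by (simp add: abs_mult gauss_nonneg algebra_simps)
  qed
  have "A \<in> borel_measurable (lborel \<Otimes>\<^sub>M lborel)" unfolding A_def by measurable
  then have iA: "integrable (lborel \<Otimes>\<^sub>M lborel) A"
    by (rule Bochner_Integration.integrable_bound[OF iD]) (auto intro!: AE_I2 order_trans[OF AD])
  have "(\<integral>x. gauss (s *\<^sub>R x) * ((cos_tr f x)\<^sup>2 + (sin_tr f x)\<^sup>2) \<partial>lborel) = ?Z * integral\<^sup>L (lborel \<Otimes>\<^sub>M lborel) A"
    unfolding fourier_gauss_weighted(2)[OF f s] using lborel_pair.integral_fst'[OF iA] by (simp add: A_def)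
  also have "\<dots> \<le> ?Z * integral\<^sup>L (lborel \<Otimes>\<^sub>M lborel) D"
    using AD by (intro mult_left_mono integral_mono iA iD) (auto intro: order_trans[OF abs_ge_self] less_imp_le[OF gauss_mass_pos])
  also have "integral\<^sup>L (lborel \<Otimes>\<^sub>M lborel) D = (\<integral>x. (f x)\<^sup>2 \<partial>lborel) * ?Z"
    unfolding D_def using i1 i2 lborel_pair.integral_fst'[OF i1] lborel_pair.integral_fst'[OF i2] e1 e2
    by simp
  finally show ?thesis by (simp add: power2_eq_square mult_ac)
qed


text \<open>Removing the cut-off by Fatou's lemma gives only an inequality, but without any
  regularity of \<open>f\<close>; it later controls the approximation errors in the proof of
  equality.\<close>

lemma fourier_square_le:
  fixes f :: "'a::euclidean_space \<Rightarrow> real"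
  assumes f: "integrable lborel f" and f2: "integrable lborel (\<lambda>x. (f x)\<^sup>2)"
  shows "integrable lborel (\<lambda>x. (cos_tr f x)\<^sup>2 + (sin_tr f x)\<^sup>2)"
    and "(\<integral>x. (cos_tr f x)\<^sup>2 + (sin_tr f x)\<^sup>2 \<partial>lborel) \<le> (gauss_mass TYPE('a))\<^sup>2 * (\<integral>x. (f x)\<^sup>2 \<partial>lborel)"
proof -
  note [measurable] = f[THEN borel_measurable_integrable, simplified] gauss_measurable[where 'a = 'a]
  let ?B = "(gauss_mass TYPE('a))\<^sup>2 * (\<integral>x. (f x)\<^sup>2 \<partial>lborel)"
  define P where "P x = (cos_tr f x)\<^sup>2 + (sin_tr f x)\<^sup>2" for x
  have P[measurable]: "P \<in> borel_measurable borel" unfolding P_def[abs_def] using cos_tr_measurable[of f] sin_tr_measurable[of f] by measurable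
  have P0: "0 \<le> P x" for x by (simp add: P_def)
  define u where "u k x = ennreal (gauss ((1 / real (Suc k)) *\<^sub>R x) * P x)" for k x
  have u_lim: "(\<lambda>k. u k x) \<longlonglongrightarrow> ennreal (P x)" for x
  proof -
    have l: "(\<lambda>k. 1 / real (Suc k)) \<longlonglongrightarrow> 0" using LIMSEQ_Suc[OF lim_1_over_n] .
    have "(\<lambda>k. exp (- (norm ((1 / real (Suc k)) *\<^sub>R x))\<^sup>2 / 2) * P x) \<longlonglongrightarrow> exp (- (norm (0 *\<^sub>R x))\<^sup>2 / 2) * P x"
      by (intro tendsto_intros l) simp
    then show ?thesis unfolding u_def gauss_def by (intro tendsto_ennrealI) simp
  qed
  have "(\<integral>\<^sup>+x. ennreal (P x) \<partial>lborel) = (\<integral>\<^sup>+x. liminf (\<lambda>k. u k x) \<partial>lborel)"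
    by (intro nn_integral_cong lim_imp_Liminf[symmetric] u_lim) simp
  also have "\<dots> \<le> liminf (\<lambda>k. \<integral>\<^sup>+x. u k x \<partial>lborel)"
    by (intro nn_integral_liminf) (auto simp: u_def[abs_def])
  also have "\<dots> \<le> liminf (\<lambda>k. ennreal ?B)"
  proof (intro Liminf_mono always_eventually allI)
    fix k
    have "(\<integral>\<^sup>+x. u k x \<partial>lborel) = ennreal (\<integral>x. gauss ((1 / real (Suc k)) *\<^sub>R x) * P x \<partial>lborel)"
      unfolding u_def P_def by (intro nn_integral_eq_integral fourier_gauss_weighted f) (auto simp: gauss_nonneg)
    also have "\<dots> \<le> ennreal ?B"
      unfolding P_def by (intro ennreal_leI fourier_gauss_weighted_le f f2) simp
    finally show "(\<integral>\<^sup>+x. u k x \<partial>lborel) \<le> ennreal ?B" .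
  qed
  finally have le: "(\<integral>\<^sup>+x. ennreal (P x) \<partial>lborel) \<le> ennreal ?B"
    by (simp add: Liminf_const)
  have "integrable lborel P"
    by (rule integrableI_nonneg) (use le P0 in \<open>auto simp: order_le_less_trans\<close>)
  then show "integrable lborel (\<lambda>x. (cos_tr f x)\<^sup>2 + (sin_tr f x)\<^sup>2)" unfolding P_def[abs_def] .
  then have "ennreal (\<integral>x. P x \<partial>lborel) \<le> ennreal ?B"
    using le P0 by (subst nn_integral_eq_integral[symmetric]) (auto simp: P_def[abs_def])
  then show "(\<integral>x. (cos_tr f x)\<^sup>2 + (sin_tr f x)\<^sup>2 \<partial>lborel) \<le> ?B"
    unfolding P_def by (subst (asm) ennreal_le_iff) auto
qed

text \<open>Continuity identifies the limit of the shifted products as the cut-off is removed.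
  Dominated convergence applies on both sides: the squared transform is integrable by the upper
  bound, and the shifted products are at most \<open>M\<close> times an integrable function.\<close>

lemma plancherel_continuous:
  fixes f :: "'a::euclidean_space \<Rightarrow> real"
  assumes f: "integrable lborel f" and f2: "integrable lborel (\<lambda>x. (f x)\<^sup>2)"
    and cont: "continuous_on UNIV f" and M: "\<And>x. \<bar>f x\<bar> \<le> M"
  shows "(\<integral>x. (cos_tr f x)\<^sup>2 + (sin_tr f x)\<^sup>2 \<partial>lborel) = (gauss_mass TYPE('a))\<^sup>2 * (\<integral>x. (f x)\<^sup>2 \<partial>lborel)"
proof -
  note [measurable] = f[THEN borel_measurable_integrable, simplified] gauss_measurable[where 'a = 'a]
  let ?Z = "gauss_mass TYPE('a)"
  define P where "P x = (cos_tr f x)\<^sup>2 + (sin_tr f x)\<^sup>2" for x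
  have P[measurable]: "P \<in> borel_measurable borel" unfolding P_def[abs_def] using cos_tr_measurable[of f] sin_tr_measurable[of f] by measurable
  have iP: "integrable lborel P" unfolding P_def[abs_def] by (rule fourier_square_le(1)[OF f f2])
  define s where "s k = 1 / real (Suc k)" for k
  have s: "s k > 0" "s \<longlonglongrightarrow> 0" for k
    unfolding s_def using LIMSEQ_Suc[OF lim_1_over_n] by simp_all
  have "(\<lambda>k. \<integral>x. gauss (s k *\<^sub>R x) * P x \<partial>lborel) \<longlonglongrightarrow> (\<integral>x. P x \<partial>lborel)"
  proof (rule integral_dominated_convergence[where w = "\<lambda>x. \<bar>P x\<bar>"])
    show "AE x in lborel. (\<lambda>k. gauss (s k *\<^sub>R x) * P x) \<longlonglongrightarrow> P x"
    proof (intro AE_I2)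
      fix x :: 'a
      have "(\<lambda>k. exp (- (norm (s k *\<^sub>R x))\<^sup>2 / 2) * P x) \<longlonglongrightarrow> exp (- (norm (0 *\<^sub>R x))\<^sup>2 / 2) * P x"
        by (intro tendsto_intros s) simp
      then show "(\<lambda>k. gauss (s k *\<^sub>R x) * P x) \<longlonglongrightarrow> P x" unfolding gauss_def by simp
    qed
  qed (use iP in \<open>auto simp: abs_mult gauss_nonneg gauss_le_1 mult_left_le_one_le\<close>)
  moreover have "(\<lambda>k. \<integral>x. gauss (s k *\<^sub>R x) * P x \<partial>lborel) \<longlonglongrightarrow> ?Z\<^sup>2 * (\<integral>x. (f x)\<^sup>2 \<partial>lborel)"
  proof -
    define A where "A k = (\<lambda>(\<eta>, \<zeta>). f \<eta> * f (\<eta> + s k *\<^sub>R \<zeta>) * gauss \<zeta>)" for k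
    define A' where "A' = (\<lambda>(\<eta>, \<zeta>). (f \<eta>)\<^sup>2 * gauss (\<zeta>::'a))"
    have [measurable]: "A k \<in> borel_measurable (borel \<Otimes>\<^sub>M borel)" for k unfolding A_def by measurable
    have [measurable]: "A' \<in> borel_measurable (borel \<Otimes>\<^sub>M borel)" unfolding A'_def by measurable
    have dom: "integrable (lborel \<Otimes>\<^sub>M lborel) (\<lambda>z. M * \<bar>(\<lambda>(\<eta>, \<zeta>). f \<eta> * gauss (\<zeta>::'a)) z\<bar>)"
      using integrable_lborel_pair_mult[OF f gauss_integral(1)[where 'a = 'a]]
      by (intro integrable_mult_right integrable_abs)
    have M': "\<bar>A k z\<bar> \<le> M * \<bar>(\<lambda>(\<eta>, \<zeta>). f \<eta> * gauss (\<zeta>::'a)) z\<bar>" for k z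
    proof -
      obtain \<eta> \<zeta> where z: "z = (\<eta>, \<zeta>)" by force
      show ?thesis
        using mult_right_mono[OF M, of "\<bar>f \<eta> * gauss \<zeta>\<bar>" "\<eta> + s k *\<^sub>R \<zeta>"]
        unfolding A_def z by (simp add: abs_mult mult_ac)
    qed
    have lim: "(\<lambda>k. A k z) \<longlonglongrightarrow> A' z" for z
    proof -
      obtain \<eta> \<zeta> where z: "z = (\<eta>, \<zeta>)" by force
      have "(\<lambda>k. \<eta> + s k *\<^sub>R \<zeta>) \<longlonglongrightarrow> \<eta> + 0 *\<^sub>R \<zeta>" by (intro tendsto_intros s)
      then have "(\<lambda>k. f (\<eta> + s k *\<^sub>R \<zeta>)) \<longlonglongrightarrow> f \<eta>"
        using continuous_on_tendsto_compose[OF cont, of "\<lambda>k. \<eta> + s k *\<^sub>R \<zeta>" \<eta>] by simp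
      then have "(\<lambda>k. f \<eta> * f (\<eta> + s k *\<^sub>R \<zeta>) * gauss \<zeta>) \<longlonglongrightarrow> f \<eta> * f \<eta> * gauss \<zeta>"
        by (intro tendsto_intros)
      then show ?thesis unfolding A_def A'_def z by (simp add: power2_eq_square)
    qed
    have "(\<lambda>k. integral\<^sup>L (lborel \<Otimes>\<^sub>M lborel) (A k)) \<longlonglongrightarrow> integral\<^sup>L (lborel \<Otimes>\<^sub>M lborel) A'"
      by (rule integral_dominated_convergence[OF _ _ dom], simp, simp, intro AE_I2 lim,
          unfold real_norm_def, intro AE_I2 M')
    moreover have "(\<integral>x. gauss (s k *\<^sub>R x) * P x \<partial>lborel) = ?Z * integral\<^sup>L (lborel \<Otimes>\<^sub>M lborel) (A k)" for k
    proof -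
      have iA: "integrable (lborel \<Otimes>\<^sub>M lborel) (A k)"
        by (rule Bochner_Integration.integrable_bound[OF dom], simp, unfold real_norm_def,
            intro AE_I2 order_trans[OF M'] abs_ge_self)
      show ?thesis unfolding P_def fourier_gauss_weighted(2)[OF f s(1)]
        using lborel_pair.integral_fst'[OF iA] by (simp add: A_def)
    qed
    moreover have "integral\<^sup>L (lborel \<Otimes>\<^sub>M lborel) A' = (\<integral>x. (f x)\<^sup>2 \<partial>lborel) * ?Z"
      unfolding A'_def
      using lborel_pair.integral_fst'[OF integrable_lborel_pair_mult[OF f2 gauss_integral(1)[where 'a = 'a]]]
      by (simp add: gauss_integral(2))
    ultimately show ?thesis
      by (auto intro!: tendsto_eq_intros simp: power2_eq_square)
  qed
  ultimately show ?thesis unfolding P_def by (rule LIMSEQ_unique)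
qed

section \<open>Approximation in mean square and the general Plancherel identity\<close>

lemma L2_approx_truncate:
  fixes f :: "'a::euclidean_space \<Rightarrow> real"
  assumes [measurable]: "f \<in> borel_measurable borel" and f2: "integrable lborel (\<lambda>x. (f x)\<^sup>2)" and e: "e > 0"
  obtains h :: "'a \<Rightarrow> real" and N :: nat where "h \<in> borel_measurable borel" "\<And>x. \<bar>h x\<bar> \<le> real N"
    "\<And>x. norm x > real N \<Longrightarrow> h x = 0" "integrable lborel (\<lambda>x. (f x - h x)\<^sup>2)" "(\<integral>x. (f x - h x)\<^sup>2 \<partial>lborel) < e"
proof -
  define h where "h N x = (if \<bar>f x\<bar> \<le> real N \<and> norm x \<le> real N then f x else 0)" for N x
  have [measurable]: "h N \<in> borel_measurable borel" for N unfolding h_def[abs_def] by measurable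
  have le: "(f x - h N x)\<^sup>2 \<le> (f x)\<^sup>2" for N x by (simp add: h_def)
  have "(\<lambda>N. \<integral>x. (f x - h N x)\<^sup>2 \<partial>lborel) \<longlonglongrightarrow> (\<integral>x. 0 \<partial>(lborel :: 'a measure))"
  proof (rule integral_dominated_convergence[OF _ _ f2])
    show "AE x in lborel. (\<lambda>N. (f x - h N x)\<^sup>2) \<longlonglongrightarrow> 0"
    proof (intro AE_I2 tendsto_eventually)
      fix x :: 'a
      obtain n where n: "max \<bar>f x\<bar> (norm x) \<le> real n" using real_arch_simple ..
      have "(f x - h N x)\<^sup>2 = 0" if "n \<le> N" for N
      proof -
        have "real n \<le> real N" using that by simp
        then have "\<bar>f x\<bar> \<le> real N" "norm x \<le> real N" using n by linarith+
        then show ?thesis by (simp add: h_def)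
      qed
      then show "\<forall>\<^sub>F N in sequentially. (f x - h N x)\<^sup>2 = 0"
        by (auto intro: eventually_sequentiallyI)
    qed
    show "AE x in lborel. norm ((f x - h N x)\<^sup>2) \<le> (f x)\<^sup>2" for N using le by simp
  qed simp_all
  then have "\<forall>\<^sub>F N in sequentially. (\<integral>x. (f x - h N x)\<^sup>2 \<partial>lborel) < e"
    using e by (intro order_tendstoD(2)) simp_all
  then obtain N where N: "(\<integral>x. (f x - h N x)\<^sup>2 \<partial>lborel) < e"
    using eventually_happens'[OF sequentially_bot] by blast
  show ?thesis
  proof (rule that[OF _ _ _ _ N])
    show "integrable lborel (\<lambda>x. (f x - h N x)\<^sup>2)"
      using le by (intro integrable_dominated[OF f2]) auto
  qed (auto simp: h_def)
qed

text \<open>Measurability supplies continuous functions converging almost everywhere, without any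
  bound. Clipping them at height \<open>N\<close> and multiplying by the cut-off \<open>ch\<close>,
  which is one wherever \<open>h\<close> can be nonzero, provides a common majorant and leaves the
  limit intact.\<close>

lemma L2_approx_continuous_bounded:
  fixes h :: "'a::euclidean_space \<Rightarrow> real"
  assumes hm[measurable]: "h \<in> borel_measurable borel" and hN: "\<And>x. \<bar>h x\<bar> \<le> real N"
    and supp: "\<And>x. norm x > real N \<Longrightarrow> h x = 0" and e: "e > 0"
  obtains g :: "'a \<Rightarrow> real" where "continuous_on UNIV g" "\<And>x. \<bar>g x\<bar> \<le> real N"
    "integrable lborel g" "integrable lborel (\<lambda>x. (g x)\<^sup>2)"
    "integrable lborel (\<lambda>x. (h x - g x)\<^sup>2)" "(\<integral>x. (h x - g x)\<^sup>2 \<partial>lborel) < e"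
proof -
  have "h measurable_on UNIV"
    by (intro lebesgue_measurable_imp_measurable_on) (auto intro: measurable_completion)
  then obtain Z k where Z: "negligible Z" and k: "\<And>n::nat. continuous_on UNIV (k n)"
    and lim: "\<And>x. x \<notin> Z \<Longrightarrow> (\<lambda>n. k n x) \<longlonglongrightarrow> h x"
    unfolding measurable_on_def by auto
  define ch where "ch x = max 0 (min 1 (real N + 1 - norm x))" for x :: 'a
  define g where "g n x = max (- real N) (min (real N) (k n x)) * ch x" for n x
  let ?I = "indicator (cball 0 (real N + 1)) :: 'a \<Rightarrow> real"
  have ch: "0 \<le> ch x" "ch x \<le> 1" "ch x \<le> ?I x" for x
    by (auto simp: ch_def indicator_def)
  have gc: "continuous_on UNIV (g n)" for n
    unfolding g_def ch_def by (intro continuous_intros k)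
  have gm[measurable]: "g n \<in> borel_measurable borel" for n
    using gc by (rule borel_measurable_continuous_onI)
  have iI: "integrable lborel ?I"
    using emeasure_compact_finite[of "cball (0::'a) (real N + 1)"]
    by (intro integrable_real_indicator) auto
  have gI: "\<bar>g n x\<bar> \<le> real N * ?I x" for n x
    unfolding g_def abs_mult using ch[of x] by (intro mult_mono) auto
  have gN: "\<bar>g n x\<bar> \<le> real N" for n x
    using gI[of n x] by (cases "norm x \<le> real N + 1") auto
  have hI: "\<bar>h x\<bar> \<le> real N * ?I x" for x
    using hN[of x] supp[of x] by (auto simp: indicator_def)
  have gi: "integrable lborel (g n)" for n
    using gI by (intro integrable_dominated[OF integrable_mult_right[OF iI]]) auto
  have gi2: "integrable lborel (\<lambda>x. (g n x)\<^sup>2)" for n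
    using integrable_bounded_mult[OF gi gm gN] by (simp add: power2_eq_square)
  have d: "(h x - g n x)\<^sup>2 \<le> 4 * (real N)\<^sup>2 * ?I x" for n x
  proof -
    have "\<bar>h x - g n x\<bar> \<le> 2 * real N * ?I x" using hI[of x] gI[of n x] by linarith
    from power_mono[OF this, of 2] show ?thesis by (cases "norm x \<le> real N + 1") (simp_all add: power_mult_distrib)
  qed
  have glim: "(\<lambda>n. g n x) \<longlonglongrightarrow> h x" if "x \<notin> Z" for x
  proof -
    have "(\<lambda>n. g n x) \<longlonglongrightarrow> max (- real N) (min (real N) (h x)) * ch x"
      unfolding g_def by (intro tendsto_intros lim that)
    also have "max (- real N) (min (real N) (h x)) * ch x = h x"
      using hN[of x] supp[of x] by (cases "norm x \<le> real N") (auto simp: ch_def)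
    finally show ?thesis .
  qed
  have AEZ: "AE x in lborel. x \<notin> Z"
    using AE_not_in[of Z lebesgue] Z unfolding negligible_iff_null_sets AE_completion_iff by simp
  have "(\<lambda>n. \<integral>x. (h x - g n x)\<^sup>2 \<partial>lborel) \<longlonglongrightarrow> (\<integral>x. 0 \<partial>(lborel :: 'a measure))"
  proof (rule integral_dominated_convergence[OF _ _ integrable_mult_right[OF iI]])
    show "AE x in lborel. (\<lambda>n. (h x - g n x)\<^sup>2) \<longlonglongrightarrow> 0"
      using AEZ by eventually_elim (auto intro!: tendsto_eq_intros glim)
    show "AE x in lborel. norm ((h x - g n x)\<^sup>2) \<le> 4 * (real N)\<^sup>2 * ?I x" for n using d by simp
  qed simp_all
  then have "\<forall>\<^sub>F n in sequentially. (\<integral>x. (h x - g n x)\<^sup>2 \<partial>lborel) < e"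
    using e by (intro order_tendstoD(2)) simp_all
  then obtain n where n: "(\<integral>x. (h x - g n x)\<^sup>2 \<partial>lborel) < e"
    using eventually_happens'[OF sequentially_bot] by blast
  show ?thesis
    by (rule that[OF gc gN gi gi2 _ n], rule integrable_dominated[OF integrable_mult_right[OF iI]])
       (use d in auto)
qed

text \<open>Young's inequality with a parameter. Small \<open>d\<close> keeps the leading constant
  near one, as an equality like Plancherel's requires; \<open>d = 1\<close> gives the usual factor
  two.\<close>

lemma square_add_le:
  fixes a b d :: real
  assumes d: "d > 0"
  shows "(a + b)\<^sup>2 \<le> (1 + d) * a\<^sup>2 + (1 + 1 / d) * b\<^sup>2"
proof -
  have "0 \<le> (d * a - b)\<^sup>2 / d" using d by simp
  also have "(d * a - b)\<^sup>2 / d = (1 + d) * a\<^sup>2 + (1 + 1 / d) * b\<^sup>2 - (a + b)\<^sup>2"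
    using d by (simp add: power2_eq_square field_simps)
  finally show ?thesis by simp
qed

text \<open>Only the lower bound is new. A continuous approximation \<open>g\<close> satisfies the
  equality, and the upper bound applied to \<open>g - f\<close> controls the change on the transform
  side. The limit in \<open>e\<close> is taken before the one in \<open>d\<close>, because the error
  constant blows up like \<open>1 / d\<close>.\<close>

lemma plancherel:
  fixes f :: "'a::euclidean_space \<Rightarrow> real"
  assumes f: "integrable lborel f" and f2: "integrable lborel (\<lambda>x. (f x)\<^sup>2)"
  shows "(\<integral>x. (cos_tr f x)\<^sup>2 + (sin_tr f x)\<^sup>2 \<partial>lborel) = (gauss_mass TYPE('a))\<^sup>2 * (\<integral>x. (f x)\<^sup>2 \<partial>lborel)"
proof -
  have fm[measurable]: "f \<in> borel_measurable borel" using f[THEN borel_measurable_integrable] by simp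
  define K where "K = (gauss_mass TYPE('a))\<^sup>2"
  have K: "K > 0" using gauss_mass_pos[where 'a = 'a] by (simp add: K_def)
  define P where "P f x = (cos_tr f x)\<^sup>2 + (sin_tr f x)\<^sup>2" for f :: "'a \<Rightarrow> real" and x
  let ?A = "\<integral>x. P f x \<partial>lborel" and ?F = "\<integral>x. (f x)\<^sup>2 \<partial>lborel"
  have F0: "0 \<le> ?F" and A0: "0 \<le> ?A" by (auto simp: P_def)
  \<comment> \<open>Truncation and smoothing each cost \<open>e\<close>, so the squared distance
    from \<open>f\<close> to \<open>g\<close> is at most \<open>4 * e\<close>. It enters with factor
    \<open>1 + 1 / d\<close> once on the side of \<open>f\<close> and once, multiplied by a further
    \<open>1 + d\<close>, on the side of the transforms; the sum is \<open>C\<close>.\<close>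
  have key: "K * ?F \<le> (1 + d)\<^sup>2 * ?A + C * e * K"
    if d: "d > 0" and e: "e > 0" and C: "C = 4 * (1 + 1 / d) * (2 + d)" for d e C
  proof -
    obtain h N where h: "h \<in> borel_measurable borel" "\<And>x. \<bar>h x\<bar> \<le> real N" "\<And>x. norm x > real N \<Longrightarrow> h x = 0"
      "integrable lborel (\<lambda>x. (f x - h x)\<^sup>2)" "(\<integral>x. (f x - h x)\<^sup>2 \<partial>lborel) < e"
      using L2_approx_truncate[OF fm f2 e] by blast
    obtain g where g: "continuous_on UNIV g" "\<And>x. \<bar>g x\<bar> \<le> real N"
      "integrable lborel g" "integrable lborel (\<lambda>x. (g x)\<^sup>2)"
      "integrable lborel (\<lambda>x. (h x - g x)\<^sup>2)" "(\<integral>x. (h x - g x)\<^sup>2 \<partial>lborel) < e"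
      using L2_approx_continuous_bounded[OF h(1-3) e] by blast
    have [measurable]: "g \<in> borel_measurable borel" "h \<in> borel_measurable borel"
      using h(1) g(3)[THEN borel_measurable_integrable] by simp_all
    have le: "(f x - g x)\<^sup>2 \<le> 2 * (f x - h x)\<^sup>2 + 2 * (h x - g x)\<^sup>2" for x
      using square_add_le[of 1 "f x - h x" "h x - g x"] by simp
    have i: "integrable lborel (\<lambda>x. 2 * (f x - h x)\<^sup>2 + 2 * (h x - g x)\<^sup>2)"
      using h(4) g(5) by simp
    have fg2: "integrable lborel (\<lambda>x. (f x - g x)\<^sup>2)"
      by (rule integrable_dominated[OF i]) (use le in auto)
    have E: "(\<integral>x. (f x - g x)\<^sup>2 \<partial>lborel) \<le> 4 * e"
    proof -
      have "(\<integral>x. (f x - g x)\<^sup>2 \<partial>lborel) \<le> (\<integral>x. 2 * (f x - h x)\<^sup>2 + 2 * (h x - g x)\<^sup>2 \<partial>lborel)"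
        by (rule integral_mono[OF fg2 i le])
      then show ?thesis using h(4,5) g(5,6) by simp
    qed
    have gf: "integrable lborel (\<lambda>x. g x - f x)" using f g(3) by simp
    have gf2: "integrable lborel (\<lambda>x. (g x - f x)\<^sup>2)" using fg2 by (simp add: power2_commute)
    have E': "(\<integral>x. (g x - f x)\<^sup>2 \<partial>lborel) \<le> 4 * e" using E by (simp add: power2_commute)
    have iP: "integrable lborel (P g)" "integrable lborel (P f)" "integrable lborel (P (\<lambda>x. g x - f x))"
      unfolding P_def[abs_def] by (rule fourier_square_le(1); fact)+
    have "?F \<le> (\<integral>x. (1 + d) * (g x)\<^sup>2 + (1 + 1 / d) * (f x - g x)\<^sup>2 \<partial>lborel)"
    proof (rule integral_mono[OF f2])
      show "(f x)\<^sup>2 \<le> (1 + d) * (g x)\<^sup>2 + (1 + 1 / d) * (f x - g x)\<^sup>2" for x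
        using square_add_le[OF d, of "g x" "f x - g x"] by simp
    qed (use fg2 g(4) in simp)
    also have "\<dots> = (1 + d) * (\<integral>x. (g x)\<^sup>2 \<partial>lborel) + (1 + 1 / d) * (\<integral>x. (f x - g x)\<^sup>2 \<partial>lborel)"
      using fg2 g(4) by simp
    also have "\<dots> \<le> (1 + d) * (\<integral>x. (g x)\<^sup>2 \<partial>lborel) + (1 + 1 / d) * (4 * e)"
      using E d by (intro add_left_mono mult_left_mono) auto
    finally have 1: "?F \<le> (1 + d) * (\<integral>x. (g x)\<^sup>2 \<partial>lborel) + (1 + 1 / d) * (4 * e)" .
    have tr: "cos_tr (\<lambda>x. g x - f x) x = cos_tr g x - cos_tr f x" "sin_tr (\<lambda>x. g x - f x) x = sin_tr g x - sin_tr f x" for x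
      unfolding cos_tr_def sin_tr_def left_diff_distrib
      by (intro Bochner_Integration.integral_diff integrable_mult_cos_sin f g(3))+
    have Ple: "P g x \<le> (1 + d) * P f x + (1 + 1 / d) * P (\<lambda>x. g x - f x) x" for x
      using square_add_le[OF d, of "cos_tr f x" "cos_tr g x - cos_tr f x"]
        square_add_le[OF d, of "sin_tr f x" "sin_tr g x - sin_tr f x"]
      unfolding P_def tr by (simp add: distrib_left)
    have "K * (\<integral>x. (g x)\<^sup>2 \<partial>lborel) = (\<integral>x. P g x \<partial>lborel)"
      unfolding P_def K_def by (rule plancherel_continuous[symmetric]) (use g in auto)
    also have "\<dots> \<le> (\<integral>x. (1 + d) * P f x + (1 + 1 / d) * P (\<lambda>x. g x - f x) x \<partial>lborel)"
      by (intro integral_mono iP Ple) (use iP in simp)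
    also have "\<dots> = (1 + d) * ?A + (1 + 1 / d) * (\<integral>x. P (\<lambda>x. g x - f x) x \<partial>lborel)"
      using iP by simp
    also have "\<dots> \<le> (1 + d) * ?A + (1 + 1 / d) * (K * (4 * e))"
    proof -
      have "(\<integral>x. P (\<lambda>x. g x - f x) x \<partial>lborel) \<le> K * (\<integral>x. (g x - f x)\<^sup>2 \<partial>lborel)"
        unfolding P_def K_def by (rule fourier_square_le(2)[OF gf gf2])
      also have "\<dots> \<le> K * (4 * e)" using E' K by simp
      finally show ?thesis using d by (intro add_left_mono mult_left_mono) auto
    qed
    finally have 2: "K * (\<integral>x. (g x)\<^sup>2 \<partial>lborel) \<le> (1 + d) * ?A + (1 + 1 / d) * (K * (4 * e))" .
    have "K * ?F \<le> (1 + d) * (K * (\<integral>x. (g x)\<^sup>2 \<partial>lborel)) + K * ((1 + 1 / d) * (4 * e))"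
      using mult_left_mono[OF 1, of K] K by (simp add: algebra_simps)
    also have "\<dots> \<le> (1 + d) * ((1 + d) * ?A + (1 + 1 / d) * (K * (4 * e))) + K * ((1 + 1 / d) * (4 * e))"
      using 2 d by (intro add_right_mono mult_left_mono) auto
    also have "\<dots> = (1 + d)\<^sup>2 * ?A + C * e * K"
      unfolding C using d by (simp add: power2_eq_square field_simps)
    finally show ?thesis .
  qed
  have "K * ?F \<le> ?A"
  proof -
    have 1: "K * ?F \<le> (1 + d)\<^sup>2 * ?A" if d: "d > 0" for d
    proof (rule field_le_epsilon)
      fix e :: real assume e: "e > 0"
      define C where "C = 4 * (1 + 1 / d) * (2 + d)"
      have C: "C > 0" using d by (auto simp: C_def intro!: mult_pos_pos add_pos_pos)
      show "K * ?F \<le> (1 + d)\<^sup>2 * ?A + e"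
        using key[OF d _ C_def, of "e / (C * K)"] C K e by simp
    qed
    have "((\<lambda>d. (1 + d)\<^sup>2 * ?A) \<longlongrightarrow> (1 + 0)\<^sup>2 * ?A) (at_right 0)"
      by (intro tendsto_intros)
    moreover have "\<forall>\<^sub>F d in at_right 0. K * ?F \<le> (1 + d)\<^sup>2 * ?A"
      using eventually_at_right_less[of "0::real"] by (rule eventually_mono) (rule 1)
    ultimately have "K * ?F \<le> (1 + 0)\<^sup>2 * ?A"
      by (rule tendsto_lowerbound) simp
    then show ?thesis by simp
  qed
  moreover have "?A \<le> K * ?F" unfolding P_def K_def by (rule fourier_square_le(2)[OF f f2])
  ultimately show ?thesis unfolding P_def K_def by linarith
qed


section \<open>Vector fields given by sine transforms\<close>

lemma borel_measurable_vecI: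
  fixes f :: "'a \<Rightarrow> 'b::euclidean_space ^ 'n::finite"
  assumes "\<And>i. (\<lambda>x. f x $ i) \<in> borel_measurable M"
  shows "f \<in> borel_measurable M"
proof (subst borel_measurable_euclidean_space, intro ballI)
  fix b :: "'b ^ 'n" assume "b \<in> Basis"
  then obtain i u where b: "b = axis i u" unfolding Basis_vec_def by blast
  show "(\<lambda>x. f x \<bullet> b) \<in> borel_measurable M"
    unfolding b inner_axis using assms by simp
qed

lemma borel_measurable_vec_nth:
  fixes f :: "'a \<Rightarrow> real ^ 'n::finite"
  assumes "f \<in> borel_measurable M"
  shows "(\<lambda>x. f x $ i) \<in> borel_measurable M"
  unfolding cart_eq_inner_axis using assms by simp

lemma borel_measurable_nth_id: "(\<lambda>x :: real ^ 'n::finite. x $ i) \<in> borel_measurable borel"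
  by (intro borel_measurable_continuous_onI continuous_intros)

lemma norm_vec_power2: "(norm (x :: 'b::real_inner ^ 'n::finite))\<^sup>2 = (\<Sum>i\<in>UNIV. (norm (x $ i))\<^sup>2)"
  by (simp add: power2_norm_eq_inner inner_vec_def)

text \<open>Here \<open>a \<xi> z\<close> is a single wave and its integral over
  \<open>\<xi>\<close> a field. Testing the field against \<open>\<psi>\<close> reduces to testing
  the waves one frequency at a time.\<close>

lemma superposition:
  fixes a :: "'a::euclidean_space \<Rightarrow> 'b::euclidean_space \<Rightarrow> real"
  assumes a[measurable]: "case_prod a \<in> borel_measurable (borel \<Otimes>\<^sub>M borel)"
    and V: "integrable lborel V" and \<psi>: "integrable lborel \<psi>"
    and le: "\<And>\<xi> z. \<bar>a \<xi> z\<bar> \<le> V \<xi>"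
  shows "(\<integral>z. (\<integral>\<xi>. a \<xi> z \<partial>lborel) * \<psi> z \<partial>lborel) = (\<integral>\<xi>. (\<integral>z. a \<xi> z * \<psi> z \<partial>lborel) \<partial>lborel)"
    and "integrable lborel (\<lambda>z. (\<integral>\<xi>. a \<xi> z \<partial>lborel) * \<psi> z)"
    and "integrable lborel (\<lambda>\<xi>. \<integral>z. a \<xi> z * \<psi> z \<partial>lborel)"
proof -
  have [measurable]: "\<psi> \<in> borel_measurable borel" using \<psi>[THEN borel_measurable_integrable] by simp
  have m: "case_prod (\<lambda>\<xi> z. a \<xi> z * \<psi> z) \<in> borel_measurable (borel \<Otimes>\<^sub>M borel)"
    by measurable
  have "\<bar>a \<xi> z * \<psi> z\<bar> \<le> V \<xi> * \<bar>\<psi> z\<bar>" for \<xi> z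
    unfolding abs_mult by (intro mult_right_mono le) simp
  note F = dominated_Fubini[OF m V integrable_abs[OF \<psi>] this]
  show "(\<integral>z. (\<integral>\<xi>. a \<xi> z \<partial>lborel) * \<psi> z \<partial>lborel) = (\<integral>\<xi>. (\<integral>z. a \<xi> z * \<psi> z \<partial>lborel) \<partial>lborel)"
    "integrable lborel (\<lambda>z. (\<integral>\<xi>. a \<xi> z \<partial>lborel) * \<psi> z)"
    "integrable lborel (\<lambda>\<xi>. \<integral>z. a \<xi> z * \<psi> z \<partial>lborel)"
    using F by simp_all
qed

lemma sin_tr_weak_derivative:
  fixes f :: "'a::euclidean_space \<Rightarrow> real"
  assumes f: "integrable lborel f" and f1: "integrable lborel (\<lambda>\<xi>. (\<xi> \<bullet> b) * f \<xi>)"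
    and \<phi>: "\<phi> \<in> test_functions UNIV" and b: "b \<in> Basis"
  shows "(\<integral>x. sin_tr f x * dir_deriv b \<phi> x \<partial>lborel) = - (\<integral>x. cos_tr (\<lambda>\<xi>. (\<xi> \<bullet> b) * f \<xi>) x * \<phi> x \<partial>lborel)"
proof -
  have [measurable]: "f \<in> borel_measurable borel" using f[THEN borel_measurable_integrable] by simp
  have m1: "case_prod (\<lambda>\<xi> x. f \<xi> * sin (\<xi> \<bullet> x)) \<in> borel_measurable (borel \<Otimes>\<^sub>M borel)"
    and m2: "case_prod (\<lambda>\<xi> x. (\<xi> \<bullet> b) * f \<xi> * cos (\<xi> \<bullet> x)) \<in> borel_measurable (borel \<Otimes>\<^sub>M borel)"
    by measurable
  have l1: "\<bar>f \<xi> * sin (\<xi> \<bullet> x)\<bar> \<le> \<bar>f \<xi>\<bar>" and l2: "\<bar>(\<xi> \<bullet> b) * f \<xi> * cos (\<xi> \<bullet> x)\<bar> \<le> \<bar>(\<xi> \<bullet> b) * f \<xi>\<bar>" for \<xi> x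
    unfolding abs_mult by (auto intro!: mult_left_le)
  have ibp: "(\<integral>x. f \<xi> * sin (\<xi> \<bullet> x) * dir_deriv b \<phi> x \<partial>lborel) = - (\<integral>x. (\<xi> \<bullet> b) * f \<xi> * cos (\<xi> \<bullet> x) * \<phi> x \<partial>lborel)" for \<xi>
  proof (rule integration_by_parts_test_functions[OF \<phi> b])
    show "((\<lambda>h. f \<xi> * sin (\<xi> \<bullet> (z + h *\<^sub>R b))) has_real_derivative (\<xi> \<bullet> b) * f \<xi> * cos (\<xi> \<bullet> z)) (at 0)" for z
      by (auto intro!: derivative_eq_intros simp: inner_add_right)
  qed (use l1 l2 in auto)
  have "(\<integral>x. sin_tr f x * dir_deriv b \<phi> x \<partial>lborel) = (\<integral>\<xi>. (\<integral>x. f \<xi> * sin (\<xi> \<bullet> x) * dir_deriv b \<phi> x \<partial>lborel) \<partial>lborel)"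
    unfolding sin_tr_def
    by (rule superposition(1)[OF m1 integrable_abs[OF f] test_functions_integrable[OF test_functions_dir_deriv[OF \<phi> b]] l1])
  also have "\<dots> = - (\<integral>\<xi>. (\<integral>x. (\<xi> \<bullet> b) * f \<xi> * cos (\<xi> \<bullet> x) * \<phi> x \<partial>lborel) \<partial>lborel)"
    unfolding ibp by simp
  also have "(\<integral>\<xi>. (\<integral>x. (\<xi> \<bullet> b) * f \<xi> * cos (\<xi> \<bullet> x) * \<phi> x \<partial>lborel) \<partial>lborel) = (\<integral>x. cos_tr (\<lambda>\<xi>. (\<xi> \<bullet> b) * f \<xi>) x * \<phi> x \<partial>lborel)"
    unfolding cos_tr_def
    by (rule superposition(1)[OF m2 integrable_abs[OF f1] test_functions_integrable[OF \<phi>] l2, symmetric])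
  finally show ?thesis .
qed

text \<open>An odd amplitude has no cosine transform, so the sine transform carries the whole
  energy.\<close>

lemma plancherel_sin:
  fixes f :: "'a::euclidean_space \<Rightarrow> real"
  assumes f: "integrable lborel f" and f2: "integrable lborel (\<lambda>x. (f x)\<^sup>2)" and odd: "\<And>x. f (- x) = - f x"
  shows "integrable lborel (\<lambda>x. (sin_tr f x)\<^sup>2)"
    and "(\<integral>x. (sin_tr f x)\<^sup>2 \<partial>lborel) = (gauss_mass TYPE('a))\<^sup>2 * (\<integral>x. (f x)\<^sup>2 \<partial>lborel)"
proof -
  have [measurable]: "f \<in> borel_measurable borel" using f[THEN borel_measurable_integrable] by simp
  have "cos_tr f x = 0" for x
    unfolding cos_tr_def by (rule integral_odd_eq_0) (simp_all add: odd)
  then show "integrable lborel (\<lambda>x. (sin_tr f x)\<^sup>2)"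
    "(\<integral>x. (sin_tr f x)\<^sup>2 \<partial>lborel) = (gauss_mass TYPE('a))\<^sup>2 * (\<integral>x. (f x)\<^sup>2 \<partial>lborel)"
    using fourier_square_le(1)[OF f f2] plancherel[OF f f2] by simp_all
qed

lemma plancherel_cos:
  fixes f :: "'a::euclidean_space \<Rightarrow> real"
  assumes f: "integrable lborel f" and f2: "integrable lborel (\<lambda>x. (f x)\<^sup>2)" and even: "\<And>x. f (- x) = f x"
  shows "integrable lborel (\<lambda>x. (cos_tr f x)\<^sup>2)"
    and "(\<integral>x. (cos_tr f x)\<^sup>2 \<partial>lborel) = (gauss_mass TYPE('a))\<^sup>2 * (\<integral>x. (f x)\<^sup>2 \<partial>lborel)"
proof -
  have [measurable]: "f \<in> borel_measurable borel" using f[THEN borel_measurable_integrable] by simp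
  have "sin_tr f x = 0" for x
    unfolding sin_tr_def by (rule integral_odd_eq_0) (simp_all add: even)
  then show "integrable lborel (\<lambda>x. (cos_tr f x)\<^sup>2)"
    "(\<integral>x. (cos_tr f x)\<^sup>2 \<partial>lborel) = (gauss_mass TYPE('a))\<^sup>2 * (\<integral>x. (f x)\<^sup>2 \<partial>lborel)"
    using fourier_square_le(1)[OF f f2] plancherel[OF f f2] by simp_all
qed

section \<open>Vector fields and their gradients\<close>

definition sin_vec :: "(real^'n \<Rightarrow> real^'n) \<Rightarrow> real^'n \<Rightarrow> real^'n::finite" where
  "sin_vec a x = (\<chi> i. sin_tr (\<lambda>\<xi>. a \<xi> $ i) x)"

text \<open>The gradient of \<open>sin_vec a\<close>: differentiating a sine in direction
  \<open>j\<close> brings down \<open>\<xi> $ j\<close> and leaves a cosine. Rows belong to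
  components and columns to derivatives, as in \<open>weak_gradient\<close>.\<close>

definition cos_mat :: "(real^'n \<Rightarrow> real^'n) \<Rightarrow> real^'n \<Rightarrow> real^'n^'n::finite" where
  "cos_mat a x = (\<chi> i j. cos_tr (\<lambda>\<xi>. \<xi> $ j * a \<xi> $ i) x)"

lemma abs_nth_le_norm: "\<bar>x $ i\<bar> \<le> norm (x :: real^'n::finite)"
  using component_le_norm_cart[of x i] by simp

lemma integrable_component:
  fixes a :: "real^'n \<Rightarrow> real^'n::finite"
  assumes [measurable]: "a \<in> borel_measurable borel" and "integrable lborel (\<lambda>\<xi>. norm (a \<xi>))"
  shows "integrable lborel (\<lambda>\<xi>. a \<xi> $ i)"
  by (rule integrable_dominated[OF assms(2)]) (use borel_measurable_vec_nth[OF assms(1)] abs_nth_le_norm in auto)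

lemma integrable_component_square:
  fixes a :: "real^'n \<Rightarrow> real^'n::finite"
  assumes [measurable]: "a \<in> borel_measurable borel" and "integrable lborel (\<lambda>\<xi>. (norm (a \<xi>))\<^sup>2)"
  shows "integrable lborel (\<lambda>\<xi>. (a \<xi> $ i)\<^sup>2)"
proof (rule integrable_dominated[OF assms(2)])
  have [measurable]: "(\<lambda>\<xi>. a \<xi> $ i) \<in> borel_measurable borel" by (rule borel_measurable_vec_nth) simp
  show "(\<lambda>\<xi>. (a \<xi> $ i)\<^sup>2) \<in> borel_measurable borel" by measurable
  show "norm ((a \<xi> $ i)\<^sup>2) \<le> (norm (a \<xi>))\<^sup>2" for \<xi>
    using power_mono[OF abs_nth_le_norm[of "a \<xi>" i], of 2] by simp
qed

lemma plancherel_sin_vec: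
  fixes a :: "real^'n \<Rightarrow> real^'n::finite"
  assumes m: "a \<in> borel_measurable borel" and a1: "integrable lborel (\<lambda>\<xi>. norm (a \<xi>))"
    and a2: "integrable lborel (\<lambda>\<xi>. (norm (a \<xi>))\<^sup>2)" and odd: "\<And>\<xi>. a (- \<xi>) = - a \<xi>"
  shows "sin_vec a \<in> borel_measurable borel" "integrable lborel (\<lambda>x. (norm (sin_vec a x))\<^sup>2)"
    "(\<integral>x. (norm (sin_vec a x))\<^sup>2 \<partial>lborel) = (gauss_mass TYPE(real^'n))\<^sup>2 * (\<integral>\<xi>. (norm (a \<xi>))\<^sup>2 \<partial>lborel)"
proof -
  note P = plancherel_sin[OF integrable_component[OF m a1] integrable_component_square[OF m a2]]
  have e: "(norm (sin_vec a x))\<^sup>2 = (\<Sum>i\<in>UNIV. (sin_tr (\<lambda>\<xi>. a \<xi> $ i) x)\<^sup>2)" for x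
    by (simp add: norm_vec_power2 sin_vec_def)
  show "sin_vec a \<in> borel_measurable borel"
    by (rule borel_measurable_vecI) (simp add: sin_vec_def sin_tr_measurable borel_measurable_vec_nth[OF m])
  show "integrable lborel (\<lambda>x. (norm (sin_vec a x))\<^sup>2)"
    unfolding e by (intro Bochner_Integration.integrable_sum P) (simp add: odd)
  have "(\<integral>x. (norm (sin_vec a x))\<^sup>2 \<partial>lborel) = (\<Sum>i\<in>UNIV. (\<integral>x. (sin_tr (\<lambda>\<xi>. a \<xi> $ i) x)\<^sup>2 \<partial>lborel))"
    unfolding e by (intro Bochner_Integration.integral_sum P) (simp add: odd)
  also have "\<dots> = (\<Sum>i\<in>UNIV. (gauss_mass TYPE(real^'n))\<^sup>2 * (\<integral>\<xi>. (a \<xi> $ i)\<^sup>2 \<partial>lborel))"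
    by (intro sum.cong refl P) (simp add: odd)
  also have "\<dots> = (gauss_mass TYPE(real^'n))\<^sup>2 * (\<integral>\<xi>. (norm (a \<xi>))\<^sup>2 \<partial>lborel)"
    unfolding norm_vec_power2 sum_distrib_left[symmetric]
    by (subst Bochner_Integration.integral_sum) (simp_all add: integrable_component_square[OF m a2])
  finally show "(\<integral>x. (norm (sin_vec a x))\<^sup>2 \<partial>lborel) = (gauss_mass TYPE(real^'n))\<^sup>2 * (\<integral>\<xi>. (norm (a \<xi>))\<^sup>2 \<partial>lborel)" .
qed

text \<open>The squares of all products \<open>\<xi> $ j * a \<xi> $ i\<close> sum to
  \<open>(norm \<xi> * norm (a \<xi>))^2\<close>, which matches the Frobenius norm; each product is
  even because \<open>a\<close> is odd.\<close>

lemma plancherel_cos_mat: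
  fixes a :: "real^'n \<Rightarrow> real^'n::finite"
  assumes m: "a \<in> borel_measurable borel" and a1: "integrable lborel (\<lambda>\<xi>. norm \<xi> * norm (a \<xi>))"
    and a2: "integrable lborel (\<lambda>\<xi>. (norm \<xi> * norm (a \<xi>))\<^sup>2)" and odd: "\<And>\<xi>. a (- \<xi>) = - a \<xi>"
  shows "cos_mat a \<in> borel_measurable borel" "integrable lborel (\<lambda>x. (norm (cos_mat a x))\<^sup>2)"
    "(\<integral>x. (norm (cos_mat a x))\<^sup>2 \<partial>lborel) = (gauss_mass TYPE(real^'n))\<^sup>2 * (\<integral>\<xi>. (norm \<xi> * norm (a \<xi>))\<^sup>2 \<partial>lborel)"
proof -
  have [measurable]: "(\<lambda>\<xi>. a \<xi> $ i) \<in> borel_measurable borel" "(\<lambda>\<xi>::real^'n. \<xi> $ j) \<in> borel_measurable borel"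
    for i j
    by (rule borel_measurable_vec_nth[OF m], rule borel_measurable_nth_id)
  define f where "f i j \<xi> = \<xi> $ j * a \<xi> $ i" for i j \<xi>
  have fm[measurable]: "f i j \<in> borel_measurable borel" for i j unfolding f_def[abs_def] by measurable
  have le: "\<bar>f i j \<xi>\<bar> \<le> norm \<xi> * norm (a \<xi>)" for i j \<xi>
    unfolding f_def abs_mult by (intro mult_mono abs_nth_le_norm) auto
  have f1: "integrable lborel (f i j)" for i j
    by (rule integrable_dominated[OF a1]) (use le in auto)
  have f2: "integrable lborel (\<lambda>\<xi>. (f i j \<xi>)\<^sup>2)" for i j
  proof (rule integrable_dominated[OF a2])
    show "norm ((f i j \<xi>)\<^sup>2) \<le> (norm \<xi> * norm (a \<xi>))\<^sup>2" for \<xi>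
      using power_mono[OF le[of i j \<xi>], of 2] by simp
  qed simp
  have "f i j (- \<xi>) = f i j \<xi>" for i j \<xi> by (simp add: f_def odd)
  note P = plancherel_cos[OF f1 f2 this]
  have e: "(norm (cos_mat a x))\<^sup>2 = (\<Sum>i\<in>UNIV. \<Sum>j\<in>UNIV. (cos_tr (f i j) x)\<^sup>2)" for x
    by (simp add: norm_vec_power2 cos_mat_def f_def[abs_def])
  have e2: "(norm \<xi> * norm (a \<xi>))\<^sup>2 = (\<Sum>i\<in>UNIV. \<Sum>j\<in>UNIV. (f i j \<xi>)\<^sup>2)" for \<xi>
    unfolding power_mult_distrib norm_vec_power2 f_def sum_product
    by (subst sum.swap) (simp add: power_mult_distrib)
  show "cos_mat a \<in> borel_measurable borel"
    by (intro borel_measurable_vecI) (simp add: cos_mat_def cos_tr_measurable flip: f_def)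
  show "integrable lborel (\<lambda>x. (norm (cos_mat a x))\<^sup>2)"
    unfolding e by (intro Bochner_Integration.integrable_sum P)
  have "(\<integral>x. (norm (cos_mat a x))\<^sup>2 \<partial>lborel) = (\<Sum>i\<in>UNIV. \<Sum>j\<in>UNIV. (\<integral>x. (cos_tr (f i j) x)\<^sup>2 \<partial>lborel))"
    unfolding e by (simp add: P)
  also have "\<dots> = (\<Sum>i\<in>UNIV. \<Sum>j\<in>UNIV. (gauss_mass TYPE(real^'n))\<^sup>2 * (\<integral>\<xi>. (f i j \<xi>)\<^sup>2 \<partial>lborel))"
    by (simp only: P)
  also have "\<dots> = (gauss_mass TYPE(real^'n))\<^sup>2 * (\<integral>\<xi>. (norm \<xi> * norm (a \<xi>))\<^sup>2 \<partial>lborel)"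
    unfolding e2 by (simp add: f2 sum_distrib_left)
  finally show "(\<integral>x. (norm (cos_mat a x))\<^sup>2 \<partial>lborel) = (gauss_mass TYPE(real^'n))\<^sup>2 * (\<integral>\<xi>. (norm \<xi> * norm (a \<xi>))\<^sup>2 \<partial>lborel)" .
qed

lemma L2_norm_power2:
  fixes f :: "'a::euclidean_space \<Rightarrow> 'b::euclidean_space"
  assumes [measurable]: "f \<in> borel_measurable borel"
  shows "(L2_norm f)\<^sup>2 = (\<integral>x. (norm (f x))\<^sup>2 \<partial>lborel)"
proof -
  have "(\<integral>x. (norm (f x))\<^sup>2 \<partial>lebesgue) = (\<integral>x. (norm (f x))\<^sup>2 \<partial>lborel)"
    by (rule integral_lebesgue_lborel) measurable
  then show ?thesis unfolding L2_norm_def by simp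
qed

lemma L2_norm_zero: "L2_norm (\<lambda>_. 0) = 0"
  by (simp add: L2_norm_def)

lemma L2_borelI:
  fixes f :: "'a::euclidean_space \<Rightarrow> 'b::euclidean_space"
  assumes [measurable]: "f \<in> borel_measurable borel" and i: "integrable lborel (\<lambda>x. (norm (f x))\<^sup>2)"
  shows "f \<in> L2"
  unfolding L2_on_def using assms
  by (auto simp: lebesgue_on_UNIV_eq integrable_completion intro!: measurable_completion)

lemma zero_in_L2: "(\<lambda>_. 0) \<in> L2_on S"
  by (simp add: L2_on_def)

lemma div_free_zero: "div_free (\<lambda>_. 0)"
  by (simp add: div_free_def)

lemma leray_hopf_field_zero: "leray_hopf_field (\<lambda>_ _. 0) (\<lambda>_ _. 0) (\<lambda>_. 0)"
  unfolding leray_hopf_field_def weak_gradient_def weakly_continuous_L2_def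
  by (auto simp: L2_norm_zero zero_in_L2 div_free_zero case_prod_unfold)


section \<open>The nonlinearity in frequency variables\<close>

text \<open>Expanding the sine of a sum of frequencies leaves two products, and the one containing
  \<open>cos_tr f\<close> vanishes by oddness. The convection term therefore stays within the class
  of sine transforms.\<close>

lemma sin_tr_mult_cos_tr:
  fixes f g :: "'a::euclidean_space \<Rightarrow> real"
  assumes f: "integrable lborel f" and g: "integrable lborel g" and odd: "\<And>\<xi>. f (- \<xi>) = - f \<xi>"
  shows "sin_tr f x * cos_tr g x = sin_tr (\<lambda>\<xi>. \<integral>\<zeta>. f (\<xi> - \<zeta>) * g \<zeta> \<partial>lborel) x"
proof -
  have [measurable]: "f \<in> borel_measurable borel" using f[THEN borel_measurable_integrable] by simp
  have c0: "cos_tr f x = 0"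
    unfolding cos_tr_def by (rule integral_odd_eq_0) (simp_all add: odd)
  have inner: "(\<integral>\<eta>. sin ((\<eta> + \<zeta>) \<bullet> x) * f \<eta> * g \<zeta> \<partial>lborel) = sin_tr f x * (g \<zeta> * cos (\<zeta> \<bullet> x))" for \<zeta>
  proof -
    have e: "sin ((\<eta> + \<zeta>) \<bullet> x) * f \<eta> * g \<zeta> =
        (f \<eta> * sin (\<eta> \<bullet> x)) * (g \<zeta> * cos (\<zeta> \<bullet> x)) + (f \<eta> * cos (\<eta> \<bullet> x)) * (g \<zeta> * sin (\<zeta> \<bullet> x))" for \<eta>
      by (simp add: inner_add_left sin_add algebra_simps)
    have "(\<integral>\<eta>. sin ((\<eta> + \<zeta>) \<bullet> x) * f \<eta> * g \<zeta> \<partial>lborel) =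
      sin_tr f x * (g \<zeta> * cos (\<zeta> \<bullet> x)) + cos_tr f x * (g \<zeta> * sin (\<zeta> \<bullet> x))"
      unfolding e sin_tr_def cos_tr_def
      by (subst Bochner_Integration.integral_add)
         (auto intro!: integrable_mult_left integrable_mult_cos_sin f)
    then show ?thesis using c0 by simp
  qed
  have "sin_tr f x * cos_tr g x = (\<integral>\<zeta>. sin_tr f x * (g \<zeta> * cos (\<zeta> \<bullet> x)) \<partial>lborel)"
    unfolding cos_tr_def by simp
  also have "\<dots> = (\<integral>\<zeta>. (\<integral>\<eta>. sin ((\<eta> + \<zeta>) \<bullet> x) * f \<eta> * g \<zeta> \<partial>lborel) \<partial>lborel)"
    unfolding inner ..
  also have "\<dots> = (\<integral>\<xi>. sin (\<xi> \<bullet> x) * (\<integral>\<zeta>. f (\<xi> - \<zeta>) * g \<zeta> \<partial>lborel) \<partial>lborel)"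
    by (rule integral_convolution[OF f g, where B = 1]) auto
  finally show ?thesis unfolding sin_tr_def by (simp add: mult.commute)
qed

text \<open>Frequency form of the convection term. The derivative itself brings the factor
  \<open>\<eta> \<bullet> a (\<xi> - \<eta>)\<close>; for amplitudes orthogonal to their frequency
  this equals \<open>\<xi> \<bullet> a (\<xi> - \<eta>)\<close>, and the output frequency can be
  pulled out of all estimates.\<close>

definition convect :: "(real^'n \<Rightarrow> real^'n) \<Rightarrow> (real^'n \<Rightarrow> real^'n) \<Rightarrow> real^'n \<Rightarrow> real^'n::finite" where
  "convect a b \<xi> = (\<integral>\<eta>. (\<xi> \<bullet> a (\<xi> - \<eta>)) *\<^sub>R b \<eta> \<partial>lborel)"

text \<open>The Fourier multiplier that removes the gradient part of a field. At
  \<open>\<xi> = 0\<close>, where division by zero gives zero, it is the identity.\<close>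

definition leray_proj :: "real^'n \<Rightarrow> real^'n \<Rightarrow> real^'n::finite" where
  "leray_proj \<xi> v = v - ((\<xi> \<bullet> v) / (norm \<xi>)\<^sup>2) *\<^sub>R \<xi>"

lemma inner_leray_proj: "\<xi> \<bullet> leray_proj \<xi> v = 0"
  by (cases "\<xi> = 0") (simp_all add: leray_proj_def inner_diff_right power2_norm_eq_inner)

lemma norm_leray_proj_le: "norm (leray_proj \<xi> v) \<le> norm v"
proof -
  have "(norm (leray_proj \<xi> v))\<^sup>2 \<le> (norm v)\<^sup>2"
  proof -
    have "v = leray_proj \<xi> v + ((\<xi> \<bullet> v) / (norm \<xi>)\<^sup>2) *\<^sub>R \<xi>" by (simp add: leray_proj_def)
    then have "(norm v)\<^sup>2 = (norm (leray_proj \<xi> v + ((\<xi> \<bullet> v) / (norm \<xi>)\<^sup>2) *\<^sub>R \<xi>))\<^sup>2" by simp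
    also have "\<dots> = (norm (leray_proj \<xi> v))\<^sup>2 + (norm (((\<xi> \<bullet> v) / (norm \<xi>)\<^sup>2) *\<^sub>R \<xi>))\<^sup>2"
      using inner_leray_proj[of \<xi> v]
      by (simp only: power2_norm_eq_inner) (simp add: inner_add_left inner_add_right inner_commute)
    finally show ?thesis by (simp only: le_add_same_cancel1 zero_le_power2)
  qed
  then show ?thesis by (rule power2_le_imp_le) simp
qed

lemma leray_proj_diff: "leray_proj \<xi> (v - w) = leray_proj \<xi> v - leray_proj \<xi> w"
  by (simp add: leray_proj_def inner_diff_right diff_divide_distrib scaleR_diff_left)

lemma leray_proj_minus: "leray_proj (- \<xi>) (- v) = - leray_proj \<xi> v"
  by (simp add: leray_proj_def)

text \<open>A majorant of amplitudes that does not depend on time. Its four integrability conditions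
  stand, in this order, for absolute convergence of the field, absolute convergence of its gradient,
  finite energy and square integrable gradient.\<close>

locale envelope =
  fixes W :: "real^'n::finite \<Rightarrow> real"
  assumes W_meas[measurable]: "W \<in> borel_measurable borel"
    and W_nonneg: "0 \<le> W \<xi>"
    and W_int: "integrable lborel W"
    and W_int1: "integrable lborel (\<lambda>\<xi>. norm \<xi> * W \<xi>)"
    and W_sq: "integrable lborel (\<lambda>\<xi>. (W \<xi>)\<^sup>2)"
    and W_sq1: "integrable lborel (\<lambda>\<xi>. (norm \<xi> * W \<xi>)\<^sup>2)"
begin

definition "WW \<xi> = (\<integral>\<eta>. W (\<xi> - \<eta>) * W \<eta> \<partial>lborel)"

text \<open>Majorant of \<open>norm \<xi> * WW \<xi>\<close>, obtained by distributing the factor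
  \<open>norm \<xi>\<close> over the two frequencies that add up to \<open>\<xi>\<close>. Each term
  is a convolution of integrable functions, so the convection term has an integrable
  amplitude.\<close>

definition "WW1 \<xi> = (\<integral>\<eta>. norm (\<xi> - \<eta>) * W (\<xi> - \<eta>) * W \<eta> \<partial>lborel) + (\<integral>\<eta>. W (\<xi> - \<eta>) * (norm \<eta> * W \<eta>) \<partial>lborel)"

lemma W_reflect_sq: "integrable lborel (\<lambda>\<eta>. (W (\<xi> - \<eta>))\<^sup>2)" "integrable lborel (\<lambda>\<eta>. (norm (\<xi> - \<eta>) * W (\<xi> - \<eta>))\<^sup>2)"
  using lborel_integral_reflect(2)[of "\<lambda>\<eta>. (W \<eta>)\<^sup>2" \<xi>] lborel_integral_reflect(2)[of "\<lambda>\<eta>. (norm \<eta> * W \<eta>)\<^sup>2" \<xi>]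
    W_sq W_sq1 by simp_all

lemma integrable_WW: "integrable lborel (\<lambda>\<eta>. W (\<xi> - \<eta>) * W \<eta>)"
  by (rule integrable_mult_of_square[OF _ _ W_reflect_sq(1) W_sq]) measurable

lemma integrable_WW1: "integrable lborel (\<lambda>\<eta>. norm (\<xi> - \<eta>) * W (\<xi> - \<eta>) * W \<eta>)"
  "integrable lborel (\<lambda>\<eta>. W (\<xi> - \<eta>) * (norm \<eta> * W \<eta>))"
  by (rule integrable_mult_of_square[OF _ _ W_reflect_sq(2) W_sq], measurable)
     (rule integrable_mult_of_square[OF _ _ W_reflect_sq(1) W_sq1], measurable)

lemma WW_nonneg: "0 \<le> WW \<xi>"
  unfolding WW_def by (intro integral_nonneg_AE AE_I2 mult_nonneg_nonneg W_nonneg)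

lemma WW_le: "WW \<xi> \<le> (\<integral>\<eta>. (W \<eta>)\<^sup>2 \<partial>lborel)"
  using integral_mult_le_square[OF _ _ W_reflect_sq(1) W_sq, of \<xi>]
    lborel_integral_reflect(1)[of "\<lambda>\<eta>. (W \<eta>)\<^sup>2" \<xi>] unfolding WW_def by simp

lemma WW_integrable: "integrable lborel WW"
  unfolding WW_def[abs_def] by (rule integrable_convolution[OF W_int W_int])

lemma WW1_integrable: "integrable lborel WW1"
  unfolding WW1_def[abs_def]
  by (intro Bochner_Integration.integrable_add integrable_convolution[OF W_int W_int1]
    integrable_convolution[OF W_int1 W_int])

lemma WW_meas[measurable]: "WW \<in> borel_measurable borel"
  using borel_measurable_integrable[OF WW_integrable] by simp

lemma norm_WW_le: "norm \<xi> * WW \<xi> \<le> WW1 \<xi>"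
proof -
  have "norm \<xi> * WW \<xi> = (\<integral>\<eta>. norm \<xi> * (W (\<xi> - \<eta>) * W \<eta>) \<partial>lborel)"
    unfolding WW_def by simp
  also have "\<dots> \<le> (\<integral>\<eta>. norm (\<xi> - \<eta>) * W (\<xi> - \<eta>) * W \<eta> + W (\<xi> - \<eta>) * (norm \<eta> * W \<eta>) \<partial>lborel)"
  proof (rule integral_mono)
    fix \<eta>
    have "norm \<xi> \<le> norm (\<xi> - \<eta>) + norm \<eta>" using norm_triangle_ineq[of "\<xi> - \<eta>" \<eta>] by simp
    from mult_right_mono[OF this, of "W (\<xi> - \<eta>) * W \<eta>"]
    show "norm \<xi> * (W (\<xi> - \<eta>) * W \<eta>) \<le> norm (\<xi> - \<eta>) * W (\<xi> - \<eta>) * W \<eta> + W (\<xi> - \<eta>) * (norm \<eta> * W \<eta>)"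
      using W_nonneg by (simp add: algebra_simps)
  qed (use integrable_WW integrable_WW1 in auto)
  also have "\<dots> = WW1 \<xi>" unfolding WW1_def using integrable_WW1 by simp
  finally show ?thesis .
qed

lemma convect_integrable:
  assumes a[measurable]: "a \<in> borel_measurable borel" and b[measurable]: "b \<in> borel_measurable borel"
    and le: "\<And>\<xi>. norm (a \<xi>) \<le> \<alpha> * W \<xi>" "\<And>\<xi>. norm (b \<xi>) \<le> \<beta> * W \<xi>"
  shows "integrable lborel (\<lambda>\<eta>. (\<xi> \<bullet> a (\<xi> - \<eta>)) *\<^sub>R b \<eta>)"
    and "norm (convect a b \<xi>) \<le> \<alpha> * \<beta> * (norm \<xi> * WW \<xi>)"
proof -
  have n: "norm ((\<xi> \<bullet> a (\<xi> - \<eta>)) *\<^sub>R b \<eta>) \<le> norm \<xi> * \<alpha> * \<beta> * (W (\<xi> - \<eta>) * W \<eta>)" for \<eta>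
  proof -
    have p: "0 \<le> \<alpha> * W (\<xi> - \<eta>)" by (rule order_trans[OF norm_ge_zero le(1)])
    have "\<bar>\<xi> \<bullet> a (\<xi> - \<eta>)\<bar> \<le> norm \<xi> * (\<alpha> * W (\<xi> - \<eta>))"
      by (rule order_trans[OF Cauchy_Schwarz_ineq2 mult_left_mono[OF le(1)]]) simp
    from mult_mono[OF this le(2)[of \<eta>] mult_nonneg_nonneg[OF norm_ge_zero p] norm_ge_zero]
    show ?thesis by (simp add: mult_ac)
  qed
  show i: "integrable lborel (\<lambda>\<eta>. (\<xi> \<bullet> a (\<xi> - \<eta>)) *\<^sub>R b \<eta>)"
    by (rule integrable_dominated[OF integrable_mult_right[OF integrable_WW[of \<xi>]] _ n]) measurable
  have "norm (convect a b \<xi>) \<le> (\<integral>\<eta>. norm \<xi> * \<alpha> * \<beta> * (W (\<xi> - \<eta>) * W \<eta>) \<partial>lborel)"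
    unfolding convect_def
    by (rule order_trans[OF integral_norm_bound integral_mono[OF integrable_norm[OF i] integrable_mult_right[OF integrable_WW] n]])
  then show "norm (convect a b \<xi>) \<le> \<alpha> * \<beta> * (norm \<xi> * WW \<xi>)"
    unfolding WW_def by (simp add: mult_ac)
qed

lemma cos_mat_mult_sin_vec:
  assumes a[measurable]: "a \<in> borel_measurable borel" and le: "\<And>\<xi>. norm (a \<xi>) \<le> W \<xi>"
    and odd: "\<And>\<xi>. a (- \<xi>) = - a \<xi>" and div: "\<And>\<xi>. \<xi> \<bullet> a \<xi> = 0"
  shows "(cos_mat a x *v sin_vec a x) $ i = sin_tr (\<lambda>\<xi>. convect a a \<xi> $ i) x"
proof -
  have am[measurable]: "(\<lambda>\<xi>. a \<xi> $ i) \<in> borel_measurable borel" for i by (rule borel_measurable_vec_nth) simp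
  have xm[measurable]: "(\<lambda>\<xi>::real^'n. \<xi> $ i) \<in> borel_measurable borel" for i by (rule borel_measurable_nth_id)
  have l: "\<bar>a \<xi> $ i\<bar> \<le> W \<xi>" for i \<xi> using abs_nth_le_norm[of "a \<xi>" i] le[of \<xi>] by linarith
  have l1: "\<bar>\<xi> $ j * a \<xi> $ i\<bar> \<le> norm \<xi> * W \<xi>" for i j \<xi>
    unfolding abs_mult by (intro mult_mono l abs_nth_le_norm) auto
  have f: "integrable lborel (\<lambda>\<xi>. a \<xi> $ j)" for j
    by (rule integrable_dominated[OF W_int]) (use l in auto)
  have g: "integrable lborel (\<lambda>\<xi>. \<xi> $ j * a \<xi> $ i)" for j
    by (rule integrable_dominated[OF W_int1]) (use l1 in auto)
  have ifg: "integrable lborel (\<lambda>\<zeta>. a (\<xi> - \<zeta>) $ j * (\<zeta> $ j * a \<zeta> $ i))" for \<xi> j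
  proof (rule integrable_dominated[OF integrable_WW1(2)[of \<xi>]])
    show "norm (a (\<xi> - \<zeta>) $ j * (\<zeta> $ j * a \<zeta> $ i)) \<le> W (\<xi> - \<zeta>) * (norm \<zeta> * W \<zeta>)" for \<zeta>
      unfolding real_norm_def abs_mult[of "a (\<xi> - \<zeta>) $ j"] by (intro mult_mono l l1) (auto simp: W_nonneg)
  qed measurable
  let ?c = "\<lambda>j \<xi>. \<integral>\<zeta>. a (\<xi> - \<zeta>) $ j * (\<zeta> $ j * a \<zeta> $ i) \<partial>lborel"
  have ic: "integrable lborel (?c j)" for j by (rule integrable_convolution[OF f g])
  have "(cos_mat a x *v sin_vec a x) $ i = (\<Sum>j\<in>UNIV. sin_tr (\<lambda>\<xi>. a \<xi> $ j) x * cos_tr (\<lambda>\<xi>. \<xi> $ j * a \<xi> $ i) x)"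
    by (simp add: matrix_vector_mult_def cos_mat_def sin_vec_def mult.commute)
  also have "\<dots> = (\<Sum>j\<in>UNIV. sin_tr (?c j) x)"
    by (intro sum.cong refl sin_tr_mult_cos_tr[OF f g]) (simp add: odd)
  also have "\<dots> = sin_tr (\<lambda>\<xi>. \<Sum>j\<in>UNIV. ?c j \<xi>) x"
    unfolding sin_tr_def sum_distrib_right
    by (rule Bochner_Integration.integral_sum[symmetric]) (rule integrable_mult_cos_sin(2)[OF ic])
  also have "(\<lambda>\<xi>. \<Sum>j\<in>UNIV. ?c j \<xi>) = (\<lambda>\<xi>. convect a a \<xi> $ i)"
  proof
    fix \<xi>
    have s: "(\<Sum>j\<in>UNIV. a (\<xi> - \<zeta>) $ j * (\<zeta> $ j * a \<zeta> $ i)) = ((\<xi> \<bullet> a (\<xi> - \<zeta>)) *\<^sub>R a \<zeta>) $ i" for \<zeta>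
    proof -
      have "(\<Sum>j\<in>UNIV. a (\<xi> - \<zeta>) $ j * (\<zeta> $ j * a \<zeta> $ i)) = (\<zeta> \<bullet> a (\<xi> - \<zeta>)) * a \<zeta> $ i"
        by (simp add: inner_vec_def sum_distrib_left mult_ac)
      \<comment> \<open>Incompressibility of the transporting field: the frequency hit by the
        derivative may be replaced by the output frequency.\<close>
      moreover have "\<zeta> \<bullet> a (\<xi> - \<zeta>) = \<xi> \<bullet> a (\<xi> - \<zeta>)"
        using div[of "\<xi> - \<zeta>"] by (simp add: inner_diff_left)
      ultimately show ?thesis by simp
    qed
    have "(\<Sum>j\<in>UNIV. ?c j \<xi>) = (\<integral>\<zeta>. ((\<xi> \<bullet> a (\<xi> - \<zeta>)) *\<^sub>R a \<zeta>) $ i \<partial>lborel)"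
      unfolding s[symmetric] by (rule Bochner_Integration.integral_sum[symmetric]) (rule ifg)
    also have "\<dots> = convect a a \<xi> $ i"
      unfolding convect_def
      by (rule integral_bounded_linear[OF bounded_linear_vec_nth])
         (rule convect_integrable(1)[where \<alpha> = 1 and \<beta> = 1], use le in auto)
    finally show "(\<Sum>j\<in>UNIV. ?c j \<xi>) = convect a a \<xi> $ i" .
  qed
  finally show ?thesis .
qed

text \<open>The integrand is antisymmetric under exchanging the output frequency with \<open>\<eta>\<close>, because
  \<open>(\<xi> - \<eta>) \<bullet> a (\<xi> - \<eta>) = 0\<close>.\<close>

lemma convect_energy:
  assumes a[measurable]: "a \<in> borel_measurable borel" and le: "\<And>\<xi>. norm (a \<xi>) \<le> W \<xi>"
    and odd: "\<And>\<xi>. a (- \<xi>) = - a \<xi>" and div: "\<And>\<xi>. \<xi> \<bullet> a \<xi> = 0"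
  shows "(\<integral>\<xi>. a \<xi> \<bullet> convect a a \<xi> \<partial>lborel) = 0"
proof -
  define T where "T \<xi> \<eta> = (\<xi> \<bullet> a (\<xi> - \<eta>)) * (a \<xi> \<bullet> a \<eta>)" for \<xi> \<eta>
  have e: "a \<xi> \<bullet> convect a a \<xi> = (\<integral>\<eta>. T \<xi> \<eta> \<partial>lborel)" for \<xi>
  proof -
    have "a \<xi> \<bullet> convect a a \<xi> = (\<integral>\<eta>. a \<xi> \<bullet> ((\<xi> \<bullet> a (\<xi> - \<eta>)) *\<^sub>R a \<eta>) \<partial>lborel)"
      unfolding convect_def
      by (rule integral_bounded_linear[OF bounded_linear_inner_right, symmetric])
         (rule convect_integrable(1)[where \<alpha> = 1 and \<beta> = 1], use le in auto)
    then show ?thesis unfolding T_def by simp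
  qed
  have anti: "T \<eta> \<xi> = - T \<xi> \<eta>" for \<xi> \<eta>
  proof -
    have "a (\<eta> - \<xi>) = - a (\<xi> - \<eta>)" using odd[of "\<xi> - \<eta>"] by simp
    moreover have "\<eta> \<bullet> a (\<xi> - \<eta>) = \<xi> \<bullet> a (\<xi> - \<eta>)" using div[of "\<xi> - \<eta>"] by (simp add: inner_diff_left)
    ultimately show ?thesis unfolding T_def by (simp add: inner_commute)
  qed
  have T_le: "\<bar>T \<xi> \<eta>\<bar> \<le> norm \<xi> * W \<xi> * (W (\<xi> - \<eta>) * W \<eta>)" for \<xi> \<eta>
  proof -
    have "\<bar>T \<xi> \<eta>\<bar> \<le> (norm \<xi> * norm (a (\<xi> - \<eta>))) * (norm (a \<xi>) * norm (a \<eta>))"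
      unfolding T_def abs_mult by (intro mult_mono Cauchy_Schwarz_ineq2) auto
    also have "\<dots> \<le> (norm \<xi> * W (\<xi> - \<eta>)) * (W \<xi> * W \<eta>)"
      by (intro mult_mono le mult_left_mono mult_nonneg_nonneg W_nonneg) auto
    finally show ?thesis by (simp add: mult_ac)
  qed
  have Tm: "case_prod T \<in> borel_measurable (lborel \<Otimes>\<^sub>M lborel)" unfolding T_def[abs_def] by measurable
  have dom: "integrable (lborel \<Otimes>\<^sub>M lborel) (\<lambda>(\<xi>, \<eta>). norm \<xi> * W \<xi> * (W (\<xi> - \<eta>) * W \<eta>))"
  proof (rule lborel_pair.Fubini_integrable)
    show "AE \<xi> in lborel. integrable lborel (\<lambda>\<eta>. case (\<xi>, \<eta>) of (\<xi>, \<eta>) \<Rightarrow> norm \<xi> * W \<xi> * (W (\<xi> - \<eta>) * W \<eta>))"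
      unfolding prod.case by (intro AE_I2 integrable_mult_right integrable_WW)
    \<comment> \<open>The inner integral is \<open>WW \<xi>\<close>, bounded by the square integral
      of \<open>W\<close>; what is left is the integrable function
      \<open>norm \<xi> * W \<xi>\<close>.\<close>
    have "integrable lborel (\<lambda>\<xi>. WW \<xi> * (norm \<xi> * W \<xi>))"
      by (rule integrable_bounded_mult[OF W_int1 WW_meas]) (use WW_nonneg WW_le in auto)
    moreover have "(\<integral>\<eta>. norm (norm \<xi> * W \<xi> * (W (\<xi> - \<eta>) * W \<eta>)) \<partial>lborel) = WW \<xi> * (norm \<xi> * W \<xi>)" for \<xi>
      unfolding WW_def using W_nonneg by (simp add: abs_mult)
    ultimately show "integrable lborel (\<lambda>\<xi>. \<integral>\<eta>. norm (case (\<xi>, \<eta>) of (\<xi>, \<eta>) \<Rightarrow> norm \<xi> * W \<xi> * (W (\<xi> - \<eta>) * W \<eta>)) \<partial>lborel)"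
      unfolding prod.case by simp
  qed measurable
  have iT: "integrable (lborel \<Otimes>\<^sub>M lborel) (case_prod T)"
  proof (rule Bochner_Integration.integrable_bound[OF dom Tm], intro AE_I2)
    show "norm (case_prod T z) \<le> norm (case z of (\<xi>, \<eta>) \<Rightarrow> norm \<xi> * W \<xi> * (W (\<xi> - \<eta>) * W \<eta>))" for z
      using order_trans[OF T_le abs_ge_self] by (cases z) simp
  qed
  have "(\<integral>\<xi>. (\<integral>\<eta>. T \<xi> \<eta> \<partial>lborel) \<partial>lborel) = (\<integral>\<eta>. (\<integral>\<xi>. T \<xi> \<eta> \<partial>lborel) \<partial>lborel)"
    using lborel_pair.Fubini_integral[OF iT] by simp
  also have "(\<lambda>\<eta>. \<integral>\<xi>. T \<xi> \<eta> \<partial>lborel) = (\<lambda>\<eta>. - (\<integral>\<xi>. T \<eta> \<xi> \<partial>lborel))"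
    by (subst anti) (simp only: integral_minus)
  finally show ?thesis unfolding e by simp
qed

end


section \<open>The momentum equation\<close>

text \<open>Bound, parity and orthogonality are imposed for all real times, so that measurability
  and domination need no case split. Continuity is imposed from time zero on and the equation for
  positive times, which is all that \<open>spacetime\<close> and the initial condition see.\<close>

locale frequency_solution = envelope W for W :: "real^'n::finite \<Rightarrow> real" +
  fixes c :: "real \<Rightarrow> real^'n \<Rightarrow> real^'n"
  assumes c_meas: "case_prod c \<in> borel_measurable (borel \<Otimes>\<^sub>M borel)"
    and c_le: "norm (c t \<xi>) \<le> W \<xi>"
    and c_odd: "c t (- \<xi>) = - c t \<xi>"
    and c_div: "\<xi> \<bullet> c t \<xi> = 0"
    and c_cont: "continuous_on {0..} (\<lambda>t. c t \<xi>)"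
    and c_ode: "0 < t \<Longrightarrow> ((\<lambda>t. c t \<xi>) has_vector_derivative
          - (norm \<xi>)\<^sup>2 *\<^sub>R c t \<xi> - leray_proj \<xi> (convect (c t) (c t) \<xi>)) (at t)"
begin

definition "nonlin t \<xi> = convect (c t) (c t) \<xi>"
text \<open>The field \<open>cos_tr (press t)\<close> is the pressure: its gradient is minus the
  sine transform of \<open>press t \<xi> *\<^sub>R \<xi>\<close>, precisely the part of the
  nonlinearity that \<open>leray_proj\<close> takes away.\<close>

definition "press t \<xi> = (\<xi> \<bullet> nonlin t \<xi>) / (norm \<xi>)\<^sup>2"

lemma c_compose: "f \<in> borel_measurable M \<Longrightarrow> g \<in> borel_measurable M \<Longrightarrow> (\<lambda>x. c (f x) (g x)) \<in> borel_measurable M"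
  using measurable_compose[OF measurable_Pair[of f M borel g borel] c_meas] by simp

lemma ct_meas: "c t \<in> borel_measurable borel"
  using c_compose[of "\<lambda>_. t" borel "\<lambda>\<xi>. \<xi>"] by simp

lemma nonlin_meas: "case_prod nonlin \<in> borel_measurable (borel \<Otimes>\<^sub>M borel)"
proof -
  have 1: "(\<lambda>z. c (fst (fst z)) (snd (fst z) - snd z)) \<in> borel_measurable ((borel \<Otimes>\<^sub>M borel) \<Otimes>\<^sub>M lborel)"
    by (rule c_compose) measurable
  have 2: "(\<lambda>z. c (fst (fst z)) (snd z)) \<in> borel_measurable ((borel \<Otimes>\<^sub>M borel) \<Otimes>\<^sub>M lborel)"
    by (rule c_compose) measurable
  have "(\<lambda>(z, \<eta>). (snd z \<bullet> c (fst z) (snd z - \<eta>)) *\<^sub>R c (fst z) \<eta>) \<in> borel_measurable ((borel \<Otimes>\<^sub>M borel) \<Otimes>\<^sub>M lborel)"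
    unfolding case_prod_unfold using 1 2 by measurable
  then show ?thesis
    unfolding nonlin_def convect_def case_prod_unfold
    by (rule lborel.borel_measurable_lebesgue_integral[where f = "\<lambda>p \<eta>. (snd p \<bullet> c (fst p) (snd p - \<eta>)) *\<^sub>R c (fst p) \<eta>", unfolded case_prod_unfold])
qed

lemma nonlin_compose: "f \<in> borel_measurable M \<Longrightarrow> g \<in> borel_measurable M \<Longrightarrow> (\<lambda>x. nonlin (f x) (g x)) \<in> borel_measurable M"
  using measurable_compose[OF measurable_Pair[of f M borel g borel] nonlin_meas] by simp

lemma norm_nonlin_le: "norm (nonlin t \<xi>) \<le> norm \<xi> * WW \<xi>"
  unfolding nonlin_def
  using convect_integrable(2)[OF ct_meas ct_meas, of t 1 t 1] c_le by simp

text \<open>Cauchy-Schwarz and the bound on the nonlinearity yield two powers of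
  \<open>norm \<xi>\<close>, which cancel the denominator; the pressure amplitude has no singularity
  beyond that of \<open>WW\<close>.\<close>

lemma abs_press_le: "\<bar>press t \<xi>\<bar> \<le> WW \<xi>"
proof (cases "\<xi> = 0")
  case False
  have "\<bar>\<xi> \<bullet> nonlin t \<xi>\<bar> \<le> norm \<xi> * (norm \<xi> * WW \<xi>)"
    by (rule order_trans[OF Cauchy_Schwarz_ineq2 mult_left_mono[OF norm_nonlin_le]]) simp
  then show ?thesis using False by (simp add: press_def divide_simps power2_eq_square mult_ac)
qed (simp add: press_def WW_nonneg)

lemma leray_nonlin: "leray_proj \<xi> (nonlin t \<xi>) = nonlin t \<xi> - press t \<xi> *\<^sub>R \<xi>"
  by (simp add: leray_proj_def press_def)

lemma press_compose:
  assumes "f \<in> borel_measurable M" "g \<in> borel_measurable M"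
  shows "(\<lambda>x. press (f x) (g x)) \<in> borel_measurable M"
  unfolding press_def using nonlin_compose[OF assms] assms by measurable

lemma abs_c_nth_le: "\<bar>c t \<xi> $ i\<bar> \<le> W \<xi>"
  using abs_nth_le_norm[of "c t \<xi>" i] c_le[of t \<xi>] by linarith

lemma abs_nonlin_nth_le: "\<bar>nonlin t \<xi> $ i\<bar> \<le> norm \<xi> * WW \<xi>"
  using abs_nth_le_norm[of "nonlin t \<xi>" i] norm_nonlin_le[of t \<xi>] by linarith

lemma c_nth_has_derivative:
  assumes "0 < t"
  shows "((\<lambda>t. c t \<xi> $ i) has_real_derivative
     - (norm \<xi>)\<^sup>2 * c t \<xi> $ i - (nonlin t \<xi> $ i - press t \<xi> * \<xi> $ i)) (at t)"
  using bounded_linear.has_vector_derivative[OF bounded_linear_vec_nth[of i] c_ode[OF assms, of \<xi>]]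
  unfolding nonlin_def[symmetric] leray_nonlin
  by (simp add: has_real_derivative_iff_has_vector_derivative)

section \<open>Single waves tested on space-time\<close>

abbreviation "tdir \<equiv> (1 :: real, 0 :: real^'n)"
abbreviation "xdir j \<equiv> (0 :: real, axis j 1 :: real^'n)"

lemma dir_Basis: "tdir \<in> Basis" "xdir j \<in> Basis"
  by (auto simp: Basis_prod_def axis_in_Basis_iff)

lemma fst_snd_meas: "fst \<in> borel_measurable (borel :: (real \<times> (real^'n)) measure)"
  "snd \<in> borel_measurable (borel :: (real \<times> (real^'n)) measure)"
  by (simp_all add: borel_prod[symmetric])

text \<open>At a space-time point \<open>z = (t, x)\<close> these three are the contributions of one
  frequency to the velocity, to the convection term and to the pressure.\<close>

definition "wave_c i \<xi> z = c (fst z) \<xi> $ i * sin (\<xi> \<bullet> snd z)"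
definition "wave_N i \<xi> z = nonlin (fst z) \<xi> $ i * sin (\<xi> \<bullet> snd z)"
definition "wave_p \<xi> z = press (fst z) \<xi> * cos (\<xi> \<bullet> snd z)"

lemma wave_meas:
  "case_prod (wave_c i) \<in> borel_measurable (borel \<Otimes>\<^sub>M borel)"
  "case_prod (wave_N i) \<in> borel_measurable (borel \<Otimes>\<^sub>M borel)"
  "case_prod wave_p \<in> borel_measurable (borel \<Otimes>\<^sub>M borel)"
proof -
  have f: "(\<lambda>z :: (real^'n) \<times> (real \<times> (real^'n)). fst (snd z)) \<in> borel_measurable (borel \<Otimes>\<^sub>M borel)"
    and s[measurable]: "(\<lambda>z :: (real^'n) \<times> (real \<times> (real^'n)). snd (snd z)) \<in> borel_measurable (borel \<Otimes>\<^sub>M borel)"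
    and x[measurable]: "(\<lambda>z :: (real^'n) \<times> (real \<times> (real^'n)). fst z) \<in> borel_measurable (borel \<Otimes>\<^sub>M borel)"
    using measurable_compose[OF measurable_snd fst_snd_meas(1)] measurable_compose[OF measurable_snd fst_snd_meas(2)] by simp_all
  note [measurable] = borel_measurable_vec_nth[OF c_compose[OF f x], of i]
     borel_measurable_vec_nth[OF nonlin_compose[OF f x], of i] press_compose[OF f x]
  show "case_prod (wave_c i) \<in> borel_measurable (borel \<Otimes>\<^sub>M borel)"
    "case_prod (wave_N i) \<in> borel_measurable (borel \<Otimes>\<^sub>M borel)"
    "case_prod wave_p \<in> borel_measurable (borel \<Otimes>\<^sub>M borel)"
    unfolding wave_c_def wave_N_def wave_p_def case_prod_unfold by measurable
qed

lemma wave_le: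
  "\<bar>wave_c i \<xi> z\<bar> \<le> W \<xi>" "\<bar>wave_N i \<xi> z\<bar> \<le> WW1 \<xi>" "\<bar>wave_p \<xi> z\<bar> \<le> WW \<xi>"
proof -
  show "\<bar>wave_c i \<xi> z\<bar> \<le> W \<xi>"
    unfolding wave_c_def abs_mult by (rule order_trans[OF mult_left_le abs_c_nth_le]) auto
  show "\<bar>wave_N i \<xi> z\<bar> \<le> WW1 \<xi>"
    unfolding wave_N_def abs_mult
    by (rule order_trans[OF mult_left_le order_trans[OF abs_nonlin_nth_le norm_WW_le]]) auto
  show "\<bar>wave_p \<xi> z\<bar> \<le> WW \<xi>"
    unfolding wave_p_def abs_mult by (rule order_trans[OF mult_left_le abs_press_le]) auto
qed

lemma wave_meas_space:
  "wave_c i \<xi> \<in> borel_measurable borel" "wave_N i \<xi> \<in> borel_measurable borel" "wave_p \<xi> \<in> borel_measurable borel"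
  "(\<lambda>z. press (fst z) \<xi> * sin (\<xi> \<bullet> snd z)) \<in> borel_measurable borel"
  "(\<lambda>z. c (fst z) \<xi> $ i * cos (\<xi> \<bullet> snd z)) \<in> borel_measurable borel"
proof -
  note [measurable] = fst_snd_meas
  have x: "(\<lambda>_. \<xi>) \<in> borel_measurable borel" by simp
  note [measurable] = borel_measurable_vec_nth[OF c_compose[OF fst_snd_meas(1) x], of i]
     borel_measurable_vec_nth[OF nonlin_compose[OF fst_snd_meas(1) x], of i] press_compose[OF fst_snd_meas(1) x]
  show "wave_c i \<xi> \<in> borel_measurable borel" "wave_N i \<xi> \<in> borel_measurable borel" "wave_p \<xi> \<in> borel_measurable borel"
  "(\<lambda>z. press (fst z) \<xi> * sin (\<xi> \<bullet> snd z)) \<in> borel_measurable borel"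
  "(\<lambda>z. c (fst z) \<xi> $ i * cos (\<xi> \<bullet> snd z)) \<in> borel_measurable borel"
    unfolding wave_c_def[abs_def] wave_N_def[abs_def] wave_p_def[abs_def] by measurable
qed

lemma integrable_wave_test:
  assumes \<phi>: "\<phi> \<in> test_functions U" and a: "a \<in> borel_measurable borel" "\<And>z. \<bar>a z\<bar> \<le> B"
  shows "integrable lborel (\<lambda>z. a z * \<phi> z)"
  by (rule integrable_bounded_mult[OF test_functions_integrable[OF \<phi>] a])

text \<open>Integration by parts in time inserts the amplitude equation. The last term, a sine with
  amplitude \<open>press\<close>, is what \<open>wave_p_space\<close> extracts from the pressure, so
  the two cancel in the momentum equation.\<close>

lemma wave_c_time:
  assumes \<phi>: "\<phi> \<in> test_functions spacetime"
  shows "(\<integral>z. wave_c i \<xi> z * dir_deriv tdir \<phi> z \<partial>lborel) =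
    (norm \<xi>)\<^sup>2 * (\<integral>z. wave_c i \<xi> z * \<phi> z \<partial>lborel) + (\<integral>z. wave_N i \<xi> z * \<phi> z \<partial>lborel)
     - \<xi> $ i * (\<integral>z. press (fst z) \<xi> * sin (\<xi> \<bullet> snd z) * \<phi> z \<partial>lborel)"
proof -
  define Q where "Q z = press (fst z) \<xi> * sin (\<xi> \<bullet> snd z)" for z
  define g where "g z = - (norm \<xi>)\<^sup>2 * wave_c i \<xi> z - (wave_N i \<xi> z - \<xi> $ i * Q z)" for z
  have [measurable]: "wave_c i \<xi> \<in> borel_measurable borel" "wave_N i \<xi> \<in> borel_measurable borel" "Q \<in> borel_measurable borel"
    unfolding Q_def[abs_def] by (rule wave_meas_space)+
  have Q_le: "\<bar>Q z\<bar> \<le> WW \<xi>" for z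
    unfolding Q_def abs_mult by (rule order_trans[OF mult_left_le abs_press_le]) auto
  have g_meas: "g \<in> borel_measurable borel" unfolding g_def[abs_def] by measurable
  have "(\<integral>z. wave_c i \<xi> z * dir_deriv tdir \<phi> z \<partial>lborel) = - (\<integral>z. g z * \<phi> z \<partial>lborel)"
  proof (rule integration_by_parts_test_functions[OF \<phi> dir_Basis(1) _ g_meas])
    show "\<bar>wave_c i \<xi> z\<bar> \<le> W \<xi>" for z by (rule wave_le)
    show "\<bar>g z\<bar> \<le> (norm \<xi>)\<^sup>2 * W \<xi> + (WW1 \<xi> + \<bar>\<xi> $ i\<bar> * WW \<xi>)" for z
    proof -
      have "\<bar>(norm \<xi>)\<^sup>2 * wave_c i \<xi> z\<bar> \<le> (norm \<xi>)\<^sup>2 * W \<xi>" "\<bar>\<xi> $ i * Q z\<bar> \<le> \<bar>\<xi> $ i\<bar> * WW \<xi>"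
        unfolding abs_mult by (auto intro!: mult_left_mono wave_le Q_le)
      then show ?thesis using wave_le(2)[of i \<xi> z] unfolding g_def by linarith
    qed
    show "((\<lambda>h. wave_c i \<xi> (z + h *\<^sub>R tdir)) has_real_derivative g z) (at 0)" if z: "z \<in> spacetime" for z
    proof -
      obtain t x where zt: "z = (t, x)" by force
      have t: "0 < t" using z unfolding spacetime_def zt by simp
      have "((\<lambda>h. c (h + t) \<xi> $ i) has_real_derivative - (norm \<xi>)\<^sup>2 * c t \<xi> $ i - (nonlin t \<xi> $ i - press t \<xi> * \<xi> $ i)) (at 0)"
        using c_nth_has_derivative[OF t, of \<xi> i] DERIV_shift[of "\<lambda>t. c t \<xi> $ i" _ 0 t] by simp
      from DERIV_cmult_right[OF this, of "sin (\<xi> \<bullet> x)"] show ?thesis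
        unfolding zt wave_c_def g_def wave_N_def Q_def by (simp add: algebra_simps)
    qed
  qed simp
  also have "(\<integral>z. g z * \<phi> z \<partial>lborel) = (\<integral>z. - (norm \<xi>)\<^sup>2 * (wave_c i \<xi> z * \<phi> z) - (wave_N i \<xi> z * \<phi> z - \<xi> $ i * (Q z * \<phi> z)) \<partial>lborel)"
    by (simp add: g_def algebra_simps)
  also have "\<dots> = - (norm \<xi>)\<^sup>2 * (\<integral>z. wave_c i \<xi> z * \<phi> z \<partial>lborel) - ((\<integral>z. wave_N i \<xi> z * \<phi> z \<partial>lborel) - \<xi> $ i * (\<integral>z. Q z * \<phi> z \<partial>lborel))"
  proof -
    have "integrable lborel (\<lambda>z. wave_c i \<xi> z * \<phi> z)" "integrable lborel (\<lambda>z. wave_N i \<xi> z * \<phi> z)" "integrable lborel (\<lambda>z. Q z * \<phi> z)"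
      by (rule integrable_wave_test[OF \<phi> _ wave_le(1)], measurable)
         (rule integrable_wave_test[OF \<phi> _ wave_le(2)], measurable, rule integrable_wave_test[OF \<phi> _ Q_le], measurable)
    then show ?thesis by simp
  qed
  finally show ?thesis unfolding Q_def by simp
qed

lemma wave_p_space:
  assumes \<phi>: "\<phi> \<in> test_functions spacetime"
  shows "(\<integral>z. wave_p \<xi> z * dir_deriv (xdir i) \<phi> z \<partial>lborel) =
    \<xi> $ i * (\<integral>z. press (fst z) \<xi> * sin (\<xi> \<bullet> snd z) * \<phi> z \<partial>lborel)"
proof -
  define Q where "Q z = press (fst z) \<xi> * sin (\<xi> \<bullet> snd z)" for z
  have [measurable]: "wave_p \<xi> \<in> borel_measurable borel" "Q \<in> borel_measurable borel"
    unfolding Q_def[abs_def] by (rule wave_meas_space)+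
  have Q_le: "\<bar>Q z\<bar> \<le> WW \<xi>" for z
    unfolding Q_def abs_mult by (rule order_trans[OF mult_left_le abs_press_le]) auto
  have "(\<integral>z. wave_p \<xi> z * dir_deriv (xdir i) \<phi> z \<partial>lborel) = - (\<integral>z. - \<xi> $ i * Q z * \<phi> z \<partial>lborel)"
  proof (rule integration_by_parts_test_functions[OF \<phi> dir_Basis(2)])
    show "\<bar>wave_p \<xi> z\<bar> \<le> WW \<xi>" for z by (rule wave_le)
    show "\<bar>- \<xi> $ i * Q z\<bar> \<le> \<bar>\<xi> $ i\<bar> * WW \<xi>" for z
      unfolding abs_mult using Q_le[of z] by (auto intro!: mult_left_mono)
    show "((\<lambda>h. wave_p \<xi> (z + h *\<^sub>R xdir i)) has_real_derivative - \<xi> $ i * Q z) (at 0)" for z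
      unfolding wave_p_def Q_def
      by (auto intro!: derivative_eq_intros simp: inner_add_right inner_axis)
  qed measurable
  then show ?thesis unfolding Q_def by (simp add: mult.assoc)
qed

lemma wave_c_laplacian:
  assumes \<phi>: "\<phi> \<in> test_functions spacetime"
  shows "(\<integral>z. wave_c i \<xi> z * space_laplacian \<phi> z \<partial>lborel) = - (norm \<xi>)\<^sup>2 * (\<integral>z. wave_c i \<xi> z * \<phi> z \<partial>lborel)"
proof -
  define C where "C z = c (fst z) \<xi> $ i * cos (\<xi> \<bullet> snd z)" for z
  have [measurable]: "wave_c i \<xi> \<in> borel_measurable borel" "C \<in> borel_measurable borel"
    unfolding C_def[abs_def] by (rule wave_meas_space)+
  have C_le: "\<bar>C z\<bar> \<le> W \<xi>" for z
    unfolding C_def abs_mult by (rule order_trans[OF mult_left_le abs_c_nth_le]) auto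
  note \<phi>1 = test_functions_dir_deriv[OF \<phi> dir_Basis(2)]
  note \<phi>2 = test_functions_dir_deriv[OF \<phi>1 dir_Basis(2)]
  have 1: "(\<integral>z. wave_c i \<xi> z * dir_deriv (xdir j) (dir_deriv (xdir j) \<phi>) z \<partial>lborel) = - (\<xi> $ j)\<^sup>2 * (\<integral>z. wave_c i \<xi> z * \<phi> z \<partial>lborel)" for j
  proof -
    have "(\<integral>z. wave_c i \<xi> z * dir_deriv (xdir j) (dir_deriv (xdir j) \<phi>) z \<partial>lborel) = - (\<integral>z. \<xi> $ j * C z * dir_deriv (xdir j) \<phi> z \<partial>lborel)"
    proof (rule integration_by_parts_test_functions[OF \<phi>1 dir_Basis(2)])
      show "\<bar>wave_c i \<xi> z\<bar> \<le> W \<xi>" for z by (rule wave_le)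
      show "\<bar>\<xi> $ j * C z\<bar> \<le> \<bar>\<xi> $ j\<bar> * W \<xi>" for z
        unfolding abs_mult using C_le[of z] by (auto intro!: mult_left_mono)
      show "((\<lambda>h. wave_c i \<xi> (z + h *\<^sub>R xdir j)) has_real_derivative \<xi> $ j * C z) (at 0)" for z
        unfolding wave_c_def C_def
        by (auto intro!: derivative_eq_intros simp: inner_add_right inner_axis)
    qed measurable
    also have "(\<integral>z. \<xi> $ j * C z * dir_deriv (xdir j) \<phi> z \<partial>lborel) = - (\<integral>z. - (\<xi> $ j)\<^sup>2 * wave_c i \<xi> z * \<phi> z \<partial>lborel)"
    proof (rule integration_by_parts_test_functions[OF \<phi> dir_Basis(2)])
      show "\<bar>\<xi> $ j * C z\<bar> \<le> \<bar>\<xi> $ j\<bar> * W \<xi>" for z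
        unfolding abs_mult using C_le[of z] by (auto intro!: mult_left_mono)
      show "\<bar>- (\<xi> $ j)\<^sup>2 * wave_c i \<xi> z\<bar> \<le> (\<xi> $ j)\<^sup>2 * W \<xi>" for z
        unfolding abs_mult using wave_le(1)[of i \<xi> z] by (auto intro!: mult_left_mono)
      show "((\<lambda>h. \<xi> $ j * C (z + h *\<^sub>R xdir j)) has_real_derivative - (\<xi> $ j)\<^sup>2 * wave_c i \<xi> z) (at 0)" for z
        unfolding wave_c_def C_def
        by (auto intro!: derivative_eq_intros simp: inner_add_right inner_axis power2_eq_square)
    qed measurable
    finally show ?thesis by (simp add: mult.assoc)
  qed
  have "(\<integral>z. wave_c i \<xi> z * space_laplacian \<phi> z \<partial>lborel) = (\<Sum>j\<in>UNIV. (\<integral>z. wave_c i \<xi> z * dir_deriv (xdir j) (dir_deriv (xdir j) \<phi>) z \<partial>lborel))"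
    unfolding space_laplacian_def space_deriv_def sum_distrib_left
    by (rule Bochner_Integration.integral_sum, rule integrable_wave_test[OF \<phi>2]) (measurable, rule wave_le)
  also have "\<dots> = - (\<Sum>j\<in>UNIV. (\<xi> $ j)\<^sup>2) * (\<integral>z. wave_c i \<xi> z * \<phi> z \<partial>lborel)"
    unfolding 1 by (simp add: sum_distrib_right sum_negf)
  finally show ?thesis by (simp add: norm_vec_power2)
qed

text \<open>After the integrals are interchanged, the tested equation is an integral over
  \<open>\<xi>\<close> of single-wave identities, and its integrand is zero at every
  frequency.\<close>

lemma momentum: "momentum_equation (\<lambda>t. sin_vec (c t)) (\<lambda>_ _. 0) (\<lambda>t. cos_mat (c t)) (\<lambda>_ _. 0) (\<lambda>t. cos_tr (press t))"
  unfolding momentum_equation_def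
proof (intro ballI allI)
  fix \<phi> :: "real \<times> (real^'n) \<Rightarrow> real" and i
  assume \<phi>: "\<phi> \<in> test_functions spacetime"
  note \<phi>t = test_functions_dir_deriv[OF \<phi> dir_Basis(1)]
  note \<phi>x = test_functions_dir_deriv[OF \<phi> dir_Basis(2)]
  note \<phi>xx = test_functions_dir_deriv[OF \<phi>x dir_Basis(2)]
  have iL: "integrable lborel (space_laplacian \<phi>)"
    unfolding space_laplacian_def[abs_def] space_deriv_def
    by (intro Bochner_Integration.integrable_sum test_functions_integrable[OF \<phi>xx])
  define U where "U z = (\<integral>\<xi>. wave_c i \<xi> z \<partial>lborel)" for z
  define N where "N z = (\<integral>\<xi>. wave_N i \<xi> z \<partial>lborel)" for z
  define P where "P z = (\<integral>\<xi>. wave_p \<xi> z \<partial>lborel)" for z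
  have [measurable]: "\<phi> \<in> borel_measurable borel" "dir_deriv tdir \<phi> \<in> borel_measurable borel"
    "dir_deriv (xdir i) \<phi> \<in> borel_measurable borel" "space_laplacian \<phi> \<in> borel_measurable borel"
    using test_functions_measurable[OF \<phi>] test_functions_measurable[OF \<phi>t] test_functions_measurable[OF \<phi>x]
      borel_measurable_integrable[OF iL] by simp_all
  note s1 = superposition[OF wave_meas(1)[of i] W_int test_functions_integrable[OF \<phi>t] wave_le(1), folded U_def]
  note s2 = superposition[OF wave_meas(2)[of i] WW1_integrable test_functions_integrable[OF \<phi>] wave_le(2), folded N_def]
  note s3 = superposition[OF wave_meas(3) WW_integrable test_functions_integrable[OF \<phi>x[of i]] wave_le(3), folded P_def]
  note s4 = superposition[OF wave_meas(1)[of i] W_int iL wave_le(1), folded U_def]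
  have u: "sin_vec (c t) x $ i = U (t, x)" and n: "(cos_mat (c t) x *v sin_vec (c t) x) $ i = N (t, x)"
    and p: "cos_tr (press t) x = P (t, x)" for t x
  proof -
    show "sin_vec (c t) x $ i = U (t, x)" "cos_tr (press t) x = P (t, x)"
      by (simp_all add: sin_vec_def sin_tr_def U_def wave_c_def cos_tr_def P_def wave_p_def)
    show "(cos_mat (c t) x *v sin_vec (c t) x) $ i = N (t, x)"
      unfolding cos_mat_mult_sin_vec[OF ct_meas c_le c_odd c_div]
      by (simp add: sin_tr_def N_def wave_N_def nonlin_def)
  qed
  define G where "G z = - (U z * dir_deriv tdir \<phi> z) + N z * \<phi> z - P z * dir_deriv (xdir i) \<phi> z" for z
  have Lout: "space_laplacian \<phi> z = 0" if "z \<notin> spacetime" for z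
    unfolding space_laplacian_def space_deriv_def
    by (intro sum.neutral ballI test_functions_eq_0_outside[OF \<phi>xx that])
  have Gout: "G z = 0" if "z \<notin> spacetime" for z
    using test_functions_eq_0_outside[OF \<phi> that] test_functions_eq_0_outside[OF \<phi>t that]
      test_functions_eq_0_outside[OF \<phi>x that] by (simp add: G_def)
  have sp: "spacetime \<in> sets (borel :: (real \<times> (real^'n)) measure)"
    unfolding spacetime_def by (intro borel_open open_Times) auto
  have iG: "integrable lborel G" unfolding G_def[abs_def] using s1(2) s2(2) s3(2) by simp
  have "(\<integral>z. G z \<partial>lborel) - (\<integral>z. U z * space_laplacian \<phi> z \<partial>lborel) = 
    (\<integral>\<xi>. - (\<integral>z. wave_c i \<xi> z * dir_deriv tdir \<phi> z \<partial>lborel) + (\<integral>z. wave_N i \<xi> z * \<phi> z \<partial>lborel)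
       - (\<integral>z. wave_p \<xi> z * dir_deriv (xdir i) \<phi> z \<partial>lborel) - (\<integral>z. wave_c i \<xi> z * space_laplacian \<phi> z \<partial>lborel) \<partial>lborel)"
    unfolding G_def using s1 s2 s3 s4 by simp
  also have "\<dots> = (\<integral>\<xi>. 0 \<partial>(lborel :: (real^'n) measure))"
    unfolding wave_c_time[OF \<phi>] wave_p_space[OF \<phi>] wave_c_laplacian[OF \<phi>] by simp
  finally have main: "(\<integral>z. G z \<partial>lborel) = (\<integral>z. U z * space_laplacian \<phi> z \<partial>lborel)" by simp
  have "(\<integral>z. G z \<partial>lebesgue_on spacetime) = (\<integral>z. G z \<partial>lborel)"
    using borel_measurable_integrable[OF iG] by (intro integral_lebesgue_on_lborel[OF sp] Gout) simp
  also have "\<dots> = (\<integral>z. U z * space_laplacian \<phi> z \<partial>lebesgue_on spacetime)"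
    unfolding main using borel_measurable_integrable[OF s4(2)]
    by (intro integral_lebesgue_on_lborel[OF sp, symmetric]) (simp_all add: Lout)
  finally show "(\<integral>(t, x). - (sin_vec (c t) x $ i * time_deriv \<phi> (t, x))
         + (cos_mat (c t) x *v sin_vec (c t) x - 0 *v 0) $ i * \<phi> (t, x)
         - cos_tr (press t) x * space_deriv i \<phi> (t, x) \<partial>lebesgue_on spacetime)
        = (\<integral>(t, x). sin_vec (c t) x $ i * space_laplacian \<phi> (t, x) \<partial>lebesgue_on spacetime)"
    by (simp add: u n p G_def time_deriv_def space_deriv_def case_prod_unfold)
qed

end


section \<open>Leray--Hopf regularity and the energy equality\<close>

context frequency_solution
begin

lemma c_square_int: "integrable lborel (\<lambda>\<xi>. (norm (c t \<xi>))\<^sup>2)"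
proof (rule integrable_dominated[OF W_sq])
  show "(\<lambda>\<xi>. (norm (c t \<xi>))\<^sup>2) \<in> borel_measurable borel" using ct_meas[of t] by measurable
  show "norm ((norm (c t \<xi>))\<^sup>2) \<le> (W \<xi>)\<^sup>2" for \<xi>
    using power_mono[OF c_le[of t \<xi>], of 2] by simp
qed

lemma c_int: "integrable lborel (\<lambda>\<xi>. norm (c t \<xi>))"
  by (rule integrable_dominated[OF W_int]) (use ct_meas[of t] c_le in auto)

lemma c_int1: "integrable lborel (\<lambda>\<xi>. norm \<xi> * norm (c t \<xi>))"
  by (rule integrable_dominated[OF W_int1]) (use ct_meas[of t] c_le in \<open>auto intro: mult_left_mono\<close>)

lemma c_square_int1: "integrable lborel (\<lambda>\<xi>. (norm \<xi> * norm (c t \<xi>))\<^sup>2)"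
proof (rule integrable_dominated[OF W_sq1])
  show "(\<lambda>\<xi>. (norm \<xi> * norm (c t \<xi>))\<^sup>2) \<in> borel_measurable borel" using ct_meas[of t] by measurable
  show "norm ((norm \<xi> * norm (c t \<xi>))\<^sup>2) \<le> (norm \<xi> * W \<xi>)\<^sup>2" for \<xi>
    using power_mono[OF mult_left_mono[OF c_le[of t \<xi>], of "norm \<xi>"], of 2] by simp
qed

lemmas u_plancherel = plancherel_sin_vec[OF ct_meas c_int c_square_int c_odd]
lemmas Du_plancherel = plancherel_cos_mat[OF ct_meas c_int1 c_square_int1 c_odd]

lemma L2_norm_u: "(L2_norm (sin_vec (c t)))\<^sup>2 = (gauss_mass TYPE(real^'n))\<^sup>2 * (\<integral>\<xi>. (norm (c t \<xi>))\<^sup>2 \<partial>lborel)"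
  unfolding L2_norm_power2[OF u_plancherel(1)] by (rule u_plancherel(3))

lemma L2_norm_Du: "(L2_norm (cos_mat (c t)))\<^sup>2 = (gauss_mass TYPE(real^'n))\<^sup>2 * (\<integral>\<xi>. (norm \<xi> * norm (c t \<xi>))\<^sup>2 \<partial>lborel)"
  unfolding L2_norm_power2[OF Du_plancherel(1)] by (rule Du_plancherel(3))

lemma dissipation_meas: "(\<lambda>t. \<integral>\<xi>. (norm \<xi> * norm (c t \<xi>))\<^sup>2 \<partial>lborel) \<in> borel_measurable borel"
proof -
  have [measurable]: "(\<lambda>z. c (fst z) (snd z)) \<in> borel_measurable (borel \<Otimes>\<^sub>M lborel)"
    by (rule c_compose) measurable
  have "(\<lambda>(t, \<xi>). (norm \<xi> * norm (c t \<xi>))\<^sup>2) \<in> borel_measurable (borel \<Otimes>\<^sub>M lborel)"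
    unfolding case_prod_unfold by measurable
  then show ?thesis by (rule lborel.borel_measurable_lebesgue_integral)
qed

lemma dissipation_nonneg: "0 \<le> (\<integral>\<xi>. (norm \<xi> * norm (c t \<xi>))\<^sup>2 \<partial>lborel)"
  by simp

text \<open>The pressure amplitude is parallel to \<open>\<xi>\<close> and drops out against the
  orthogonal velocity amplitude. The convection term stays: it moves energy between frequencies and
  vanishes only in the integral over all of them.\<close>

lemma energy_pointwise:
  assumes st: "0 \<le> s" "s \<le> t"
  shows "(norm (c t \<xi>))\<^sup>2 - (norm (c s \<xi>))\<^sup>2 =
     (\<integral>\<tau>. indicator {s..t} \<tau> * (- 2 * (norm \<xi> * norm (c \<tau> \<xi>))\<^sup>2 - 2 * (c \<tau> \<xi> \<bullet> nonlin \<tau> \<xi>)) \<partial>lborel)"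
proof -
  define g where "g \<tau> = - 2 * (norm \<xi> * norm (c \<tau> \<xi>))\<^sup>2 - 2 * (c \<tau> \<xi> \<bullet> nonlin \<tau> \<xi>)" for \<tau>
  have [measurable]: "(\<lambda>\<tau>. c \<tau> \<xi>) \<in> borel_measurable borel" "(\<lambda>\<tau>. nonlin \<tau> \<xi>) \<in> borel_measurable borel"
    by (rule c_compose nonlin_compose; simp)+
  have gm[measurable]: "g \<in> borel_measurable borel" unfolding g_def[abs_def] by measurable
  have g_le: "\<bar>g \<tau>\<bar> \<le> 2 * (norm \<xi> * W \<xi>)\<^sup>2 + 2 * (W \<xi> * (norm \<xi> * WW \<xi>))" for \<tau>
  proof -
    have "(norm \<xi> * norm (c \<tau> \<xi>))\<^sup>2 \<le> (norm \<xi> * W \<xi>)\<^sup>2"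
      by (intro power_mono mult_left_mono c_le) auto
    moreover have "\<bar>c \<tau> \<xi> \<bullet> nonlin \<tau> \<xi>\<bar> \<le> W \<xi> * (norm \<xi> * WW \<xi>)"
      by (rule order_trans[OF Cauchy_Schwarz_ineq2]) (intro mult_mono c_le norm_nonlin_le W_nonneg norm_ge_zero)
    ultimately show ?thesis unfolding g_def using zero_le_power2[of "norm \<xi> * norm (c \<tau> \<xi>)"] by linarith
  qed
  have iI: "integrable lborel (indicator {s..t} :: real \<Rightarrow> real)"
    using emeasure_compact_finite[of "{s..t}"] by (intro integrable_real_indicator) auto
  have gi: "set_integrable lborel {s..t} g"
    unfolding set_integrable_def
    using integrable_bounded_mult[OF iI gm g_le] by (simp add: mult.commute)
  have "(g has_integral ((norm (c t \<xi>))\<^sup>2 - (norm (c s \<xi>))\<^sup>2)) {s..t}"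
  \<comment> \<open>The amplitude is known to be differentiable at positive times and
    \<open>s\<close> may be zero; hence the version with derivatives in the open interval and
    continuity up to its ends.\<close>
  proof (rule fundamental_theorem_of_calculus_interior[OF st(2)])
    show "continuous_on {s..t} (\<lambda>t. (norm (c t \<xi>))\<^sup>2)"
      by (intro continuous_intros continuous_on_subset[OF c_cont]) (use st in auto)
    show "((\<lambda>t. (norm (c t \<xi>))\<^sup>2) has_vector_derivative g \<tau>) (at \<tau>)" if \<tau>: "\<tau> \<in> {s<..<t}" for \<tau>
    proof -
      have t0: "0 < \<tau>" using \<tau> st by simp
      define d where "d = - (norm \<xi>)\<^sup>2 *\<^sub>R c \<tau> \<xi> - leray_proj \<xi> (nonlin \<tau> \<xi>)"
      have "((\<lambda>t. c t \<xi>) has_vector_derivative d) (at \<tau>)"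
        using c_ode[OF t0, of \<xi>] unfolding d_def nonlin_def .
      from bounded_bilinear.has_vector_derivative[OF bounded_bilinear_inner this this]
      have "((\<lambda>t. c t \<xi> \<bullet> c t \<xi>) has_vector_derivative (c \<tau> \<xi> \<bullet> d + d \<bullet> c \<tau> \<xi>)) (at \<tau>)" .
      moreover have "c \<tau> \<xi> \<bullet> d + d \<bullet> c \<tau> \<xi> = g \<tau>"
      proof -
        have "c \<tau> \<xi> \<bullet> d = - (norm \<xi>)\<^sup>2 * (norm (c \<tau> \<xi>))\<^sup>2 - c \<tau> \<xi> \<bullet> nonlin \<tau> \<xi>"
          using c_div[of \<xi> \<tau>] unfolding d_def leray_nonlin
          by (simp add: inner_diff_right power2_norm_eq_inner inner_commute)
        then show ?thesis unfolding g_def by (simp add: inner_commute power_mult_distrib)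
      qed
      ultimately show ?thesis by (simp add: power2_norm_eq_inner)
    qed
  qed
  then have "integral {s..t} g = (norm (c t \<xi>))\<^sup>2 - (norm (c s \<xi>))\<^sup>2" by (rule integral_unique)
  moreover have "(\<integral>\<tau>. indicator {s..t} \<tau> * g \<tau> \<partial>lborel) = integral {s..t} g"
    using set_borel_integral_eq_integral(2)[OF gi] by (simp add: set_lebesgue_integral_def)
  ultimately show ?thesis unfolding g_def by simp
qed

text \<open>The pointwise identity is integrated over \<open>\<xi>\<close> and the integrals over
  time and frequency are exchanged. At each fixed time the convection term then integrates to zero
  by antisymmetry, which leaves the dissipation.\<close>

lemma energy_equality:
  assumes st: "0 \<le> s" "s \<le> t"
  shows "integrable lborel (\<lambda>\<tau>. indicator {s..t} \<tau> * (\<integral>\<xi>. (norm \<xi> * norm (c \<tau> \<xi>))\<^sup>2 \<partial>lborel))"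
    and "(\<integral>\<xi>. (norm (c t \<xi>))\<^sup>2 \<partial>lborel) + 2 * (\<integral>\<tau>. indicator {s..t} \<tau> * (\<integral>\<xi>. (norm \<xi> * norm (c \<tau> \<xi>))\<^sup>2 \<partial>lborel) \<partial>lborel)
       = (\<integral>\<xi>. (norm (c s \<xi>))\<^sup>2 \<partial>lborel)"
proof -
  define g where "g \<xi> \<tau> = - 2 * (norm \<xi> * norm (c \<tau> \<xi>))\<^sup>2 - 2 * (c \<tau> \<xi> \<bullet> nonlin \<tau> \<xi>)" for \<xi> \<tau>
  have [measurable]: "(\<lambda>z. c (snd z) (fst z)) \<in> borel_measurable (borel \<Otimes>\<^sub>M borel)"
      "(\<lambda>z. nonlin (snd z) (fst z)) \<in> borel_measurable (borel \<Otimes>\<^sub>M borel)"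
    by (rule c_compose nonlin_compose; measurable)+
  have gm: "case_prod g \<in> borel_measurable (borel \<Otimes>\<^sub>M borel)"
    unfolding g_def case_prod_unfold by measurable
  define K where "K = (\<integral>\<eta>. (W \<eta>)\<^sup>2 \<partial>lborel)"
  \<comment> \<open>Majorant for the exchange, independent of time: the first part bounds the
    dissipation, and the second the convection term, where \<open>WW\<close> is at most
    \<open>K\<close>.\<close>
  define V where "V \<xi> = 2 * (norm \<xi> * W \<xi>)\<^sup>2 + 2 * K * (norm \<xi> * W \<xi>)" for \<xi>
  have V: "integrable lborel V" unfolding V_def[abs_def] using W_sq1 W_int1 by simp
  have d_le: "(norm \<xi> * norm (c \<tau> \<xi>))\<^sup>2 \<le> (norm \<xi> * W \<xi>)\<^sup>2" for \<xi> \<tau>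
    by (intro power_mono mult_left_mono c_le) auto
  have n_le: "\<bar>c \<tau> \<xi> \<bullet> nonlin \<tau> \<xi>\<bar> \<le> K * (norm \<xi> * W \<xi>)" for \<xi> \<tau>
  proof -
    have "\<bar>c \<tau> \<xi> \<bullet> nonlin \<tau> \<xi>\<bar> \<le> W \<xi> * (norm \<xi> * WW \<xi>)"
      by (rule order_trans[OF Cauchy_Schwarz_ineq2]) (intro mult_mono c_le norm_nonlin_le W_nonneg norm_ge_zero)
    also have "\<dots> \<le> W \<xi> * (norm \<xi> * K)"
      unfolding K_def by (intro mult_left_mono WW_le W_nonneg norm_ge_zero)
    finally show ?thesis by (simp add: mult_ac)
  qed
  have g_le: "\<bar>g \<xi> \<tau>\<bar> \<le> V \<xi>" for \<xi> \<tau>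
    using d_le[of \<xi> \<tau>] n_le[of \<tau> \<xi>] zero_le_power2[of "norm \<xi> * norm (c \<tau> \<xi>)"]
    unfolding g_def V_def by linarith
  have iI: "integrable lborel (indicator {s..t} :: real \<Rightarrow> real)"
    using emeasure_compact_finite[of "{s..t}"] by (intro integrable_real_indicator) auto
  note S = superposition[OF gm V iI g_le]
  have n_int: "integrable lborel (\<lambda>\<xi>. c \<tau> \<xi> \<bullet> nonlin \<tau> \<xi>)" for \<tau>
  proof (rule integrable_dominated[OF integrable_mult_right[OF W_int1, of K]])
    have [measurable]: "(\<lambda>\<xi>. c \<tau> \<xi>) \<in> borel_measurable borel" "(\<lambda>\<xi>. nonlin \<tau> \<xi>) \<in> borel_measurable borel"
      by (rule c_compose nonlin_compose; simp)+
    show "(\<lambda>\<xi>. c \<tau> \<xi> \<bullet> nonlin \<tau> \<xi>) \<in> borel_measurable borel" by measurable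
  qed (use n_le in simp)
  have G: "(\<integral>\<xi>. g \<xi> \<tau> \<partial>lborel) = - 2 * (\<integral>\<xi>. (norm \<xi> * norm (c \<tau> \<xi>))\<^sup>2 \<partial>lborel)" for \<tau>
  proof -
    have "(\<integral>\<xi>. c \<tau> \<xi> \<bullet> nonlin \<tau> \<xi> \<partial>lborel) = 0"
      unfolding nonlin_def by (rule convect_energy[OF ct_meas c_le c_odd c_div])
    then show ?thesis unfolding g_def using c_square_int1[of \<tau>] n_int[of \<tau>] by simp
  qed
  have "integrable lborel (\<lambda>\<tau>. (- 1 / 2) * ((- 2 * (\<integral>\<xi>. (norm \<xi> * norm (c \<tau> \<xi>))\<^sup>2 \<partial>lborel)) * indicator {s..t} \<tau>))"
    by (rule integrable_mult_right) (use S(2) in \<open>simp only: G\<close>)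
  then show I: "integrable lborel (\<lambda>\<tau>. indicator {s..t} \<tau> * (\<integral>\<xi>. (norm \<xi> * norm (c \<tau> \<xi>))\<^sup>2 \<partial>lborel))"
    by (simp add: mult.commute)
  have "(\<integral>\<xi>. (norm (c t \<xi>))\<^sup>2 \<partial>lborel) - (\<integral>\<xi>. (norm (c s \<xi>))\<^sup>2 \<partial>lborel) = (\<integral>\<xi>. (norm (c t \<xi>))\<^sup>2 - (norm (c s \<xi>))\<^sup>2 \<partial>lborel)"
    by (rule Bochner_Integration.integral_diff[symmetric]) (rule c_square_int)+
  also have "\<dots> = (\<integral>\<xi>. (\<integral>\<tau>. g \<xi> \<tau> * indicator {s..t} \<tau> \<partial>lborel) \<partial>lborel)"
    unfolding energy_pointwise[OF st] g_def by (simp only: mult.commute)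
  also have "\<dots> = (\<integral>\<tau>. - 2 * (indicator {s..t} \<tau> * (\<integral>\<xi>. (norm \<xi> * norm (c \<tau> \<xi>))\<^sup>2 \<partial>lborel)) \<partial>lborel)"
    unfolding S(1)[symmetric] G by (simp add: mult_ac)
  also have "\<dots> = - 2 * (\<integral>\<tau>. indicator {s..t} \<tau> * (\<integral>\<xi>. (norm \<xi> * norm (c \<tau> \<xi>))\<^sup>2 \<partial>lborel) \<partial>lborel)"
    by (rule integral_mult_right_zero)
  finally show "(\<integral>\<xi>. (norm (c t \<xi>))\<^sup>2 \<partial>lborel) + 2 * (\<integral>\<tau>. indicator {s..t} \<tau> * (\<integral>\<xi>. (norm \<xi> * norm (c \<tau> \<xi>))\<^sup>2 \<partial>lborel) \<partial>lborel)
       = (\<integral>\<xi>. (norm (c s \<xi>))\<^sup>2 \<partial>lborel)" by simp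
qed

lemma energy_inequality:
  assumes "0 \<le> s"
  shows "energy_inequality_from \<delta> (\<lambda>t. sin_vec (c t)) (\<lambda>_ _. 0) (\<lambda>t. cos_mat (c t)) (\<lambda>_ _. 0) s"
  unfolding energy_inequality_from_def
proof (intro allI impI)
  fix t assume st: "s \<le> t"
  have "(\<integral>\<tau>. (L2_norm (cos_mat (c \<tau>)))\<^sup>2 \<partial>lebesgue_on {s..t}) = (\<integral>\<tau>. indicator {s..t} \<tau> *\<^sub>R ((gauss_mass TYPE(real^'n))\<^sup>2 * (\<integral>\<xi>. (norm \<xi> * norm (c \<tau> \<xi>))\<^sup>2 \<partial>lborel)) \<partial>lebesgue)"
    unfolding L2_norm_Du by (subst integral_restrict_space) (auto simp: set_lebesgue_integral_def)
  also have "\<dots> = (\<integral>\<tau>. indicator {s..t} \<tau> *\<^sub>R ((gauss_mass TYPE(real^'n))\<^sup>2 * (\<integral>\<xi>. (norm \<xi> * norm (c \<tau> \<xi>))\<^sup>2 \<partial>lborel)) \<partial>lborel)"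
    by (intro integral_lebesgue_lborel borel_measurable_scaleR borel_measurable_times borel_measurable_const
      dissipation_meas borel_measurable_indicator) simp
  also have "\<dots> = (\<integral>\<tau>. (gauss_mass TYPE(real^'n))\<^sup>2 * (indicator {s..t} \<tau> * (\<integral>\<xi>. (norm \<xi> * norm (c \<tau> \<xi>))\<^sup>2 \<partial>lborel)) \<partial>lborel)"
    by (simp only: real_scaleR_def mult.left_commute)
  also have "\<dots> = (gauss_mass TYPE(real^'n))\<^sup>2 * (\<integral>\<tau>. indicator {s..t} \<tau> * (\<integral>\<xi>. (norm \<xi> * norm (c \<tau> \<xi>))\<^sup>2 \<partial>lborel) \<partial>lborel)"
    by (rule integral_mult_right_zero)
  finally have D: "(\<integral>\<tau>. (L2_norm (cos_mat (c \<tau>)))\<^sup>2 \<partial>lebesgue_on {s..t}) = \<dots>" .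
  have "(gauss_mass TYPE(real^'n))\<^sup>2 * (\<integral>\<xi>. (norm (c t \<xi>))\<^sup>2 \<partial>lborel) + 2 * ((gauss_mass TYPE(real^'n))\<^sup>2 * (\<integral>\<tau>. indicator {s..t} \<tau> * (\<integral>\<xi>. (norm \<xi> * norm (c \<tau> \<xi>))\<^sup>2 \<partial>lborel) \<partial>lborel))
     = (gauss_mass TYPE(real^'n))\<^sup>2 * (\<integral>\<xi>. (norm (c s \<xi>))\<^sup>2 \<partial>lborel)"
    unfolding energy_equality(2)[OF assms st, symmetric] by (simp add: algebra_simps)
  then show "(L2_norm (sin_vec (c t)))\<^sup>2 + (L2_norm (\<lambda>_. 0 :: real^'n))\<^sup>2
            + 2 * (\<integral>\<tau>. (L2_norm (cos_mat (c \<tau>)))\<^sup>2 + \<delta> * (L2_norm (\<lambda>_. 0 :: real^'n^'n))\<^sup>2 \<partial>lebesgue_on {s..t})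
          \<le> (L2_norm (sin_vec (c s)))\<^sup>2 + (L2_norm (\<lambda>_. 0 :: real^'n))\<^sup>2"
    by (simp add: L2_norm_zero D L2_norm_u)
qed

text \<open>On \<open>{0..k}\<close> the integral is bounded by the initial energy for every
  \<open>k\<close>; monotone convergence extends this to the half-line.\<close>

lemma dissipation_integrable: "integrable lborel (\<lambda>\<tau>. indicator {0<..} \<tau> * (\<integral>\<xi>. (norm \<xi> * norm (c \<tau> \<xi>))\<^sup>2 \<partial>lborel))"
proof -
  define D where "D \<tau> = (\<integral>\<xi>. (norm \<xi> * norm (c \<tau> \<xi>))\<^sup>2 \<partial>lborel)" for \<tau>
  have Dm[measurable]: "D \<in> borel_measurable borel" unfolding D_def[abs_def] by (rule dissipation_meas)
  have D0: "0 \<le> D \<tau>" for \<tau> unfolding D_def by (rule dissipation_nonneg)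
  define f where "f k \<tau> = indicator {0..real k} \<tau> * D \<tau>" for k \<tau>
  have fi: "integrable lborel (f k)" for k
    unfolding f_def[abs_def] D_def by (rule energy_equality(1)) auto
  have fb: "(\<integral>\<tau>. f k \<tau> \<partial>lborel) \<le> (\<integral>\<xi>. (norm (c 0 \<xi>))\<^sup>2 \<partial>lborel)" for k
  proof -
    have "0 \<le> (\<integral>\<xi>. (norm (c (real k) \<xi>))\<^sup>2 \<partial>lborel)" "0 \<le> (\<integral>\<tau>. f k \<tau> \<partial>lborel)"
      using D0 by (auto simp: f_def intro!: integral_nonneg_AE)
    then show ?thesis using energy_equality(2)[of 0 "real k"] unfolding f_def D_def by linarith
  qed
  have mono: "mono (\<lambda>k. f k \<tau>)" for \<tau>
    unfolding f_def by (intro monoI mult_right_mono D0) (auto simp: indicator_def)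
  have "incseq (\<lambda>k. \<integral>\<tau>. f k \<tau> \<partial>lborel)"
    using mono by (intro monoI integral_mono fi) (auto dest: monoD)
  then obtain L where L: "(\<lambda>k. \<integral>\<tau>. f k \<tau> \<partial>lborel) \<longlonglongrightarrow> L"
    using incseq_convergent[of "\<lambda>k. \<integral>\<tau>. f k \<tau> \<partial>lborel"] fb by metis
  have lim: "(\<lambda>k. f k \<tau>) \<longlonglongrightarrow> indicator {0..} \<tau> * D \<tau>" for \<tau>
  proof (rule tendsto_eventually)
    obtain n where n: "\<tau> \<le> real n" using real_arch_simple ..
    have "f k \<tau> = indicator {0..} \<tau> * D \<tau>" if "n \<le> k" for k
    proof -
      have "\<tau> \<le> real k" using n that by linarith
      then show ?thesis by (simp add: f_def indicator_def)
    qed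
    then show "\<forall>\<^sub>F k in sequentially. f k \<tau> = indicator {0..} \<tau> * D \<tau>"
      by (auto intro: eventually_sequentiallyI)
  qed
  have "integrable lborel (\<lambda>\<tau>. indicator {0..} \<tau> * D \<tau>)"
    by (rule integrable_monotone_convergence[OF fi _ _ L]) (use mono lim in auto)
  then show ?thesis
    unfolding D_def[symmetric]
    by (rule integrable_dominated) (use D0 in \<open>auto simp: indicator_def\<close>)
qed

section \<open>Regularity of the velocity and the pressure\<close>

lemma field_meas:
  "(\<lambda>(t, x). sin_vec (c t) x) \<in> borel_measurable borel"
  "(\<lambda>(t, x). cos_mat (c t) x) \<in> borel_measurable borel"
  "(\<lambda>(t, x). cos_tr (press t) x) \<in> borel_measurable borel"
proof -
  have [measurable]: "(\<lambda>z. c (fst (fst z)) (snd z)) \<in> borel_measurable ((borel \<Otimes>\<^sub>M borel) \<Otimes>\<^sub>M (lborel :: (real^'n) measure))"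
    "(\<lambda>z. press (fst (fst z)) (snd z)) \<in> borel_measurable ((borel \<Otimes>\<^sub>M borel) \<Otimes>\<^sub>M (lborel :: (real^'n) measure))"
    by (rule c_compose press_compose; measurable)+
  note [measurable] = borel_measurable_vec_nth[OF this(1)]
    measurable_compose[OF measurable_snd borel_measurable_nth_id]
  have "(\<lambda>(z, \<xi>). c (fst z) \<xi> $ i * sin (\<xi> \<bullet> snd z)) \<in> borel_measurable ((borel \<Otimes>\<^sub>M borel) \<Otimes>\<^sub>M lborel)" for i
    unfolding case_prod_unfold by measurable
  from lborel.borel_measurable_lebesgue_integral[OF this]
  show "(\<lambda>(t, x). sin_vec (c t) x) \<in> borel_measurable borel"
    unfolding borel_prod[symmetric]
    by (intro borel_measurable_vecI) (simp add: sin_vec_def sin_tr_def case_prod_unfold)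
  have "(\<lambda>(z, \<xi>). \<xi> $ j * c (fst z) \<xi> $ i * cos (\<xi> \<bullet> snd z)) \<in> borel_measurable ((borel \<Otimes>\<^sub>M borel) \<Otimes>\<^sub>M lborel)" for i j
    unfolding case_prod_unfold by measurable
  from lborel.borel_measurable_lebesgue_integral[OF this]
  show "(\<lambda>(t, x). cos_mat (c t) x) \<in> borel_measurable borel"
    unfolding borel_prod[symmetric]
    by (intro borel_measurable_vecI) (simp add: cos_mat_def cos_tr_def case_prod_unfold)
  have "(\<lambda>(z, \<xi>). press (fst z) \<xi> * cos (\<xi> \<bullet> snd z)) \<in> borel_measurable ((borel \<Otimes>\<^sub>M borel) \<Otimes>\<^sub>M lborel)"
    unfolding case_prod_unfold by measurable
  from lborel.borel_measurable_lebesgue_integral[OF this]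
  show "(\<lambda>(t, x). cos_tr (press t) x) \<in> borel_measurable borel"
    unfolding borel_prod[symmetric] by (simp add: cos_tr_def case_prod_unfold)
qed

text \<open>The pressure is bounded on all of space-time by the integral of \<open>WW\<close>, so it
  is integrable on compact sets.\<close>

lemma press_locally_integrable: "locally_integrable spacetime (\<lambda>(t, x). cos_tr (press t) x)"
  unfolding locally_integrable_def
proof (intro allI impI)
  fix K :: "(real \<times> (real^'n)) set" assume K: "compact K \<and> K \<subseteq> spacetime"
  then have KB: "K \<in> sets borel" "K \<in> sets lebesgue" by (auto simp: borel_compact)
  have iK: "integrable lborel (indicator K :: _ \<Rightarrow> real)"
    using K KB emeasure_compact_finite[of K] by (intro integrable_real_indicator) auto
  have b: "\<bar>(\<lambda>(t, x). cos_tr (press t) x) z\<bar> \<le> (\<integral>\<xi>. WW \<xi> \<partial>lborel)" for z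
  proof -
    obtain t x where z: "z = (t, x)" by force
    have "\<bar>cos_tr (press t) x\<bar> \<le> (\<integral>\<xi>. \<bar>press t \<xi> * cos (\<xi> \<bullet> x)\<bar> \<partial>lborel)"
      unfolding cos_tr_def by (rule integral_abs_bound)
    also have "\<dots> \<le> (\<integral>\<xi>. WW \<xi> \<partial>lborel)"
    proof (rule integral_mono[OF _ WW_integrable])
      show le: "\<bar>press t \<xi> * cos (\<xi> \<bullet> x)\<bar> \<le> WW \<xi>" for \<xi>
        unfolding abs_mult by (rule order_trans[OF mult_left_le abs_press_le]) auto
      have [measurable]: "press t \<in> borel_measurable borel"
        using press_compose[of "\<lambda>_. t" borel "\<lambda>\<xi>. \<xi>"] by simp
      show "integrable lborel (\<lambda>\<xi>. \<bar>press t \<xi> * cos (\<xi> \<bullet> x)\<bar>)"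
        by (rule integrable_dominated[OF WW_integrable]) (use le in auto)
    qed
    finally show ?thesis unfolding z by simp
  qed
  have "integrable lborel (\<lambda>z. (\<lambda>(t, x). cos_tr (press t) x) z * indicator K z)"
    by (rule integrable_bounded_mult[OF iK field_meas(3) b])
  then have "integrable lebesgue (\<lambda>z. indicator K z *\<^sub>R (\<lambda>(t, x). cos_tr (press t) x) z)"
    using field_meas(3) KB by (subst integrable_completion) (auto simp: mult.commute)
  then show "integrable (lebesgue_on K) (\<lambda>(t, x). cos_tr (press t) x)"
    using KB by (subst integrable_restrict_space) (auto simp: set_integrable_def)
qed

text \<open>Plancherel in space turns each time slice into the dissipation in frequency, whose time
  integral is finite; Fubini combines the two.\<close>

lemma Du_in_L2: "(\<lambda>(t, x). cos_mat (c t) x) \<in> L2_on spacetime"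
proof -
  let ?f = "\<lambda>(t, x). cos_mat (c t) x"
  have sp: "spacetime \<in> sets (borel :: (real \<times> (real^'n)) measure)"
    unfolding spacetime_def by (intro borel_open open_Times) auto
  have fm: "(\<lambda>z. indicator spacetime z * (norm (?f z))\<^sup>2) \<in> borel_measurable borel"
    using sp by (intro borel_measurable_times borel_measurable_indicator borel_measurable_power
      measurable_compose[OF field_meas(2) borel_measurable_norm])
  have ind: "indicator spacetime (t, x) = (indicator {0<..} t :: real)" for t and x :: "real^'n"
    by (auto simp: spacetime_def indicator_def)
  have "integrable (lborel \<Otimes>\<^sub>M lborel) (\<lambda>z. indicator spacetime z * (norm (?f z))\<^sup>2)"
  proof (rule lborel_pair.Fubini_integrable)
    show "(\<lambda>z. indicator spacetime z * (norm (?f z))\<^sup>2) \<in> borel_measurable (lborel \<Otimes>\<^sub>M lborel)"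
      using fm by (simp add: lborel_prod)
    have e: "(\<integral>x. norm (indicator spacetime (t, x) * (norm (?f (t, x)))\<^sup>2) \<partial>lborel) = (gauss_mass TYPE(real^'n))\<^sup>2 * (indicator {0<..} t * (\<integral>\<xi>. (norm \<xi> * norm (c t \<xi>))\<^sup>2 \<partial>lborel))" for t
      unfolding ind prod.case by (simp add: Du_plancherel(3))
    show "integrable lborel (\<lambda>t. \<integral>x. norm (indicator spacetime (t, x) * (norm (?f (t, x)))\<^sup>2) \<partial>lborel)"
      unfolding e by (intro integrable_mult_right dissipation_integrable)
    show "AE t in lborel. integrable lborel (\<lambda>x. indicator spacetime (t, x) * (norm (?f (t, x)))\<^sup>2)"
      unfolding ind prod.case by (intro AE_I2 integrable_mult_right Du_plancherel(2))
  qed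
  then have "integrable lebesgue (\<lambda>z. indicator spacetime z *\<^sub>R (norm (?f z))\<^sup>2)"
    using fm by (subst integrable_completion) (simp_all add: lborel_prod)
  then have "integrable (lebesgue_on spacetime) (\<lambda>z. (norm (?f z))\<^sup>2)"
    using sp by (subst integrable_restrict_space) (auto simp: set_integrable_def)
  then show ?thesis
    unfolding L2_on_def using borel_measurable_lebesgue_on_lborel[OF field_meas(2)] by simp
qed

lemma integrable_c_nth: "integrable lborel (\<lambda>\<xi>. c t \<xi> $ i)"
  by (rule integrable_component[OF ct_meas c_int])

lemma integrable_c_nth1: "integrable lborel (\<lambda>\<xi>. \<xi> $ j * c t \<xi> $ i)"
proof (rule integrable_dominated[OF W_int1])
  show "(\<lambda>\<xi>. \<xi> $ j * c t \<xi> $ i) \<in> borel_measurable borel"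
    using borel_measurable_vec_nth[OF ct_meas] borel_measurable_nth_id by (intro borel_measurable_times)
  show "norm (\<xi> $ j * c t \<xi> $ i) \<le> norm \<xi> * W \<xi>" for \<xi>
    unfolding real_norm_def abs_mult by (intro mult_mono abs_c_nth_le abs_nth_le_norm) auto
qed

lemma u_weak_derivative:
  assumes \<phi>: "\<phi> \<in> test_functions UNIV"
  shows "integrable lborel (\<lambda>x. sin_vec (c t) x $ i * partial j \<phi> x)"
    and "(\<integral>x. sin_vec (c t) x $ i * partial j \<phi> x \<partial>lborel) = - (\<integral>x. cos_mat (c t) x $ i $ j * \<phi> x \<partial>lborel)"
proof -
  have b: "axis j (1::real) \<in> (Basis :: (real^'n) set)" by (simp add: axis_in_Basis_iff)
  have a: "\<xi> \<bullet> axis j 1 = \<xi> $ j" for \<xi> :: "real^'n" by (simp add: inner_axis)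
  have 1: "integrable lborel (\<lambda>\<xi>. (\<xi> \<bullet> axis j 1) * c t \<xi> $ i)" unfolding a by (rule integrable_c_nth1)
  show "(\<integral>x. sin_vec (c t) x $ i * partial j \<phi> x \<partial>lborel) = - (\<integral>x. cos_mat (c t) x $ i $ j * \<phi> x \<partial>lborel)"
    using sin_tr_weak_derivative[OF integrable_c_nth 1 \<phi> b]
    by (simp add: sin_vec_def cos_mat_def partial_def a)
  have [measurable]: "(\<lambda>\<xi>. c t \<xi> $ i) \<in> borel_measurable borel" by (rule borel_measurable_vec_nth[OF ct_meas])
  have m: "case_prod (\<lambda>\<xi> x. c t \<xi> $ i * sin (\<xi> \<bullet> x)) \<in> borel_measurable (borel \<Otimes>\<^sub>M borel)" by measurable
  have "\<bar>c t \<xi> $ i * sin (\<xi> \<bullet> x)\<bar> \<le> W \<xi>" for \<xi> x :: "real^'n"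
    unfolding abs_mult by (rule order_trans[OF mult_left_le abs_c_nth_le]) auto
  from superposition(2)[OF m W_int test_functions_integrable[OF test_functions_dir_deriv[OF \<phi> b]] this]
  show "integrable lborel (\<lambda>x. sin_vec (c t) x $ i * partial j \<phi> x)"
    by (simp add: sin_vec_def sin_tr_def partial_def)
qed

lemma u_nth_meas: "(\<lambda>x. sin_vec (c t) x $ i) \<in> borel_measurable borel"
  by (rule borel_measurable_vec_nth[OF u_plancherel(1)])

lemma partial_meas: "\<phi> \<in> test_functions UNIV \<Longrightarrow> partial j \<phi> \<in> borel_measurable borel"
  unfolding partial_def
  by (rule test_functions_measurable[OF test_functions_dir_deriv]) (auto simp: axis_in_Basis_iff)

lemma u_weak_gradient: "weak_gradient (sin_vec (c t)) (cos_mat (c t))"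
  unfolding weak_gradient_def
proof (intro ballI allI)
  fix \<phi> :: "real^'n \<Rightarrow> real" and i j assume \<phi>: "\<phi> \<in> test_functions UNIV"
  have "(\<lambda>x. cos_mat (c t) x $ i) \<in> borel_measurable borel"
  proof (rule borel_measurable_vecI)
    show "(\<lambda>x. cos_mat (c t) x $ i $ k) \<in> borel_measurable borel" for k
      using cos_tr_measurable[OF borel_measurable_integrable[OF integrable_c_nth1, simplified], of k t i]
      by (simp add: cos_mat_def)
  qed
  then have m: "(\<lambda>x. cos_mat (c t) x $ i $ j) \<in> borel_measurable borel" by (rule borel_measurable_vec_nth)
  have "(\<integral>x. sin_vec (c t) x $ i * partial j \<phi> x \<partial>lebesgue) = (\<integral>x. sin_vec (c t) x $ i * partial j \<phi> x \<partial>lborel)"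
    using u_nth_meas[of t i] partial_meas[OF \<phi>, of j] by (intro integral_lebesgue_lborel) measurable
  moreover have "(\<integral>x. cos_mat (c t) x $ i $ j * \<phi> x \<partial>lebesgue) = (\<integral>x. cos_mat (c t) x $ i $ j * \<phi> x \<partial>lborel)"
    using m test_functions_measurable[OF \<phi>] by (intro integral_lebesgue_lborel) measurable
  ultimately show "(\<integral>x. sin_vec (c t) x $ i * partial j \<phi> x \<partial>lebesgue) = - (\<integral>x. cos_mat (c t) x $ i $ j * \<phi> x \<partial>lebesgue)"
    using u_weak_derivative(2)[OF \<phi>] by simp
qed

text \<open>The trace of the gradient is the cosine transform of
  \<open>\<xi> \<bullet> c t \<xi>\<close>, which is zero.\<close>

lemma u_div_free: "div_free (sin_vec (c t))"
  unfolding div_free_def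
proof (intro ballI)
  fix \<phi> :: "real^'n \<Rightarrow> real" assume \<phi>: "\<phi> \<in> test_functions UNIV"
  have tr0: "(\<Sum>j\<in>UNIV. cos_mat (c t) x $ j $ j) = 0" for x
  proof -
    have "(\<Sum>j\<in>UNIV. cos_mat (c t) x $ j $ j) = (\<integral>\<xi>. (\<Sum>j\<in>UNIV. \<xi> $ j * c t \<xi> $ j * cos (\<xi> \<bullet> x)) \<partial>lborel)"
      unfolding cos_mat_def cos_tr_def
      by (simp add: Bochner_Integration.integral_sum integrable_mult_cos_sin(1)[OF integrable_c_nth1])
    also have "(\<lambda>\<xi>. \<Sum>j\<in>UNIV. \<xi> $ j * c t \<xi> $ j * cos (\<xi> \<bullet> x)) = (\<lambda>\<xi>. (\<xi> \<bullet> c t \<xi>) * cos (\<xi> \<bullet> x))"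
      by (simp add: inner_vec_def sum_distrib_right)
    finally show ?thesis by (simp add: c_div)
  qed
  have i: "integrable lborel (\<lambda>x. cos_mat (c t) x $ j $ j * \<phi> x)" for j
  proof -
    have [measurable]: "(\<lambda>\<xi>. \<xi> $ j * c t \<xi> $ j) \<in> borel_measurable borel"
      using borel_measurable_integrable[OF integrable_c_nth1] by simp
    have m: "case_prod (\<lambda>\<xi> x. \<xi> $ j * c t \<xi> $ j * cos (\<xi> \<bullet> x)) \<in> borel_measurable (borel \<Otimes>\<^sub>M borel)" by measurable
    have "\<bar>\<xi> $ j * c t \<xi> $ j * cos (\<xi> \<bullet> x)\<bar> \<le> \<bar>\<xi> $ j * c t \<xi> $ j\<bar>" for \<xi> x :: "real^'n"
      unfolding abs_mult[of "\<xi> $ j * c t \<xi> $ j"] by (rule mult_left_le) auto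
    from superposition(2)[OF m integrable_abs[OF integrable_c_nth1] test_functions_integrable[OF \<phi>] this]
    show ?thesis by (simp add: cos_mat_def cos_tr_def)
  qed
  have "(\<integral>x. (\<Sum>j\<in>UNIV. sin_vec (c t) x $ j * partial j \<phi> x) \<partial>lebesgue) = (\<integral>x. (\<Sum>j\<in>UNIV. sin_vec (c t) x $ j * partial j \<phi> x) \<partial>lborel)"
    using u_nth_meas[of t] partial_meas[OF \<phi>] by (intro integral_lebesgue_lborel borel_measurable_sum borel_measurable_times)
  also have "\<dots> = - (\<Sum>j\<in>UNIV. \<integral>x. cos_mat (c t) x $ j $ j * \<phi> x \<partial>lborel)"
    using u_weak_derivative[OF \<phi>] by (simp add: sum_negf)
  also have "\<dots> = - (\<integral>x. (\<Sum>j\<in>UNIV. cos_mat (c t) x $ j $ j) * \<phi> x \<partial>lborel)"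
    unfolding sum_distrib_right using i by simp
  finally show "(\<integral>x. (\<Sum>j\<in>UNIV. sin_vec (c t) x $ j * partial j \<phi> x) \<partial>lebesgue) = 0"
    by (simp add: tr0)
qed

lemma u_in_L2: "sin_vec (c t) \<in> L2"
  by (rule L2_borelI[OF u_plancherel(1,2)])

section \<open>Continuity in time and the assembled weak solution\<close>

lemma u_diff_norm:
  "integrable lborel (\<lambda>x. (norm (sin_vec (c t) x - sin_vec (c s) x))\<^sup>2)"
  "(\<integral>x. (norm (sin_vec (c t) x - sin_vec (c s) x))\<^sup>2 \<partial>lborel)
     = (gauss_mass TYPE(real^'n))\<^sup>2 * (\<integral>\<xi>. (norm (c t \<xi> - c s \<xi>))\<^sup>2 \<partial>lborel)"
proof -
  let ?a = "\<lambda>\<xi>. c t \<xi> - c s \<xi>"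
  have am[measurable]: "?a \<in> borel_measurable borel" using ct_meas[of t] ct_meas[of s] by measurable
  have le: "norm (?a \<xi>) \<le> 2 * W \<xi>" for \<xi>
    using norm_triangle_ineq4[of "c t \<xi>" "c s \<xi>"] c_le[of t \<xi>] c_le[of s \<xi>] by linarith
  have a1: "integrable lborel (\<lambda>\<xi>. norm (?a \<xi>))"
    by (rule integrable_dominated[OF integrable_mult_right[OF W_int, of 2]]) (use le in auto)
  have a2: "integrable lborel (\<lambda>\<xi>. (norm (?a \<xi>))\<^sup>2)"
  proof (rule integrable_dominated[OF integrable_mult_right[OF W_sq, of 4]])
    show "norm ((norm (?a \<xi>))\<^sup>2) \<le> 4 * (W \<xi>)\<^sup>2" for \<xi>
      using power_mono[OF le[of \<xi>], of 2] by (simp add: power_mult_distrib)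
  qed measurable
  have odd: "?a (- \<xi>) = - ?a \<xi>" for \<xi> by (simp add: c_odd)
  have "sin_vec ?a x = sin_vec (c t) x - sin_vec (c s) x" for x
    unfolding sin_vec_def sin_tr_def vec_eq_iff
    by (simp add: left_diff_distrib Bochner_Integration.integral_diff integrable_mult_cos_sin(2)[OF integrable_c_nth])
  then show "integrable lborel (\<lambda>x. (norm (sin_vec (c t) x - sin_vec (c s) x))\<^sup>2)"
    "(\<integral>x. (norm (sin_vec (c t) x - sin_vec (c s) x))\<^sup>2 \<partial>lborel)
     = (gauss_mass TYPE(real^'n))\<^sup>2 * (\<integral>\<xi>. (norm (c t \<xi> - c s \<xi>))\<^sup>2 \<partial>lborel)"
    using plancherel_sin_vec(2,3)[OF am a1 a2 odd] by simp_all
qed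

text \<open>Continuity of each amplitude and the majorant \<open>4 * (W \<xi>)^2\<close> give
  convergence in frequency, and Plancherel carries it to space. The weak continuity of a Leray-Hopf
  solution follows from this norm continuity.\<close>

lemma u_strongly_continuous:
  assumes r: "\<And>n. 0 \<le> r n" "r \<longlonglongrightarrow> s" and s: "0 \<le> s"
  shows "(\<lambda>n. \<integral>x. (norm (sin_vec (c (r n)) x - sin_vec (c s) x))\<^sup>2 \<partial>lborel) \<longlonglongrightarrow> 0"
proof -
  have "(\<lambda>n. \<integral>\<xi>. (norm (c (r n) \<xi> - c s \<xi>))\<^sup>2 \<partial>lborel) \<longlonglongrightarrow> (\<integral>\<xi>. 0 \<partial>(lborel :: (real^'n) measure))"
  proof (rule integral_dominated_convergence[OF _ _ integrable_mult_right[OF W_sq, of 4]])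
    show "AE \<xi> in lborel. (\<lambda>n. (norm (c (r n) \<xi> - c s \<xi>))\<^sup>2) \<longlonglongrightarrow> 0"
    proof (intro AE_I2)
      fix \<xi>
      have "(\<lambda>n. c (r n) \<xi>) \<longlonglongrightarrow> c s \<xi>"
        by (rule continuous_on_tendsto_compose[OF c_cont r(2)]) (use r s in auto)
      then show "(\<lambda>n. (norm (c (r n) \<xi> - c s \<xi>))\<^sup>2) \<longlonglongrightarrow> 0"
        by (auto intro!: tendsto_eq_intros)
    qed
    show "AE \<xi> in lborel. norm ((norm (c (r n) \<xi> - c s \<xi>))\<^sup>2) \<le> 4 * (W \<xi>)\<^sup>2" for n
    proof (intro AE_I2)
      fix \<xi>
      have "norm (c (r n) \<xi> - c s \<xi>) \<le> 2 * W \<xi>"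
        using norm_triangle_ineq4[of "c (r n) \<xi>" "c s \<xi>"] c_le[of "r n" \<xi>] c_le[of s \<xi>] by linarith
      from power_mono[OF this, of 2] show "norm ((norm (c (r n) \<xi> - c s \<xi>))\<^sup>2) \<le> 4 * (W \<xi>)\<^sup>2"
        by (simp add: power_mult_distrib)
    qed
    show "(\<lambda>\<xi>. (norm (c (r n) \<xi> - c s \<xi>))\<^sup>2) \<in> borel_measurable lborel" for n
      using ct_meas[of "r n"] ct_meas[of s] by measurable
  qed simp
  then show ?thesis unfolding u_diff_norm(2) by (auto intro!: tendsto_eq_intros)
qed

lemma u_weakly_continuous: "weakly_continuous_L2 (\<lambda>t. sin_vec (c t))"
  unfolding weakly_continuous_L2_def
proof (intro conjI allI impI ballI)
  show "sin_vec (c t) \<in> L2" for t by (rule u_in_L2)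
  fix w :: "real^'n \<Rightarrow> real^'n" assume "w \<in> L2"
  then have wm[measurable]: "w \<in> borel_measurable lebesgue" and w2: "integrable lebesgue (\<lambda>x. (norm (w x))\<^sup>2)"
    by (simp_all add: L2_on_def lebesgue_on_UNIV_eq)
  have um[measurable]: "sin_vec (c t) \<in> borel_measurable lebesgue" for t
    using u_plancherel(1)[of t] by (intro measurable_completion) simp
  have u2: "integrable lebesgue (\<lambda>x. (norm (sin_vec (c t) x))\<^sup>2)" for t
  proof -
    have "(\<lambda>x. (norm (sin_vec (c t) x))\<^sup>2) \<in> borel_measurable lborel" using u_plancherel(1)[of t] by measurable
    then show ?thesis using u_plancherel(2)[of t] by (simp add: integrable_completion)
  qed
  have uw: "integrable lebesgue (\<lambda>x. sin_vec (c t) x \<bullet> w x)" for t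
  proof (rule Bochner_Integration.integrable_bound[OF Bochner_Integration.integrable_add[OF u2[of t] w2]])
    show "AE x in lebesgue. norm (sin_vec (c t) x \<bullet> w x) \<le> norm ((norm (sin_vec (c t) x))\<^sup>2 + (norm (w x))\<^sup>2)"
    proof (intro AE_I2)
      fix x
      have "\<bar>sin_vec (c t) x \<bullet> w x\<bar> \<le> norm (sin_vec (c t) x) * norm (w x)" by (rule Cauchy_Schwarz_ineq2)
      also have "\<dots> \<le> 2 * norm (sin_vec (c t) x) * norm (w x)" by simp
      also have "\<dots> \<le> (norm (sin_vec (c t) x))\<^sup>2 + (norm (w x))\<^sup>2" by (rule sum_squares_bound)
      finally show "norm (sin_vec (c t) x \<bullet> w x) \<le> norm ((norm (sin_vec (c t) x))\<^sup>2 + (norm (w x))\<^sup>2)" by simp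
    qed
  qed measurable
  define B where "B = (\<integral>x. (norm (w x))\<^sup>2 \<partial>lebesgue)"
  have B: "0 \<le> B" by (simp add: B_def)
  define d where "d t s = (\<integral>x. (norm (sin_vec (c t) x - sin_vec (c s) x))\<^sup>2 \<partial>lborel)" for t s
  have d2: "integrable lebesgue (\<lambda>x. (norm (sin_vec (c t) x - sin_vec (c s) x))\<^sup>2)"
    "(\<integral>x. (norm (sin_vec (c t) x - sin_vec (c s) x))\<^sup>2 \<partial>lebesgue) = d t s" for t s
  proof -
    have m: "(\<lambda>x. (norm (sin_vec (c t) x - sin_vec (c s) x))\<^sup>2) \<in> borel_measurable lborel"
      using u_plancherel(1)[of t] u_plancherel(1)[of s] by measurable
    show "integrable lebesgue (\<lambda>x. (norm (sin_vec (c t) x - sin_vec (c s) x))\<^sup>2)"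
      "(\<integral>x. (norm (sin_vec (c t) x - sin_vec (c s) x))\<^sup>2 \<partial>lebesgue) = d t s"
      using u_diff_norm(1)[of t s] m by (simp_all add: integrable_completion integral_completion d_def)
  qed
  have est: "2 * \<bar>(\<integral>x. sin_vec (c t) x \<bullet> w x \<partial>lebesgue) - (\<integral>x. sin_vec (c s) x \<bullet> w x \<partial>lebesgue)\<bar> \<le> e * B + d t s / e"
    if e: "e > 0" for e t s
  proof -
    have "2 * \<bar>(\<integral>x. sin_vec (c t) x \<bullet> w x \<partial>lebesgue) - (\<integral>x. sin_vec (c s) x \<bullet> w x \<partial>lebesgue)\<bar>
       = \<bar>\<integral>x. 2 * (sin_vec (c t) x \<bullet> w x - sin_vec (c s) x \<bullet> w x) \<partial>lebesgue\<bar>"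
      unfolding integral_mult_right_zero Bochner_Integration.integral_diff[OF uw uw] abs_mult by simp
    also have "\<dots> \<le> (\<integral>x. \<bar>2 * (sin_vec (c t) x \<bullet> w x - sin_vec (c s) x \<bullet> w x)\<bar> \<partial>lebesgue)"
      by (rule integral_abs_bound)
    also have "\<dots> \<le> (\<integral>x. e * (norm (w x))\<^sup>2 + (norm (sin_vec (c t) x - sin_vec (c s) x))\<^sup>2 / e \<partial>lebesgue)"
    proof (rule integral_mono)
      show "integrable lebesgue (\<lambda>x. \<bar>2 * (sin_vec (c t) x \<bullet> w x - sin_vec (c s) x \<bullet> w x)\<bar>)"
        using uw by (intro integrable_abs integrable_mult_right Bochner_Integration.integrable_diff)
      show "integrable lebesgue (\<lambda>x. e * (norm (w x))\<^sup>2 + (norm (sin_vec (c t) x - sin_vec (c s) x))\<^sup>2 / e)"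
        using w2 d2(1) by simp
      fix x
      let ?D = "norm (sin_vec (c t) x - sin_vec (c s) x)"
      have "\<bar>sin_vec (c t) x \<bullet> w x - sin_vec (c s) x \<bullet> w x\<bar> \<le> ?D * norm (w x)"
        unfolding inner_diff_left[symmetric] by (rule Cauchy_Schwarz_ineq2)
      moreover have "2 * (?D * norm (w x)) \<le> e * (norm (w x))\<^sup>2 + ?D\<^sup>2 / e"
      proof -
        have "0 \<le> (e * norm (w x) - ?D)\<^sup>2 / e" using e by simp
        also have "\<dots> = e * (norm (w x))\<^sup>2 + ?D\<^sup>2 / e - 2 * (?D * norm (w x))"
          using e by (simp add: power2_eq_square field_simps)
        finally show ?thesis by simp
      qed
      ultimately show "\<bar>2 * (sin_vec (c t) x \<bullet> w x - sin_vec (c s) x \<bullet> w x)\<bar> \<le> e * (norm (w x))\<^sup>2 + ?D\<^sup>2 / e"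
        by (simp add: abs_mult)
    qed
    also have "\<dots> = e * B + d t s / e" using w2 d2 by (simp add: B_def)
    finally show ?thesis .
  qed
  show "continuous_on {0..} (\<lambda>t. \<integral>x. sin_vec (c t) x \<bullet> w x \<partial>lebesgue)"
    unfolding continuous_on_sequentially comp_def
  proof (intro allI ballI impI)
    fix r :: "nat \<Rightarrow> real" and s :: real assume s: "s \<in> {0..}" and rs: "(\<forall>n. r n \<in> {0..}) \<and> r \<longlonglongrightarrow> s"
    have dl: "(\<lambda>n. d (r n) s) \<longlonglongrightarrow> 0"
      unfolding d_def by (rule u_strongly_continuous) (use s rs in auto)
    show "(\<lambda>n. \<integral>x. sin_vec (c (r n)) x \<bullet> w x \<partial>lebesgue) \<longlonglongrightarrow> (\<integral>x. sin_vec (c s) x \<bullet> w x \<partial>lebesgue)"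
    proof (rule LIMSEQ_I)
      fix q :: real assume q: "0 < q"
      \<comment> \<open>Makes \<open>e * B\<close> at most \<open>q\<close>, also when
        \<open>B\<close> is zero, while \<open>d (r n) s / e\<close> is eventually below
        \<open>q\<close>. The estimate \<open>est\<close> bounds twice the difference, so a total
        below \<open>2 * q\<close> is enough.\<close>
      define e where "e = q / (B + 1)"
      have e: "0 < e" using q B by (simp add: e_def)
      have eB: "e * B \<le> q" using q B by (simp add: e_def field_simps)
      have "\<forall>\<^sub>F n in sequentially. d (r n) s < q * e"
        using order_tendstoD(2)[OF dl, of "q * e"] q e by simp
      then obtain N where N: "\<And>n. n \<ge> N \<Longrightarrow> d (r n) s < q * e" unfolding eventually_sequentially by auto
      have "norm ((\<integral>x. sin_vec (c (r n)) x \<bullet> w x \<partial>lebesgue) - (\<integral>x. sin_vec (c s) x \<bullet> w x \<partial>lebesgue)) < q" if "n \<ge> N" for n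
      proof -
        have "d (r n) s / e < q" using N[OF that] e by (simp add: divide_simps)
        then show ?thesis using est[OF e, of "r n" s] eB by simp
      qed
      then show "\<exists>no. \<forall>n\<ge>no. norm ((\<integral>x. sin_vec (c (r n)) x \<bullet> w x \<partial>lebesgue) - (\<integral>x. sin_vec (c s) x \<bullet> w x \<partial>lebesgue)) < q"
        by blast
    qed
  qed
qed

lemma L2_norm_u_le: "L2_norm (sin_vec (c t)) \<le> sqrt ((gauss_mass TYPE(real^'n))\<^sup>2 * (\<integral>\<xi>. (W \<xi>)\<^sup>2 \<partial>lborel))"
proof (rule real_le_rsqrt, unfold L2_norm_u, rule mult_left_mono)
  show "(\<integral>\<xi>. (norm (c t \<xi>))\<^sup>2 \<partial>lborel) \<le> (\<integral>\<xi>. (W \<xi>)\<^sup>2 \<partial>lborel)"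
    by (intro integral_mono c_square_int W_sq power_mono c_le) auto
qed simp

lemma leray_hopf: "leray_hopf_field (\<lambda>t. sin_vec (c t)) (\<lambda>t. cos_mat (c t)) (sin_vec (c 0))"
  unfolding leray_hopf_field_def
proof (intro conjI)
  show "(\<lambda>(t, x). sin_vec (c t) x) \<in> borel_measurable (lebesgue_on spacetime)"
    by (rule borel_measurable_lebesgue_on_lborel[OF field_meas(1)])
  show "\<exists>C. AE t in lebesgue_on {0<..}. L2_norm (sin_vec (c t)) \<le> C"
    using L2_norm_u_le by blast
qed (simp_all add: Du_in_L2 u_weak_gradient u_div_free u_weakly_continuous)

lemma mhd_solution_sin_vec: "mhd_solution \<delta> (sin_vec (c 0)) (\<lambda>_. 0) (\<lambda>t. sin_vec (c t)) (\<lambda>_ _. 0)"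
proof -
  have "AE s in lebesgue_on {0<..}. energy_inequality_from \<delta> (\<lambda>t. sin_vec (c t)) (\<lambda>_ _. 0) (\<lambda>t. cos_mat (c t)) (\<lambda>_ _. 0) s"
    by (rule AE_I2) (auto intro: energy_inequality)
  moreover have "induction_equation \<delta> (\<lambda>t. sin_vec (c t)) (\<lambda>_ _. 0) (\<lambda>t. cos_mat (c t)) (\<lambda>_ _. 0)"
    by (simp add: induction_equation_def case_prod_unfold)
  ultimately show ?thesis
    unfolding mhd_solution_def
    using leray_hopf leray_hopf_field_zero press_locally_integrable momentum energy_inequality[of 0]
    by blast
qed

end


section \<open>Picard iteration in frequency variables\<close>

text \<open>The antiderivative \<open>exp (- (t - s) * k)\<close> of the kernel times
  \<open>k\<close> lies between zero and one on the interval, so the bound does not see the length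
  of the interval. This is the source of global solutions.\<close>

lemma heat_kernel_time_integral:
  fixes k t :: real
  assumes k: "0 \<le> k"
  shows "integrable lborel (\<lambda>s. indicator {0..t} s * exp (- (t - s) * k))"
    and "(\<integral>s. indicator {0..t} s * exp (- (t - s) * k) \<partial>lborel) * k \<le> 1"
proof -
  have si: "set_integrable lborel {0..t} (\<lambda>s. exp (- (t - s) * k))"
    by (intro borel_integrable_atLeastAtMost') (auto intro!: continuous_intros)
  then show i: "integrable lborel (\<lambda>s. indicator {0..t} s * exp (- (t - s) * k))"
    by (simp add: set_integrable_def)
  show "(\<integral>s. indicator {0..t} s * exp (- (t - s) * k) \<partial>lborel) * k \<le> 1"
  proof (cases "0 \<le> t")
    case True
    have "((\<lambda>s. exp (- (t - s) * k) * k) has_integral (exp (- (t - t) * k) - exp (- (t - 0) * k))) {0..t}"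
      by (rule fundamental_theorem_of_calculus[OF True])
         (auto intro!: derivative_eq_intros simp flip: has_real_derivative_iff_has_vector_derivative)
    then have "integral {0..t} (\<lambda>s. exp (- (t - s) * k) * k) = exp (- (t - t) * k) - exp (- (t - 0) * k)"
      by (rule integral_unique)
    moreover have "exp (- (t - t) * k) - exp (- (t - 0) * k) \<le> 1" by simp
    moreover have "set_integrable lborel {0..t} (\<lambda>s. exp (- (t - s) * k) * k)"
      by (intro borel_integrable_atLeastAtMost') (auto intro!: continuous_intros)
    then have "(\<integral>s. indicator {0..t} s *\<^sub>R (exp (- (t - s) * k) * k) \<partial>lborel) = integral {0..t} (\<lambda>s. exp (- (t - s) * k) * k)"
      using set_borel_integral_eq_integral(2) unfolding set_lebesgue_integral_def by blast
    moreover have "(\<integral>s. indicator {0..t} s *\<^sub>R (exp (- (t - s) * k) * k) \<partial>lborel) = (\<integral>s. indicator {0..t} s * exp (- (t - s) * k) \<partial>lborel) * k"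
      unfolding real_scaleR_def mult.assoc[symmetric] by (rule integral_mult_left_zero)
    ultimately show ?thesis by linarith
  qed simp
qed

text \<open>A convergent sequence is bounded, so together with its limit it stays in one of the
  compact intervals.\<close>

lemma continuous_on_atLeast_from_Icc:
  fixes f :: "real \<Rightarrow> 'a::real_normed_vector"
  assumes "\<And>T. continuous_on {a..T} f"
  shows "continuous_on {a..} f"
  unfolding continuous_on_sequentially comp_def
proof (intro allI ballI impI)
  fix r :: "nat \<Rightarrow> real" and s :: real assume s: "s \<in> {a..}" and r: "(\<forall>n. r n \<in> {a..}) \<and> r \<longlonglongrightarrow> s"
  then obtain B where B: "\<And>n. norm (r n) \<le> B"
    using convergent_imp_Bseq[of r] unfolding convergent_def Bseq_def by auto
  define T where "T = max s B"
  have "r n \<le> T" for n using B[of n] abs_ge_self[of "r n"] unfolding T_def by simp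
  then show "(\<lambda>n. f (r n)) \<longlonglongrightarrow> f s"
    using continuous_on_tendsto_compose[OF assms[of T], of r s] r s by (auto simp: T_def)
qed

text \<open>The iteration runs in the ball of radius \<open>2 * A\<close> of the sup norm weighted
  by \<open>w\<close>: one \<open>A\<close> for the heat flow of the data, one for the Duhamel term,
  which is at most \<open>4 * A^2 * C\<close>. Invariance of the ball needs
  \<open>4 * A * C \<le> 1\<close>, contraction by one half needs \<open>8 * A * C \<le> 1\<close>.
  The origin is exempt from \<open>conv\<close> because the weight used later takes the value zero
  there while its convolution is positive.\<close>

locale picard = envelope w for w :: "real^'n::finite \<Rightarrow> real" +
  fixes c0 :: "real^'n \<Rightarrow> real^'n" and A C :: real
  assumes conv: "\<xi> \<noteq> 0 \<Longrightarrow> WW \<xi> \<le> C * norm \<xi> * w \<xi>"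
    and C0: "0 \<le> C" and A0: "0 \<le> A" and small: "8 * A * C \<le> 1"
    and c0_meas[measurable]: "c0 \<in> borel_measurable borel"
    and c0_le: "norm (c0 \<xi>) \<le> A * w \<xi>"
    and c0_odd: "c0 (- \<xi>) = - c0 \<xi>"
    and c0_div: "\<xi> \<bullet> c0 \<xi> = 0"
begin

definition admissible :: "(real \<Rightarrow> real^'n \<Rightarrow> real^'n) \<Rightarrow> bool" where
  "admissible a \<longleftrightarrow> case_prod a \<in> borel_measurable (borel \<Otimes>\<^sub>M borel) \<and>
     (\<forall>t \<xi>. norm (a t \<xi>) \<le> 2 * A * w \<xi> \<and> a t (- \<xi>) = - a t \<xi> \<and> \<xi> \<bullet> a t \<xi> = 0)"

definition "duhamel a t \<xi> =
   (\<integral>s. indicator {0..t} s *\<^sub>R (exp (- (t - s) * (norm \<xi>)\<^sup>2) *\<^sub>R leray_proj \<xi> (convect (a s) (a s) \<xi>)) \<partial>lborel)"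

text \<open>For negative \<open>t\<close> the interval in \<open>duhamel\<close> is empty and
  \<open>max\<close> freezes the heat factor at one, so that the bound in \<open>admissible\<close>
  holds at all real times.\<close>

definition "step a t \<xi> = exp (- max t 0 * (norm \<xi>)\<^sup>2) *\<^sub>R c0 \<xi> - duhamel a t \<xi>"

lemma compose_meas:
  fixes a :: "real \<Rightarrow> real^'n \<Rightarrow> real^'n"
  assumes a: "case_prod a \<in> borel_measurable (borel \<Otimes>\<^sub>M borel)"
  shows "f \<in> borel_measurable M \<Longrightarrow> g \<in> borel_measurable M \<Longrightarrow> (\<lambda>x. a (f x) (g x) :: real^'n) \<in> borel_measurable M"
  using measurable_compose[OF measurable_Pair[of f M borel g borel] a] by simp

lemma slice_meas:
  fixes a :: "real \<Rightarrow> real^'n \<Rightarrow> real^'n"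
  assumes a: "case_prod a \<in> borel_measurable (borel \<Otimes>\<^sub>M borel)"
  shows "(a t :: real^'n \<Rightarrow> real^'n) \<in> borel_measurable borel"
  using compose_meas[OF a, of "\<lambda>_. t" borel "\<lambda>\<xi>. \<xi>"] by simp

lemma convect_meas:
  fixes a :: "real \<Rightarrow> real^'n \<Rightarrow> real^'n"
  assumes a: "case_prod a \<in> borel_measurable (borel \<Otimes>\<^sub>M borel)"
  shows "(\<lambda>(t, \<xi>). convect (a t) (a t) \<xi>) \<in> borel_measurable (borel \<Otimes>\<^sub>M borel)"
proof -
  have 1: "(\<lambda>z. a (fst (fst z)) (snd (fst z) - snd z)) \<in> borel_measurable ((borel \<Otimes>\<^sub>M borel) \<Otimes>\<^sub>M lborel)"
    by (rule compose_meas[OF a]) measurable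
  have 2: "(\<lambda>z. a (fst (fst z)) (snd z)) \<in> borel_measurable ((borel \<Otimes>\<^sub>M borel) \<Otimes>\<^sub>M lborel)"
    by (rule compose_meas[OF a]) measurable
  have "(\<lambda>(z, \<eta>). (snd z \<bullet> a (fst z) (snd z - \<eta>)) *\<^sub>R a (fst z) \<eta>) \<in> borel_measurable ((borel \<Otimes>\<^sub>M borel) \<Otimes>\<^sub>M lborel)"
    unfolding case_prod_unfold using 1 2 by measurable
  then show ?thesis
    unfolding convect_def case_prod_unfold
    by (rule lborel.borel_measurable_lebesgue_integral[where f = "\<lambda>p \<eta>. (snd p \<bullet> a (fst p) (snd p - \<eta>)) *\<^sub>R a (fst p) \<eta>", unfolded case_prod_unfold])
qed

lemma convect_meas_time:
  fixes a :: "real \<Rightarrow> real^'n \<Rightarrow> real^'n"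
  assumes a: "case_prod a \<in> borel_measurable (borel \<Otimes>\<^sub>M borel)"
  shows "(\<lambda>t. convect (a t) (a t) \<xi> :: real^'n) \<in> borel_measurable borel"
  using compose_meas[OF convect_meas[OF a], of "\<lambda>t. t" borel "\<lambda>_. \<xi>"] by simp

lemma leray_meas:
  assumes [measurable]: "f \<in> borel_measurable M" "g \<in> borel_measurable M"
  shows "(\<lambda>x. leray_proj (f x) (g x :: real^'n)) \<in> borel_measurable M"
  unfolding leray_proj_def by measurable

lemma step_meas:
  fixes a :: "real \<Rightarrow> real^'n \<Rightarrow> real^'n"
  assumes a: "case_prod a \<in> borel_measurable (borel \<Otimes>\<^sub>M borel)"
  shows "case_prod (step a) \<in> borel_measurable (borel \<Otimes>\<^sub>M borel)"
proof -
  have 1: "(\<lambda>z. convect (a (snd z)) (a (snd z)) (snd (fst z))) \<in> borel_measurable (((borel :: real measure) \<Otimes>\<^sub>M (borel :: (real^'n) measure)) \<Otimes>\<^sub>M lborel)"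
    by (rule compose_meas[OF convect_meas[OF a]]) measurable
  have 2: "(\<lambda>z. leray_proj (snd (fst z)) (convect (a (snd z)) (a (snd z)) (snd (fst z)))) \<in> borel_measurable (((borel :: real measure) \<Otimes>\<^sub>M (borel :: (real^'n) measure)) \<Otimes>\<^sub>M lborel)"
    by (rule leray_meas[OF _ 1]) measurable
  have 3: "(\<lambda>z. indicator {0..fst (fst z)} (snd z) :: real) \<in> borel_measurable (((borel :: real measure) \<Otimes>\<^sub>M (borel :: (real^'n) measure)) \<Otimes>\<^sub>M lborel)"
    unfolding indicator_def atLeastAtMost_iff by measurable
  have "(\<lambda>(z, s). indicator {0..fst z} s *\<^sub>R (exp (- (fst z - s) * (norm (snd z))\<^sup>2) *\<^sub>R leray_proj (snd z) (convect (a s) (a s) (snd z))))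
     \<in> borel_measurable (((borel :: real measure) \<Otimes>\<^sub>M (borel :: (real^'n) measure)) \<Otimes>\<^sub>M lborel)"
    unfolding case_prod_unfold using 2 3 by measurable
  from lborel.borel_measurable_lebesgue_integral[OF this]
  have "(\<lambda>z. duhamel a (fst z) (snd z)) \<in> borel_measurable (borel \<Otimes>\<^sub>M borel)"
    unfolding duhamel_def .
  then show ?thesis unfolding step_def case_prod_unfold by measurable
qed

text \<open>The heat kernel regains exactly two powers of the frequency, uniformly in
  \<open>t\<close>; the forcing below has just this size.\<close>

lemma time_integral_bound:
  fixes R :: "real \<Rightarrow> real^'n"
  assumes R[measurable]: "R \<in> borel_measurable borel" and le: "\<And>s. norm (R s) \<le> B * (norm \<xi>)\<^sup>2" and B: "0 \<le> B"
  shows "integrable lborel (\<lambda>s. indicator {0..t} s *\<^sub>R (exp (- (t - s) * (norm \<xi>)\<^sup>2) *\<^sub>R R s))"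
    and "norm (\<integral>s. indicator {0..t} s *\<^sub>R (exp (- (t - s) * (norm \<xi>)\<^sup>2) *\<^sub>R R s) \<partial>lborel) \<le> B"
proof -
  note K = heat_kernel_time_integral[of "(norm \<xi>)\<^sup>2" t]
  let ?K = "\<lambda>s. indicator {0..t} s * exp (- (t - s) * (norm \<xi>)\<^sup>2)"
  have n: "norm (indicator {0..t} s *\<^sub>R (exp (- (t - s) * (norm \<xi>)\<^sup>2) *\<^sub>R R s)) \<le> ?K s * (B * (norm \<xi>)\<^sup>2)" for s
    using le[of s] by (simp add: indicator_def)
  have iK: "integrable lborel (\<lambda>s. ?K s * (B * (norm \<xi>)\<^sup>2))" by (intro integrable_mult_left K) simp
  show i: "integrable lborel (\<lambda>s. indicator {0..t} s *\<^sub>R (exp (- (t - s) * (norm \<xi>)\<^sup>2) *\<^sub>R R s))"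
    by (rule integrable_dominated[OF iK _ n]) measurable
  have "norm (\<integral>s. indicator {0..t} s *\<^sub>R (exp (- (t - s) * (norm \<xi>)\<^sup>2) *\<^sub>R R s) \<partial>lborel) \<le> (\<integral>s. ?K s * (B * (norm \<xi>)\<^sup>2) \<partial>lborel)"
    by (rule order_trans[OF integral_norm_bound integral_mono[OF integrable_norm[OF i] iK n]])
  also have "\<dots> = B * ((\<integral>s. ?K s \<partial>lborel) * (norm \<xi>)\<^sup>2)" by simp
  also have "\<dots> \<le> B * 1" by (intro mult_left_mono K B) simp
  finally show "norm (\<integral>s. indicator {0..t} s *\<^sub>R (exp (- (t - s) * (norm \<xi>)\<^sup>2) *\<^sub>R R s) \<partial>lborel) \<le> B" by simp
qed

text \<open>One power of \<open>norm \<xi>\<close> is explicit in \<open>convect\<close>, the other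
  comes from \<open>conv\<close>. At the origin the explicit factor makes both sides vanish.\<close>

lemma norm_convect_le:
  assumes "a \<in> borel_measurable borel" "b \<in> borel_measurable borel" "0 \<le> \<alpha>" "0 \<le> \<beta>"
    "\<And>\<xi>. norm (a \<xi>) \<le> \<alpha> * w \<xi>" "\<And>\<xi>. norm (b \<xi>) \<le> \<beta> * w \<xi>"
  shows "norm (convect a b \<xi>) \<le> \<alpha> * \<beta> * C * w \<xi> * (norm \<xi>)\<^sup>2"
proof -
  have "norm (convect a b \<xi>) \<le> \<alpha> * \<beta> * (norm \<xi> * WW \<xi>)"
    by (rule convect_integrable(2)) (use assms in auto)
  also have "\<dots> \<le> \<alpha> * \<beta> * (norm \<xi> * (C * norm \<xi> * w \<xi>))"
  proof (cases "\<xi> = 0")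
    case False
    then show ?thesis by (intro mult_left_mono conv mult_nonneg_nonneg assms) simp_all
  qed simp
  finally show ?thesis by (simp add: power2_eq_square mult_ac)
qed

lemma admissibleD:
  assumes "admissible a"
  shows "case_prod a \<in> borel_measurable (borel \<Otimes>\<^sub>M borel)" "norm (a t \<xi>) \<le> 2 * A * w \<xi>"
    "a t (- \<xi>) = - a t \<xi>" "\<xi> \<bullet> a t \<xi> = 0"
  using assms unfolding admissible_def by auto

lemma convect_minus:
  assumes a: "\<And>\<xi>. a (- \<xi>) = - a \<xi>" and am[measurable]: "a \<in> borel_measurable borel"
  shows "convect a a (- \<xi>) = - convect a a (\<xi> :: real^'n)"
proof -
  have "convect a a (- \<xi>) = (\<integral>\<eta>. (- \<xi> \<bullet> a (- \<xi> - (0 - \<eta>))) *\<^sub>R a (0 - \<eta>) \<partial>lborel)"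
    unfolding convect_def by (rule lborel_integral_reflect(1)[symmetric]) measurable
  also have "\<dots> = (\<integral>\<eta>. - ((\<xi> \<bullet> a (\<xi> - \<eta>)) *\<^sub>R a \<eta>) \<partial>lborel)"
  proof -
    have "a (- \<xi> - (0 - \<eta>)) = - a (\<xi> - \<eta>)" "a (0 - \<eta>) = - a \<eta>" for \<eta>
      using a[of "\<xi> - \<eta>"] a[of \<eta>] by simp_all
    then show ?thesis by simp
  qed
  finally show ?thesis unfolding convect_def by simp
qed

lemma forcing_bound:
  assumes a: "admissible a"
  shows "norm (leray_proj \<xi> (convect (a s) (a s) \<xi>)) \<le> 4 * A\<^sup>2 * C * w \<xi> * (norm \<xi>)\<^sup>2"
proof -
  note am = slice_meas[OF admissibleD(1)[OF a]]
  have "norm (convect (a s) (a s) \<xi>) \<le> (2 * A) * (2 * A) * C * w \<xi> * (norm \<xi>)\<^sup>2"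
    by (rule norm_convect_le[OF am am]) (use A0 admissibleD(2)[OF a] in auto)
  then show ?thesis
    using norm_leray_proj_le[of \<xi> "convect (a s) (a s) \<xi>"] by (simp add: power2_eq_square mult_ac)
qed

lemma forcing_meas:
  assumes a: "admissible a"
  shows "(\<lambda>s. leray_proj \<xi> (convect (a s) (a s) \<xi>)) \<in> borel_measurable borel"
  by (rule leray_meas[OF _ convect_meas_time[OF admissibleD(1)[OF a]]]) simp

lemma norm_duhamel_le:
  assumes a: "admissible a"
  shows "norm (duhamel a t \<xi>) \<le> 4 * A\<^sup>2 * C * w \<xi>"
  unfolding duhamel_def
  by (rule time_integral_bound(2)[OF forcing_meas[OF a] forcing_bound[OF a]])
     (intro mult_nonneg_nonneg C0 W_nonneg, simp_all)

lemma admissible_step: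
  assumes a: "admissible a"
  shows "admissible (step a)"
  unfolding admissible_def
proof (intro conjI allI)
  show "case_prod (step a) \<in> borel_measurable (borel \<Otimes>\<^sub>M borel)"
    by (rule step_meas[OF admissibleD(1)[OF a]])
  fix t \<xi>
  have "4 * A\<^sup>2 * C * w \<xi> \<le> A * w \<xi>"
  proof -
    have "4 * A * C \<le> 1" using small mult_nonneg_nonneg[OF A0 C0] by linarith
    from mult_left_mono[OF this, of "A * w \<xi>"] show ?thesis
      using A0 W_nonneg[of \<xi>] by (simp add: power2_eq_square mult_ac)
  qed
  moreover have "norm (exp (- max t 0 * (norm \<xi>)\<^sup>2) *\<^sub>R c0 \<xi>) \<le> A * w \<xi>"
  proof -
    have "exp (- max t 0 * (norm \<xi>)\<^sup>2) \<le> 1" by simp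
    from mult_mono[OF this c0_le[of \<xi>]] show ?thesis by simp
  qed
  ultimately show "norm (step a t \<xi>) \<le> 2 * A * w \<xi>"
    unfolding step_def
    using norm_triangle_ineq4[of "exp (- max t 0 * (norm \<xi>)\<^sup>2) *\<^sub>R c0 \<xi>" "duhamel a t \<xi>"] norm_duhamel_le[OF a, of t \<xi>]
    by linarith
  show "step a t (- \<xi>) = - step a t \<xi>"
    unfolding step_def duhamel_def
    using convect_minus[OF admissibleD(3)[OF a] slice_meas[OF admissibleD(1)[OF a]]]
    by (simp add: c0_odd leray_proj_minus)
  have "\<xi> \<bullet> duhamel a t \<xi> = (\<integral>s. \<xi> \<bullet> (indicator {0..t} s *\<^sub>R (exp (- (t - s) * (norm \<xi>)\<^sup>2) *\<^sub>R leray_proj \<xi> (convect (a s) (a s) \<xi>))) \<partial>lborel)"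
    unfolding duhamel_def
    by (rule integral_bounded_linear[OF bounded_linear_inner_right, symmetric])
       (rule time_integral_bound(1)[OF forcing_meas[OF a] forcing_bound[OF a]], intro mult_nonneg_nonneg C0 W_nonneg, simp_all)
  then have "\<xi> \<bullet> duhamel a t \<xi> = 0" by (simp add: inner_leray_proj)
  then show "\<xi> \<bullet> step a t \<xi> = 0" by (simp add: step_def inner_diff_right c0_div)
qed

lemma convect_diff:
  assumes a: "admissible a" and b: "admissible b"
  shows "convect (a s) (a s) \<xi> - convect (b s) (b s) \<xi> =
    convect (\<lambda>\<xi>. a s \<xi> - b s \<xi>) (a s) \<xi> + convect (b s) (\<lambda>\<xi>. a s \<xi> - b s \<xi>) \<xi>"
proof -
  note m = slice_meas[OF admissibleD(1)[OF a], of s] slice_meas[OF admissibleD(1)[OF b], of s]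
  note l = admissibleD(2)[OF a, of s] admissibleD(2)[OF b, of s]
  note i = convect_integrable(1)[OF m(1) m(1) l(1) l(1)] convect_integrable(1)[OF m(2) m(2) l(2) l(2)]
    convect_integrable(1)[OF m(2) m(1) l(2) l(1)]
  have e1: "(\<xi> \<bullet> (a s (\<xi> - \<eta>) - b s (\<xi> - \<eta>))) *\<^sub>R a s \<eta> = (\<xi> \<bullet> a s (\<xi> - \<eta>)) *\<^sub>R a s \<eta> - (\<xi> \<bullet> b s (\<xi> - \<eta>)) *\<^sub>R a s \<eta>" for \<eta>
    by (simp add: inner_diff_right scaleR_diff_left)
  have e2: "(\<xi> \<bullet> b s (\<xi> - \<eta>)) *\<^sub>R (a s \<eta> - b s \<eta>) = (\<xi> \<bullet> b s (\<xi> - \<eta>)) *\<^sub>R a s \<eta> - (\<xi> \<bullet> b s (\<xi> - \<eta>)) *\<^sub>R b s \<eta>" for \<eta>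
    by (simp add: scaleR_diff_right)
  show ?thesis
    unfolding convect_def e1 e2 using i by simp
qed

text \<open>The difference of the quadratic terms splits bilinearly into two, each with one factor
  of size \<open>D\<close> and one of size \<open>2 * A\<close>. Together they give
  \<open>4 * A * C * D\<close>, at most \<open>D / 2\<close> by \<open>small\<close>.\<close>

lemma step_contraction:
  assumes a: "admissible a" and b: "admissible b" and D: "0 \<le> D"
    and le: "\<And>t \<xi>. norm (a t \<xi> - b t \<xi>) \<le> D * w \<xi>"
  shows "norm (step a t \<xi> - step b t \<xi>) \<le> D / 2 * w \<xi>"
proof -
  note m = slice_meas[OF admissibleD(1)[OF a]] slice_meas[OF admissibleD(1)[OF b]]
  have dm: "(\<lambda>\<xi>. a s \<xi> - b s \<xi>) \<in> borel_measurable borel" for s using m[of s] by measurable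
  have A2: "0 \<le> 2 * A" using A0 by simp
  let ?F = "\<lambda>a s. leray_proj \<xi> (convect (a s) (a s) \<xi>)"
  have Rle: "norm (?F a s - ?F b s) \<le> (4 * A * C * D * w \<xi>) * (norm \<xi>)\<^sup>2" for s
  proof -
    have "norm (convect (\<lambda>\<xi>. a s \<xi> - b s \<xi>) (a s) \<xi>) \<le> D * (2 * A) * C * w \<xi> * (norm \<xi>)\<^sup>2"
      by (rule norm_convect_le[OF dm m(1) D A2 le admissibleD(2)[OF a]])
    moreover have "norm (convect (b s) (\<lambda>\<xi>. a s \<xi> - b s \<xi>) \<xi>) \<le> (2 * A) * D * C * w \<xi> * (norm \<xi>)\<^sup>2"
      by (rule norm_convect_le[OF m(2) dm A2 D admissibleD(2)[OF b] le])
    ultimately have "norm (convect (a s) (a s) \<xi> - convect (b s) (b s) \<xi>) \<le> (4 * A * C * D * w \<xi>) * (norm \<xi>)\<^sup>2"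
      unfolding convect_diff[OF a b] by (intro norm_triangle_le) (simp add: mult_ac)
    then show ?thesis
      unfolding leray_proj_diff[symmetric] using norm_leray_proj_le order_trans by blast
  qed
  have Rm: "(\<lambda>s. ?F a s - ?F b s) \<in> borel_measurable borel"
    using forcing_meas[OF a] forcing_meas[OF b] by (rule borel_measurable_diff)
  have p: "0 \<le> 4 * A * C * D * w \<xi>" by (intro mult_nonneg_nonneg C0 W_nonneg D A0) simp
  have p2: "0 \<le> 4 * A\<^sup>2 * C * w \<xi>" by (intro mult_nonneg_nonneg C0 W_nonneg) simp_all
  have "step a t \<xi> - step b t \<xi> = - (duhamel a t \<xi> - duhamel b t \<xi>)"
    by (simp add: step_def)
  also have "duhamel a t \<xi> - duhamel b t \<xi> = (\<integral>s. indicator {0..t} s *\<^sub>R (exp (- (t - s) * (norm \<xi>)\<^sup>2) *\<^sub>R (?F a s - ?F b s)) \<partial>lborel)"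
    unfolding duhamel_def scaleR_diff_right
    by (rule Bochner_Integration.integral_diff[symmetric])
       (rule time_integral_bound(1)[OF forcing_meas[OF a] forcing_bound[OF a] p2]
             time_integral_bound(1)[OF forcing_meas[OF b] forcing_bound[OF b] p2])+
  finally have "norm (step a t \<xi> - step b t \<xi>) \<le> 4 * A * C * D * w \<xi>"
    using time_integral_bound(2)[OF Rm Rle p, of t] by simp
  also have "\<dots> \<le> D / 2 * w \<xi>"
    using mult_right_mono[OF small, of "D * w \<xi> / 2"] D W_nonneg[of \<xi>] by (simp add: mult_ac)
  finally show ?thesis .
qed

primrec iter :: "nat \<Rightarrow> real \<Rightarrow> real^'n \<Rightarrow> real^'n" where
  "iter 0 = (\<lambda>_ _. 0)"
| "iter (Suc k) = step (iter k)"

lemma admissible_iter: "admissible (iter k)"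
proof (induction k)
  case 0
  show ?case using A0 W_nonneg by (simp add: admissible_def case_prod_unfold)
qed (simp add: admissible_step)

lemma iter_diff: "norm (iter (Suc k) t \<xi> - iter k t \<xi>) \<le> 2 * A * (1 / 2) ^ k * w \<xi>"
proof (induction k arbitrary: t \<xi>)
  case 0
  show ?case using admissibleD(2)[OF admissible_iter[of 1], of t \<xi>] by simp
next
  case (Suc k)
  have "0 \<le> 2 * A * (1 / 2) ^ k" using A0 by simp
  from step_contraction[OF admissible_iter admissible_iter this Suc, of t \<xi>] show ?case by simp
qed

text \<open>A partial geometric sum. Keeping the factor \<open>1 - (1 / 2) ^ j\<close>, which is
  dropped in the limit, is what makes the induction on \<open>j\<close> close.\<close>

lemma iter_diff_add: "norm (iter (m + j) t \<xi> - iter m t \<xi>) \<le> 4 * A * (1 / 2) ^ m * (1 - (1 / 2) ^ j) * w \<xi>"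
proof (induction j)
  case (Suc j)
  have "norm (iter (m + Suc j) t \<xi> - iter m t \<xi>) \<le> norm (iter (Suc (m + j)) t \<xi> - iter (m + j) t \<xi>) + norm (iter (m + j) t \<xi> - iter m t \<xi>)"
    using norm_triangle_ineq[of "iter (Suc (m + j)) t \<xi> - iter (m + j) t \<xi>" "iter (m + j) t \<xi> - iter m t \<xi>"] by simp
  also have "\<dots> \<le> 2 * A * (1 / 2) ^ (m + j) * w \<xi> + 4 * A * (1 / 2) ^ m * (1 - (1 / 2) ^ j) * w \<xi>"
    by (intro add_mono iter_diff Suc)
  also have "\<dots> = 4 * A * (1 / 2) ^ m * (1 - (1 / 2) ^ Suc j) * w \<xi>"
    by (simp add: power_add algebra_simps)
  finally show ?case .
qed simp

definition "sol t \<xi> = lim (\<lambda>k. iter k t \<xi>)"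

lemma iter_LIMSEQ: "(\<lambda>k. iter k t \<xi>) \<longlonglongrightarrow> sol t \<xi>"
proof -
  have "summable (\<lambda>k. iter (Suc k) t \<xi> - iter k t \<xi>)"
  proof (rule summable_norm_cancel, rule summable_comparison_test')
    show "summable (\<lambda>k. 2 * A * w \<xi> * (1 / 2 :: real) ^ k)" by (intro summable_mult summable_geometric) simp
    show "norm (norm (iter (Suc k) t \<xi> - iter k t \<xi>)) \<le> 2 * A * w \<xi> * (1 / 2) ^ k" if "k \<ge> 0" for k
      using iter_diff[of k t \<xi>] by (simp add: mult_ac)
  qed
  from summable_LIMSEQ[OF this] have "(\<lambda>k. iter k t \<xi>) \<longlonglongrightarrow> (\<Sum>k. iter (Suc k) t \<xi> - iter k t \<xi>)"
    unfolding sum_lessThan_telescope[of "\<lambda>k. iter k t \<xi>"] by simp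
  then have "convergent (\<lambda>k. iter k t \<xi>)" by (auto simp only: convergent_def)
  then show ?thesis unfolding sol_def by (rule convergent_LIMSEQ_iff[THEN iffD1])
qed

lemma sol_iter_diff: "norm (sol t \<xi> - iter m t \<xi>) \<le> 4 * A * (1 / 2) ^ m * w \<xi>"
proof (rule tendsto_upperbound)
  show "(\<lambda>j. norm (iter (j + m) t \<xi> - iter m t \<xi>)) \<longlonglongrightarrow> norm (sol t \<xi> - iter m t \<xi>)"
    by (intro tendsto_intros LIMSEQ_ignore_initial_segment iter_LIMSEQ)
  show "\<forall>\<^sub>F j in sequentially. norm (iter (j + m) t \<xi> - iter m t \<xi>) \<le> 4 * A * (1 / 2) ^ m * w \<xi>"
  proof (intro always_eventually allI)
    fix j
    have "4 * A * (1 / 2) ^ m * (1 - (1 / 2) ^ j) * w \<xi> \<le> 4 * A * (1 / 2) ^ m * 1 * w \<xi>"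
      using A0 W_nonneg[of \<xi>] by (intro mult_right_mono mult_left_mono) simp_all
    then show "norm (iter (j + m) t \<xi> - iter m t \<xi>) \<le> 4 * A * (1 / 2) ^ m * w \<xi>"
      using iter_diff_add[of m j t \<xi>] by (simp add: add.commute)
  qed
qed simp

lemma admissible_sol: "admissible sol"
  unfolding admissible_def
proof (intro conjI allI)
  show "case_prod sol \<in> borel_measurable (borel \<Otimes>\<^sub>M borel)"
    by (rule borel_measurable_LIMSEQ_metric[where f = "\<lambda>k. case_prod (iter k)"])
       (use admissibleD(1)[OF admissible_iter] iter_LIMSEQ in auto)
  fix t \<xi>
  show "norm (sol t \<xi>) \<le> 2 * A * w \<xi>"
    by (rule Lim_bounded[OF tendsto_norm[OF iter_LIMSEQ], of 0]) (simp add: admissibleD(2)[OF admissible_iter])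
  show "sol t (- \<xi>) = - sol t \<xi>"
    by (rule LIMSEQ_unique[OF iter_LIMSEQ[of t "- \<xi>"]])
       (simp add: admissibleD(3)[OF admissible_iter] tendsto_minus[OF iter_LIMSEQ])
  show "\<xi> \<bullet> sol t \<xi> = 0"
    by (rule LIMSEQ_unique[OF tendsto_inner[OF tendsto_const iter_LIMSEQ]])
       (simp add: admissibleD(4)[OF admissible_iter])
qed

text \<open>The contraction estimate, applied to \<open>sol\<close> and an iterate, carries the
  weighted rate of convergence through \<open>step\<close>.\<close>

lemma sol_fixed_point: "step sol t \<xi> = sol t \<xi>"
proof (rule LIMSEQ_unique)
  show "(\<lambda>m. iter (Suc m) t \<xi>) \<longlonglongrightarrow> sol t \<xi>" by (rule LIMSEQ_Suc[OF iter_LIMSEQ])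
  have "(\<lambda>m. step sol t \<xi> - iter (Suc m) t \<xi>) \<longlonglongrightarrow> 0"
  proof (rule Lim_null_comparison)
    show "\<forall>\<^sub>F m in sequentially. norm (step sol t \<xi> - iter (Suc m) t \<xi>) \<le> 2 * A * w \<xi> * (1 / 2) ^ m"
    proof (intro always_eventually allI)
      fix m
      have "0 \<le> 4 * A * (1 / 2) ^ m" using A0 by simp
      from step_contraction[OF admissible_sol admissible_iter[of m] this sol_iter_diff]
      show "norm (step sol t \<xi> - iter (Suc m) t \<xi>) \<le> 2 * A * w \<xi> * (1 / 2) ^ m"
        by (simp add: mult_ac)
    qed
    show "(\<lambda>m. 2 * A * w \<xi> * (1 / 2 :: real) ^ m) \<longlonglongrightarrow> 0"
      by (auto intro!: tendsto_eq_intros LIMSEQ_realpow_zero)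
  qed
  from tendsto_diff[OF tendsto_const this, of "step sol t \<xi>"]
  show "(\<lambda>m. iter (Suc m) t \<xi>) \<longlonglongrightarrow> step sol t \<xi>" by simp
qed

definition "force s \<xi> = leray_proj \<xi> (convect (sol s) (sol s) \<xi>)"

lemma force_meas: "(\<lambda>s. force s \<xi>) \<in> borel_measurable borel"
  unfolding force_def by (rule forcing_meas[OF admissible_sol])

lemma force_le: "norm (force s \<xi>) \<le> 4 * A\<^sup>2 * C * w \<xi> * (norm \<xi>)\<^sup>2"
  unfolding force_def by (rule forcing_bound[OF admissible_sol])

text \<open>Splitting the heat kernel into \<open>exp (- t * k) * exp (s * k)\<close> with
  \<open>k = (norm \<xi>)^2\<close> leaves \<open>t\<close> only in a prefactor and in the upper
  limit of integration, where the fundamental theorem of calculus can act.\<close>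

lemma sol_eq:
  assumes t: "0 \<le> t"
  shows "set_integrable lborel {0..t} (\<lambda>s. exp (s * (norm \<xi>)\<^sup>2) *\<^sub>R force s \<xi>)"
    and "sol t \<xi> = exp (- t * (norm \<xi>)\<^sup>2) *\<^sub>R (c0 \<xi> - integral {0..t} (\<lambda>s. exp (s * (norm \<xi>)\<^sup>2) *\<^sub>R force s \<xi>))"
proof -
  let ?k = "(norm \<xi>)\<^sup>2"
  let ?B = "4 * A\<^sup>2 * C * w \<xi> * ?k"
  have iI: "integrable lborel (\<lambda>s. exp (t * ?k) * ?B * indicator {0..t} s)"
    using emeasure_compact_finite[of "{0..t}"] by (intro integrable_mult_right integrable_real_indicator) auto
  show si: "set_integrable lborel {0..t} (\<lambda>s. exp (s * ?k) *\<^sub>R force s \<xi>)"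
    unfolding set_integrable_def
  proof (rule integrable_dominated[OF iI])
    show "(\<lambda>s. indicator {0..t} s *\<^sub>R exp (s * ?k) *\<^sub>R force s \<xi>) \<in> borel_measurable borel"
      using force_meas by measurable
    show "norm (indicator {0..t} s *\<^sub>R exp (s * ?k) *\<^sub>R force s \<xi>) \<le> exp (t * ?k) * ?B * indicator {0..t} s" for s
    proof (cases "s \<in> {0..t}")
      case True
      then have "exp (s * ?k) \<le> exp (t * ?k)" by (simp add: mult_right_mono)
      from mult_mono[OF this force_le[of s \<xi>]] show ?thesis using True by simp
    qed simp
  qed
  have "sol t \<xi> = exp (- t * ?k) *\<^sub>R c0 \<xi> - duhamel sol t \<xi>"
    using sol_fixed_point[of t \<xi>] t unfolding step_def by (simp add: max_def)
  also have "duhamel sol t \<xi> = (\<integral>s. exp (- t * ?k) *\<^sub>R (indicator {0..t} s *\<^sub>R (exp (s * ?k) *\<^sub>R force s \<xi>)) \<partial>lborel)"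
  proof -
    have "exp (- (t - s) * ?k) = exp (- t * ?k) * exp (s * ?k)" for s
      unfolding exp_add[symmetric] by (simp add: algebra_simps)
    then show ?thesis unfolding duhamel_def force_def by (simp add: mult_ac)
  qed
  also have "\<dots> = exp (- t * ?k) *\<^sub>R integral {0..t} (\<lambda>s. exp (s * ?k) *\<^sub>R force s \<xi>)"
    unfolding integral_scaleR_right set_borel_integral_eq_integral(2)[OF si, symmetric] set_lebesgue_integral_def by simp
  finally show "sol t \<xi> = exp (- t * ?k) *\<^sub>R (c0 \<xi> - integral {0..t} (\<lambda>s. exp (s * ?k) *\<^sub>R force s \<xi>))"
    by (simp add: scaleR_diff_right)
qed

lemma sol_cont: "continuous_on {0..} (\<lambda>t. sol t \<xi>)"
proof (rule continuous_on_atLeast_from_Icc)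
  fix T :: real
  show "continuous_on {0..T} (\<lambda>t. sol t \<xi>)"
  proof (cases "0 \<le> T")
    case True
    have "(\<lambda>s. exp (s * (norm \<xi>)\<^sup>2) *\<^sub>R force s \<xi>) integrable_on {0..T}"
      by (rule set_borel_integral_eq_integral(1)[OF sol_eq(1)[OF True]])
    then have "continuous_on {0..T} (\<lambda>t. integral {0..t} (\<lambda>s. exp (s * (norm \<xi>)\<^sup>2) *\<^sub>R force s \<xi>))"
      by (rule indefinite_integral_continuous_1)
    then have "continuous_on {0..T} (\<lambda>t. exp (- t * (norm \<xi>)\<^sup>2) *\<^sub>R (c0 \<xi> - integral {0..t} (\<lambda>s. exp (s * (norm \<xi>)\<^sup>2) *\<^sub>R force s \<xi>)))"
      by (intro continuous_intros)
    then show ?thesis by (rule continuous_on_eq) (simp add: sol_eq(2))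
  qed simp
qed

text \<open>Regularity is gained in turn: the measurable fixed point is continuous in time as an
  indefinite integral, hence by dominated convergence its forcing is continuous, and hence the
  amplitude is differentiable at every positive time rather than almost every one.\<close>

lemma force_cont: "continuous_on {0..} (\<lambda>t. force t \<xi>)"
  unfolding continuous_on_sequentially comp_def
proof (intro allI ballI impI)
  fix r :: "nat \<Rightarrow> real" and s :: real assume s: "s \<in> {0..}" and r: "(\<forall>n. r n \<in> {0..}) \<and> r \<longlonglongrightarrow> s"
  note a = admissibleD[OF admissible_sol]
  have lim: "(\<lambda>n. sol (r n) \<eta>) \<longlonglongrightarrow> sol s \<eta>" for \<eta>
    by (rule continuous_on_tendsto_compose[OF sol_cont]) (use r s in auto)
  have "(\<lambda>n. convect (sol (r n)) (sol (r n)) \<xi>) \<longlonglongrightarrow> convect (sol s) (sol s) \<xi>"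
    unfolding convect_def
  proof (rule integral_dominated_convergence[OF _ _ integrable_mult_right[OF integrable_WW[of \<xi>], of "norm \<xi> * (2 * A) * (2 * A)"]])
    note m = slice_meas[OF a(1)]
    show "(\<lambda>\<eta>. (\<xi> \<bullet> sol s (\<xi> - \<eta>)) *\<^sub>R sol s \<eta>) \<in> borel_measurable lborel"
      using m[of s] by measurable
    show "(\<lambda>\<eta>. (\<xi> \<bullet> sol (r n) (\<xi> - \<eta>)) *\<^sub>R sol (r n) \<eta>) \<in> borel_measurable lborel" for n
      using m[of "r n"] by measurable
    show "AE \<eta> in lborel. (\<lambda>n. (\<xi> \<bullet> sol (r n) (\<xi> - \<eta>)) *\<^sub>R sol (r n) \<eta>) \<longlonglongrightarrow> (\<xi> \<bullet> sol s (\<xi> - \<eta>)) *\<^sub>R sol s \<eta>"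
      by (intro AE_I2 tendsto_intros lim)
    show "AE \<eta> in lborel. norm ((\<xi> \<bullet> sol (r n) (\<xi> - \<eta>)) *\<^sub>R sol (r n) \<eta>) \<le> norm \<xi> * (2 * A) * (2 * A) * (w (\<xi> - \<eta>) * w \<eta>)" for n
    proof (intro AE_I2)
      fix \<eta>
      have "\<bar>\<xi> \<bullet> sol (r n) (\<xi> - \<eta>)\<bar> \<le> norm \<xi> * (2 * A * w (\<xi> - \<eta>))"
        by (rule order_trans[OF Cauchy_Schwarz_ineq2 mult_left_mono[OF a(2)]]) simp
      from mult_mono[OF this a(2)[of "r n" \<eta>]] A0 W_nonneg[of "\<xi> - \<eta>"]
      show "norm ((\<xi> \<bullet> sol (r n) (\<xi> - \<eta>)) *\<^sub>R sol (r n) \<eta>) \<le> norm \<xi> * (2 * A) * (2 * A) * (w (\<xi> - \<eta>) * w \<eta>)"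
        by (simp add: mult_ac)
    qed
  qed
  then show "(\<lambda>n. force (r n) \<xi>) \<longlonglongrightarrow> force s \<xi>"
    unfolding force_def leray_proj_def divide_inverse by (intro tendsto_intros)
qed

lemma sol_ode:
  assumes t: "0 < t"
  shows "((\<lambda>t. sol t \<xi>) has_vector_derivative - (norm \<xi>)\<^sup>2 *\<^sub>R sol t \<xi> - force t \<xi>) (at t)"
proof -
  let ?k = "(norm \<xi>)\<^sup>2"
  define I where "I t = integral {0..t} (\<lambda>s. exp (s * ?k) *\<^sub>R force s \<xi>)" for t
  have "continuous_on {0..t + 1} (\<lambda>s. exp (s * ?k) *\<^sub>R force s \<xi>)"
    by (intro continuous_intros continuous_on_subset[OF force_cont]) auto
  from integral_has_vector_derivative[OF this, of t] t
  have "(I has_vector_derivative exp (t * ?k) *\<^sub>R force t \<xi>) (at t within {0..t + 1})"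
    unfolding I_def[abs_def] by simp
  then have I: "(I has_vector_derivative exp (t * ?k) *\<^sub>R force t \<xi>) (at t)"
    using at_within_Icc_at[of 0 t "t + 1"] t by simp
  have E: "((\<lambda>t. exp (- t * ?k)) has_vector_derivative - ?k * exp (- t * ?k)) (at t)"
    unfolding has_real_derivative_iff_has_vector_derivative[symmetric]
    by (auto intro!: derivative_eq_intros)
  have D: "((\<lambda>t. c0 \<xi> - I t) has_vector_derivative 0 - exp (t * ?k) *\<^sub>R force t \<xi>) (at t)"
    by (intro has_vector_derivative_diff has_vector_derivative_const I)
  have "((\<lambda>t. exp (- t * ?k) *\<^sub>R (c0 \<xi> - I t)) has_vector_derivative
     exp (- t * ?k) *\<^sub>R (0 - exp (t * ?k) *\<^sub>R force t \<xi>) + (- ?k * exp (- t * ?k)) *\<^sub>R (c0 \<xi> - I t)) (at t)"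
    using bounded_bilinear.has_vector_derivative[OF bounded_bilinear_scaleR E D] .
  moreover have "exp (- t * ?k) *\<^sub>R (0 - exp (t * ?k) *\<^sub>R force t \<xi>) + (- ?k * exp (- t * ?k)) *\<^sub>R (c0 \<xi> - I t)
      = - ?k *\<^sub>R sol t \<xi> - force t \<xi>"
  proof -
    have 1: "exp (- t * ?k) * exp (t * ?k) = 1"
      unfolding exp_add[symmetric] by simp
    have 2: "exp (- t * ?k) *\<^sub>R (c0 \<xi> - I t) = sol t \<xi>"
      unfolding I_def using t by (intro sol_eq(2)[symmetric]) simp
    have "exp (- t * ?k) *\<^sub>R (0 - exp (t * ?k) *\<^sub>R force t \<xi>) + (- ?k * exp (- t * ?k)) *\<^sub>R (c0 \<xi> - I t)
       = - ((exp (- t * ?k) * exp (t * ?k)) *\<^sub>R force t \<xi>) + (- ?k) *\<^sub>R (exp (- t * ?k) *\<^sub>R (c0 \<xi> - I t))"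
      by (simp only: scaleR_scaleR scaleR_minus_right diff_0)
    then show ?thesis unfolding 1 2 by (simp only: scaleR_one uminus_add_conv_diff add.commute)
  qed
  ultimately have "((\<lambda>t. exp (- t * ?k) *\<^sub>R (c0 \<xi> - I t)) has_vector_derivative - ?k *\<^sub>R sol t \<xi> - force t \<xi>) (at t)"
    by simp
  then show ?thesis
    by (rule has_vector_derivative_transform_within_open[where S = "{0<..}"])
       (use t in \<open>auto simp: sol_eq(2) I_def\<close>)
qed

lemma envelope_scaled: "envelope (\<lambda>\<xi>. 2 * A * w \<xi>)"
proof
  show "integrable lborel (\<lambda>\<xi>. norm \<xi> * (2 * A * w \<xi>))"
    using integrable_mult_right[OF W_int1, of "2 * A"] by (simp add: mult_ac)
  show "integrable lborel (\<lambda>\<xi>. (2 * A * w \<xi>)\<^sup>2)"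
    using integrable_mult_right[OF W_sq, of "(2 * A)\<^sup>2"] by (simp add: power_mult_distrib)
  show "integrable lborel (\<lambda>\<xi>. (norm \<xi> * (2 * A * w \<xi>))\<^sup>2)"
    using integrable_mult_right[OF W_sq1, of "(2 * A)\<^sup>2"] by (simp add: power_mult_distrib mult_ac)
qed (use W_int A0 W_nonneg in auto)

lemma frequency_solution_sol: "frequency_solution (\<lambda>\<xi>. 2 * A * w \<xi>) sol"
proof -
  interpret E: envelope "\<lambda>\<xi>. 2 * A * w \<xi>" by (rule envelope_scaled)
  show ?thesis
    by unfold_locales
       (use admissibleD[OF admissible_sol] sol_cont sol_ode in \<open>auto simp: force_def\<close>)
qed

lemma sol_0: "sol 0 \<xi> = c0 \<xi>"
  using sol_eq(2)[of 0 \<xi>] by simp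

text \<open>The Duhamel term is quadratic in the size of the data. This comparison transfers the
  slow decay of a low-frequency heat flow to the nonlinear solution.\<close>

lemma sol_heat_diff:
  assumes "0 \<le> t"
  shows "norm (sol t \<xi> - exp (- t * (norm \<xi>)\<^sup>2) *\<^sub>R c0 \<xi>) \<le> 4 * A\<^sup>2 * C * w \<xi>"
proof -
  have m: "max t 0 = t" using assms by simp
  have "sol t \<xi> = exp (- t * (norm \<xi>)\<^sup>2) *\<^sub>R c0 \<xi> - duhamel sol t \<xi>"
    using sol_fixed_point[of t \<xi>] unfolding step_def m by simp
  then show ?thesis using norm_duhamel_le[OF admissible_sol, of t \<xi>] by simp
qed

end


section \<open>Rotating vortices in the plane\<close>

text \<open>In the plane of the axes \<open>a\<close> and \<open>b\<close> this is rotation by a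
  right angle; other coordinates are projected out. Being odd and orthogonal to its argument, it
  supplies odd divergence-free amplitudes in two and in three dimensions.\<close>

definition rot :: "'n \<Rightarrow> 'n \<Rightarrow> real^'n \<Rightarrow> real^'n::finite" where
  "rot a b x = x $ a *\<^sub>R axis b 1 - x $ b *\<^sub>R axis a 1"

lemma inner_rot: "x \<bullet> rot a b x = 0"
  by (simp add: rot_def inner_diff_right inner_axis)

lemma inner_rot_skew: "x \<bullet> rot a b y = - (rot a b x \<bullet> y)"
  by (simp add: rot_def inner_diff_right inner_diff_left inner_axis inner_axis' mult.commute)

lemma rot_minus: "rot a b (- x) = - rot a b x"
  by (simp add: rot_def)

lemma rot_diff: "rot a b (x - y) = rot a b x - rot a b y"
  by (simp add: rot_def scaleR_diff_left)

lemma rot_scaleR: "rot a b (r *\<^sub>R x) = r *\<^sub>R rot a b x"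
  by (simp add: rot_def scaleR_diff_right)

lemma norm_rot_power2:
  assumes "a \<noteq> b"
  shows "(norm (rot a b x))\<^sup>2 = (x $ a)\<^sup>2 + (x $ b)\<^sup>2"
  using assms unfolding power2_norm_eq_inner rot_def
  by (simp add: inner_diff_left inner_diff_right inner_axis_axis power2_eq_square)

lemma norm_rot_le:
  assumes "a \<noteq> b"
  shows "norm (rot a b x) \<le> norm x"
proof (rule power2_le_imp_le)
  have "(x $ a)\<^sup>2 + (x $ b)\<^sup>2 = (\<Sum>i\<in>{a, b}. (norm (x $ i))\<^sup>2)" using assms by simp
  also have "\<dots> \<le> (norm x)\<^sup>2" unfolding norm_vec_power2 by (rule sum_mono2) auto
  finally show "(norm (rot a b x))\<^sup>2 \<le> (norm x)\<^sup>2" unfolding norm_rot_power2[OF assms] .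
qed simp

lemma rot_meas: "rot a b \<in> borel_measurable borel"
  unfolding rot_def[abs_def] using borel_measurable_nth_id[of a] borel_measurable_nth_id[of b] by measurable

lemma AE_nth_neq_0: "AE x in (lborel :: (real^'n::finite) measure). x $ i \<noteq> 0"
proof -
  have "negligible {x :: real^'n. axis i 1 \<bullet> x = 0}"
    by (rule negligible_hyperplane) (simp add: axis_eq_0_iff)
  then have "{x :: real^'n. x $ i = 0} \<in> null_sets lebesgue"
    by (simp add: negligible_iff_null_sets inner_axis')
  from AE_not_in[OF this] show ?thesis unfolding AE_completion_iff by simp
qed

text \<open>Amplitudes built from \<open>rot a b\<close> have zeros where the coordinates
  \<open>a\<close> and \<open>b\<close> both vanish. Positivity off a hyperplane, a null set, still
  gives positive energy.\<close>

lemma integral_pos_of_pos_off_hyperplane: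
  fixes f :: "real^'n::finite \<Rightarrow> real"
  assumes f: "integrable lborel f" and nn: "\<And>x. 0 \<le> f x" and pos: "\<And>x. x $ i \<noteq> 0 \<Longrightarrow> 0 < f x"
  shows "0 < integral\<^sup>L lborel f"
proof (rule ccontr)
  assume "\<not> 0 < integral\<^sup>L lborel f"
  moreover have "0 \<le> integral\<^sup>L lborel f" using nn by simp
  ultimately have "integral\<^sup>L lborel f = 0" by linarith
  then have "AE x in lborel. f x = 0"
    using integral_nonneg_eq_0_iff_AE[OF f] nn by simp
  with AE_nth_neq_0[of i] have "AE x in (lborel :: (real^'n) measure). False"
    by eventually_elim (use pos in force)
  then show False by (simp add: AE_iff_measurable[OF _ refl])
qed

lemma Basis_vec_eq: "(Basis :: (real^'n::finite) set) = range (\<lambda>i. axis i 1)"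
  by (auto simp: Basis_vec_def)

text \<open>Lebesgue measure is determined by boxes, and a right angle takes boxes to boxes: in the
  preimage the two side intervals are exchanged and one is reflected, which explains
  \<open>l'\<close> and \<open>u'\<close>.\<close>

lemma lborel_distr_rot:
  fixes a b :: "'n::finite"
  assumes ab: "a \<noteq> b" and U: "UNIV = {a, b}"
  shows "lborel = distr lborel borel (rot a b)"
proof (rule lborel_eqI)
  have B: "(Basis :: (real^'n) set) = {axis a 1, axis b 1}" unfolding Basis_vec_eq U by simp
  have ne: "axis a 1 \<noteq> (axis b 1 :: real^'n)" using ab by (simp add: axis_eq_axis)
  have ax: "axis a (1::real) $ a = 1" "axis a (1::real) $ b = 0" "axis b (1::real) $ a = 0" "axis b (1::real) $ b = 1"
    using ab by (auto simp: axis_def)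
  fix l u :: "real^'n" assume lu: "\<And>e. e \<in> Basis \<Longrightarrow> l \<bullet> e \<le> u \<bullet> e"
  define l' where "l' = l $ b *\<^sub>R axis a 1 - u $ a *\<^sub>R (axis b 1 :: real^'n)"
  define u' where "u' = u $ b *\<^sub>R axis a 1 - l $ a *\<^sub>R (axis b 1 :: real^'n)"
  have pre: "rot a b -` box l u = box l' u'"
    by (auto simp: mem_box B rot_def l'_def u'_def inner_axis ax)
  have "emeasure (distr lborel borel (rot a b)) (box l u) = emeasure lborel (box l' u')"
    using rot_meas[of a b] by (subst emeasure_distr) (auto simp: pre)
  also have "\<dots> = (\<Prod>e\<in>Basis. (u' - l') \<bullet> e)"
    by (rule emeasure_lborel_box)
       (use lu[of "axis a 1"] lu[of "axis b 1"] in \<open>auto simp: B l'_def u'_def inner_axis ax\<close>)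
  also have "\<dots> = (\<Prod>e\<in>Basis. (u - l) \<bullet> e)"
    using ne by (simp add: B l'_def u'_def inner_axis ax mult.commute)
  finally show "emeasure (distr lborel borel (rot a b)) (box l u) = (\<Prod>e\<in>Basis. (u - l) \<bullet> e)" .
qed simp

section \<open>Gaussian envelopes\<close>

lemma gaussian_integrable:
  assumes s: "0 < s"
  shows "integrable lborel (\<lambda>x::'a::euclidean_space. exp (- s * (norm x)\<^sup>2))"
proof -
  have "integrable lborel (\<lambda>x::'a. gauss (0 + sqrt (2 * s) *\<^sub>R x))"
    using lborel_integrable_affine_iff[of gauss "sqrt (2 * s)" "0::'a"] gauss_measurable[where 'a = 'a]
      gauss_integral(1)[where 'a = 'a] s by simp
  then show ?thesis using s by (simp add: gauss_def power_mult_distrib mult_ac)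
qed

lemma poly_gaussian_integrable:
  assumes s: "0 < s"
  shows "integrable lborel (\<lambda>x::'a::euclidean_space. (1 + (norm x)\<^sup>2)\<^sup>2 * exp (- s * (norm x)\<^sup>2))"
proof -
  \<comment> \<open>Chosen such that \<open>1 + y \<le> K * exp (s * y / 4)\<close>. Squaring then
    uses up \<open>exp (s * y / 2)\<close>, half of the Gaussian.\<close>
  define K where "K = max 1 (4 / s)"
  have K: "1 \<le> K" "4 / s \<le> K" by (auto simp: K_def)
  have le: "(1 + y)\<^sup>2 * exp (- s * y) \<le> K\<^sup>2 * exp (- (s / 2) * y)" if y: "0 \<le> y" for y :: real
  proof -
    have "y = (4 / s) * (s * y / 4)" using s by simp
    also have "\<dots> \<le> K * (s * y / 4)" using K y s by (intro mult_right_mono) auto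
    finally have "1 + y \<le> K * (1 + s * y / 4)" using K by (simp add: algebra_simps)
    also have "\<dots> \<le> K * exp (s * y / 4)" using K by (intro mult_left_mono exp_ge_add_one_self) auto
    finally have "(1 + y)\<^sup>2 \<le> (K * exp (s * y / 4))\<^sup>2" using y by (intro power_mono) auto
    also have "\<dots> = K\<^sup>2 * exp (s * y / 2)" by (simp add: power_mult_distrib flip: exp_double)
    finally have "(1 + y)\<^sup>2 * exp (- s * y) \<le> K\<^sup>2 * exp (s * y / 2) * exp (- s * y)" by (rule mult_right_mono) simp
    also have "\<dots> = K\<^sup>2 * exp (- (s / 2) * y)" by (simp add: mult.assoc flip: exp_add)
    finally show ?thesis .
  qed
  have i: "integrable lborel (\<lambda>x::'a. K\<^sup>2 * exp (- (s / 2) * (norm x)\<^sup>2))"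
    by (intro integrable_mult_right gaussian_integrable) (use s in simp)
  show ?thesis
  proof (rule integrable_dominated[OF i])
    show "norm ((1 + (norm x)\<^sup>2)\<^sup>2 * exp (- s * (norm x)\<^sup>2)) \<le> K\<^sup>2 * exp (- (s / 2) * (norm x)\<^sup>2)" for x :: 'a
      using le[of "(norm x)\<^sup>2"] by (simp only: real_norm_def abs_mult abs_power2 abs_exp_cancel zero_le_power2)
  qed measurable
qed

lemma norm_le_poly: "norm x \<le> (1 + (norm x)\<^sup>2)\<^sup>2" "(norm x)\<^sup>2 \<le> (1 + (norm x)\<^sup>2)\<^sup>2" "norm x * (norm x)\<^sup>2 \<le> (1 + (norm x)\<^sup>2)\<^sup>2"
  "(norm x)\<^sup>2 * (norm x)\<^sup>2 \<le> (1 + (norm x)\<^sup>2)\<^sup>2" for x :: "'a::real_normed_vector"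
proof -
  define r where "r = norm x"
  have r: "0 \<le> r" by (simp add: r_def)
  have "0 \<le> (r - 1)\<^sup>2" by simp
  then have "2 * r \<le> 1 + r\<^sup>2" by (simp add: power2_eq_square algebra_simps)
  moreover have "(1 + r\<^sup>2)\<^sup>2 = 1 + 2 * r\<^sup>2 + r\<^sup>2 * r\<^sup>2" by (simp add: power2_eq_square algebra_simps)
  moreover have "r * r\<^sup>2 \<le> r\<^sup>2 + r\<^sup>2 * r\<^sup>2"
  proof -
    have "0 \<le> r\<^sup>2 * (1 - r + r\<^sup>2)"
      using \<open>2 * r \<le> 1 + r\<^sup>2\<close> r by (intro mult_nonneg_nonneg) auto
    then show ?thesis by (simp add: power2_eq_square algebra_simps)
  qed
  moreover have "0 \<le> r\<^sup>2" "0 \<le> r\<^sup>2 * r\<^sup>2" by auto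
  ultimately have "r \<le> (1 + r\<^sup>2)\<^sup>2 \<and> r\<^sup>2 \<le> (1 + r\<^sup>2)\<^sup>2 \<and> r * r\<^sup>2 \<le> (1 + r\<^sup>2)\<^sup>2 \<and> r\<^sup>2 * r\<^sup>2 \<le> (1 + r\<^sup>2)\<^sup>2"
    using r by linarith
  then show "norm x \<le> (1 + (norm x)\<^sup>2)\<^sup>2" "(norm x)\<^sup>2 \<le> (1 + (norm x)\<^sup>2)\<^sup>2" "norm x * (norm x)\<^sup>2 \<le> (1 + (norm x)\<^sup>2)\<^sup>2"
    "(norm x)\<^sup>2 * (norm x)\<^sup>2 \<le> (1 + (norm x)\<^sup>2)\<^sup>2"
    by (auto simp: r_def)
qed

text \<open>Up to sign, its sine transform is the rotated gradient of a Gaussian stream function.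
  Heat flow over a time \<open>r\<close> replaces \<open>s\<close> by \<open>s + r\<close>, so the
  family is closed under it.\<close>

definition vortex :: "'n \<Rightarrow> 'n \<Rightarrow> real \<Rightarrow> real \<Rightarrow> real^'n \<Rightarrow> real^'n::finite" where
  "vortex a b \<kappa> s \<xi> = (\<kappa> * exp (- s * (norm \<xi>)\<^sup>2)) *\<^sub>R rot a b \<xi>"

lemma vortex_meas: "vortex a b \<kappa> s \<in> borel_measurable borel"
  unfolding vortex_def[abs_def] using rot_meas[of a b] by measurable

lemma envelope_vortex:
  assumes ab: "a \<noteq> b" and s: "0 < s"
  shows "envelope (\<lambda>\<xi>. norm (vortex a b \<kappa> s \<xi>))"
proof -
  note [measurable] = vortex_meas[of a b \<kappa> s]
  let ?P = "\<lambda>s x :: real^'n. (1 + (norm x)\<^sup>2)\<^sup>2 * exp (- s * (norm x)\<^sup>2)"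
  have i1: "integrable lborel (\<lambda>x. \<bar>\<kappa>\<bar> * ?P s x)"
    by (intro integrable_mult_right poly_gaussian_integrable s)
  have i2: "integrable lborel (\<lambda>x. \<kappa>\<^sup>2 * ?P (2 * s) x)"
    by (intro integrable_mult_right poly_gaussian_integrable) (use s in simp)
  have n: "norm (vortex a b \<kappa> s \<xi>) \<le> \<bar>\<kappa>\<bar> * (norm \<xi> * exp (- s * (norm \<xi>)\<^sup>2))" for \<xi>
    using norm_rot_le[OF ab, of \<xi>] by (simp add: vortex_def abs_mult mult_ac mult_left_mono)
  have sq: "(\<bar>\<kappa>\<bar> * (norm \<xi> * exp (- s * (norm \<xi>)\<^sup>2)))\<^sup>2 = \<kappa>\<^sup>2 * ((norm \<xi>)\<^sup>2 * exp (- (2 * s) * (norm \<xi>)\<^sup>2))" for \<xi> :: "real^'n"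
    by (simp add: power_mult_distrib mult_ac flip: exp_double)
  have n2: "(norm (vortex a b \<kappa> s \<xi>))\<^sup>2 \<le> \<kappa>\<^sup>2 * ((norm \<xi>)\<^sup>2 * exp (- (2 * s) * (norm \<xi>)\<^sup>2))" for \<xi>
    using power_mono[OF n[of \<xi>] norm_ge_zero, of 2] unfolding sq .
  show ?thesis
  proof
    show "integrable lborel (\<lambda>\<xi>. norm (vortex a b \<kappa> s \<xi>))"
    proof (rule integrable_dominated[OF i1])
      show "norm (norm (vortex a b \<kappa> s \<xi>)) \<le> \<bar>\<kappa>\<bar> * ?P s \<xi>" for \<xi>
        using order_trans[OF n mult_left_mono[OF mult_right_mono[OF norm_le_poly(1)[of \<xi>]]]] by simp
    qed measurable
    show "integrable lborel (\<lambda>\<xi>. norm \<xi> * norm (vortex a b \<kappa> s \<xi>))"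
    proof (rule integrable_dominated[OF i1])
      show "norm (norm \<xi> * norm (vortex a b \<kappa> s \<xi>)) \<le> \<bar>\<kappa>\<bar> * ?P s \<xi>" for \<xi>
      proof -
        have "norm \<xi> * norm (vortex a b \<kappa> s \<xi>) \<le> norm \<xi> * (\<bar>\<kappa>\<bar> * (norm \<xi> * exp (- s * (norm \<xi>)\<^sup>2)))"
          by (intro mult_left_mono n) simp
        also have "\<dots> = \<bar>\<kappa>\<bar> * ((norm \<xi>)\<^sup>2 * exp (- s * (norm \<xi>)\<^sup>2))" by (simp add: power2_eq_square mult_ac)
        also have "\<dots> \<le> \<bar>\<kappa>\<bar> * ?P s \<xi>" by (intro mult_left_mono mult_right_mono norm_le_poly) auto
        finally show ?thesis by simp
      qed
    qed measurable
    show "integrable lborel (\<lambda>\<xi>. (norm (vortex a b \<kappa> s \<xi>))\<^sup>2)"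
    proof (rule integrable_dominated[OF i2])
      show "norm ((norm (vortex a b \<kappa> s \<xi>))\<^sup>2) \<le> \<kappa>\<^sup>2 * ?P (2 * s) \<xi>" for \<xi>
        using order_trans[OF n2 mult_left_mono[OF mult_right_mono[OF norm_le_poly(2)[of \<xi>]]]] by simp
    qed measurable
    show "integrable lborel (\<lambda>\<xi>. (norm \<xi> * norm (vortex a b \<kappa> s \<xi>))\<^sup>2)"
    proof (rule integrable_dominated[OF i2])
      show "norm ((norm \<xi> * norm (vortex a b \<kappa> s \<xi>))\<^sup>2) \<le> \<kappa>\<^sup>2 * ?P (2 * s) \<xi>" for \<xi>
      proof -
        have "(norm \<xi>)\<^sup>2 * (norm (vortex a b \<kappa> s \<xi>))\<^sup>2 \<le> (norm \<xi>)\<^sup>2 * (\<kappa>\<^sup>2 * ((norm \<xi>)\<^sup>2 * exp (- (2 * s) * (norm \<xi>)\<^sup>2)))"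
          by (intro mult_left_mono n2) simp
        also have "\<dots> = \<kappa>\<^sup>2 * ((norm \<xi>)\<^sup>2 * (norm \<xi>)\<^sup>2 * exp (- (2 * s) * (norm \<xi>)\<^sup>2))" by (simp add: mult_ac)
        also have "\<dots> \<le> \<kappa>\<^sup>2 * ?P (2 * s) \<xi>" by (intro mult_left_mono mult_right_mono norm_le_poly) auto
        finally show ?thesis by (simp add: power_mult_distrib)
      qed
    qed measurable
  qed auto
qed

text \<open>After centring at \<open>\<xi> / 2\<close>, the component of the nonlinearity along \<open>rot a b \<xi>\<close> is the integral
  of a function that changes sign under the rotation by a right angle.\<close>

lemma vortex_stationary:
  fixes a b :: "'n::finite"
  assumes ab: "a \<noteq> b" and U: "UNIV = {a, b}" and s: "0 < s"
  shows "leray_proj \<xi> (convect (vortex a b \<kappa> s) (vortex a b \<kappa> s) \<xi>) = 0"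
proof -
  let ?v = "vortex a b \<kappa> s" and ?J = "rot a b"
  interpret envelope "\<lambda>\<xi>. norm (?v \<xi>)" by (rule envelope_vortex[OF ab s])
  have in2: "x \<bullet> y = x $ a * y $ a + x $ b * y $ b" for x y :: "real^'n"
    using ab by (simp add: inner_vec_def U)
  have JJ: "?J (?J x) = - x" for x
    using ab by (simp add: vec_eq_iff rot_def axis_def) (metis U UNIV_I insertE singletonD)
  have Jin: "?J x \<bullet> ?J y = x \<bullet> y" for x y
    using inner_rot_skew[of "?J x" a b y] by (simp add: JJ)
  have Jn: "norm (?J x) = norm x" for x by (simp add: norm_eq_sqrt_inner Jin)
  define F where "F \<eta> = \<kappa>\<^sup>2 * exp (- s * ((norm \<xi>)\<^sup>2 / 2 + 2 * (norm \<eta>)\<^sup>2)) * (- (\<xi> \<bullet> ?J \<eta>)) * ((\<xi> \<bullet> \<xi>) / 2)" for \<eta>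
  define H where "H \<eta> = \<kappa>\<^sup>2 * exp (- s * ((norm \<xi>)\<^sup>2 / 2 + 2 * (norm \<eta>)\<^sup>2)) * (- (\<xi> \<bullet> ?J \<eta>)) * (\<eta> \<bullet> \<xi>)" for \<eta>
  define G where "G \<eta> = (\<xi> \<bullet> ?v (\<xi> - \<eta>)) * (?v \<eta> \<bullet> ?J \<xi>)" for \<eta>
  have [measurable]: "?J \<in> borel_measurable borel" "?v \<in> borel_measurable borel"
    by (rule rot_meas vortex_meas)+
  have Fm: "F \<in> borel_measurable borel" unfolding F_def[abs_def] by measurable
  have Hm: "H \<in> borel_measurable borel" unfolding H_def[abs_def] by measurable
  have Gm: "G \<in> borel_measurable borel" unfolding G_def[abs_def] by measurable
  have GFH: "G ((1/2) *\<^sub>R \<xi> + \<eta>) = F \<eta> + H \<eta>" for \<eta>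
  proof -
    define h where "h = (1/2) *\<^sub>R \<xi>"
    have hh: "\<xi> - (h + \<eta>) = h - \<eta>" "\<xi> = 2 *\<^sub>R h" by (auto simp: h_def algebra_simps simp flip: scaleR_add_left)
    have e: "exp (- s * (norm (h - \<eta>))\<^sup>2) * exp (- s * (norm (h + \<eta>))\<^sup>2) = exp (- s * ((norm \<xi>)\<^sup>2 / 2 + 2 * (norm \<eta>)\<^sup>2))"
      unfolding exp_add[symmetric] hh(2)
      by (simp add: power2_norm_eq_inner inner_add_left inner_add_right inner_diff_left inner_diff_right algebra_simps inner_commute)
    have "G (h + \<eta>) = \<kappa>\<^sup>2 * (exp (- s * (norm (h - \<eta>))\<^sup>2) * exp (- s * (norm (h + \<eta>))\<^sup>2)) * (\<xi> \<bullet> ?J (h - \<eta>)) * (?J (h + \<eta>) \<bullet> ?J \<xi>)"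
      unfolding G_def vortex_def hh(1) by (simp add: power2_eq_square mult_ac)
    also have "\<xi> \<bullet> ?J (h - \<eta>) = - (\<xi> \<bullet> ?J \<eta>)"
      unfolding h_def by (simp add: rot_diff rot_scaleR inner_diff_right inner_rot)
    also have "?J (h + \<eta>) \<bullet> ?J \<xi> = (\<xi> \<bullet> \<xi>) / 2 + \<eta> \<bullet> \<xi>"
      unfolding Jin h_def by (simp add: inner_add_left)
    finally show ?thesis unfolding e F_def H_def h_def[symmetric] by (simp add: distrib_left)
  qed
  have iG: "integrable lborel G"
  proof -
    have "integrable lborel (\<lambda>\<eta>. ((\<xi> \<bullet> ?v (\<xi> - \<eta>)) *\<^sub>R ?v \<eta>) \<bullet> ?J \<xi>)"
      by (intro integrable_inner_left convect_integrable(1)[where \<alpha> = 1 and \<beta> = 1]) auto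
    then show ?thesis unfolding G_def by simp
  qed
  have Fodd: "F (- \<eta>) = - F \<eta>" and Heven: "H (- \<eta>) = H \<eta>" for \<eta>
    by (simp_all add: F_def H_def rot_minus)
  have iGs: "integrable lborel (\<lambda>\<eta>. F \<eta> + H \<eta>)"
    using lborel_integral_translate(2)[OF Gm, of "(1/2) *\<^sub>R \<xi>"] iG by (simp add: GFH)
  \<comment> \<open>At first only the sum of \<open>F\<close> and \<open>H\<close> is known to be
    integrable, from \<open>G\<close>. Reflection and parity add \<open>- F + H\<close>, and half
    the sum of the two recovers \<open>H\<close>.\<close>
  have iGs': "integrable lborel (\<lambda>\<eta>. - F \<eta> + H \<eta>)"
    using lborel_integral_reflect(2)[of "\<lambda>\<eta>. F \<eta> + H \<eta>" 0] iGs Fm Hm by (simp add: Fodd Heven)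
  have iH: "integrable lborel H"
  proof -
    have "integrable lborel (\<lambda>\<eta>. ((F \<eta> + H \<eta>) + (- F \<eta> + H \<eta>)) / 2)"
      by (intro integrable_divide_zero Bochner_Integration.integrable_add[OF iGs iGs'])
    then show ?thesis by simp
  qed
  have iF: "integrable lborel F"
    using Bochner_Integration.integrable_diff[OF iGs iH] by simp
  have HJ: "H (?J \<eta>) = - H \<eta>" for \<eta>
  proof -
    have "?J \<eta> \<bullet> \<xi> = \<xi> \<bullet> ?J \<eta>" by (rule inner_commute)
    then show ?thesis unfolding H_def Jn JJ by (simp add: inner_commute mult_ac)
  qed
  have H0: "integral\<^sup>L lborel H = 0"
  proof -
    have "integral\<^sup>L lborel H = integral\<^sup>L (distr lborel borel ?J) H"
      by (subst lborel_distr_rot[OF ab U]) (rule refl)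
    also have "\<dots> = - integral\<^sup>L lborel H"
      using Hm by (subst integral_distr) (auto simp: HJ)
    finally show ?thesis by simp
  qed
  have "convect ?v ?v \<xi> \<bullet> ?J \<xi> = integral\<^sup>L lborel G"
  proof -
    have "convect ?v ?v \<xi> \<bullet> ?J \<xi> = (\<integral>\<eta>. ((\<xi> \<bullet> ?v (\<xi> - \<eta>)) *\<^sub>R ?v \<eta>) \<bullet> ?J \<xi> \<partial>lborel)"
      unfolding convect_def
      by (rule integral_inner_left[symmetric]) (intro convect_integrable(1)[where \<alpha> = 1 and \<beta> = 1], auto)
    then show ?thesis unfolding G_def by simp
  qed
  also have "\<dots> = (\<integral>\<eta>. F \<eta> + H \<eta> \<partial>lborel)"
    using lborel_integral_translate(1)[OF Gm, of "(1/2) *\<^sub>R \<xi>"] by (simp add: GFH)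
  also have "\<dots> = 0"
    using iF iH H0 integral_odd_eq_0[OF Fm Fodd] by simp
  finally have perp: "convect ?v ?v \<xi> \<bullet> ?J \<xi> = 0" .
  define z where "z = leray_proj \<xi> (convect ?v ?v \<xi>)"
  show ?thesis
  proof (cases "\<xi> = 0")
    case True
    then show ?thesis by (simp add: leray_proj_def convect_def)
  next
    case False
    have 1: "z \<bullet> \<xi> = 0" unfolding z_def using inner_leray_proj by (simp add: inner_commute)
    have 2: "z \<bullet> ?J \<xi> = 0"
      unfolding z_def leray_proj_def using perp inner_rot[of \<xi> a b] by (simp add: inner_diff_left)
    have J: "?J \<xi> $ a = - \<xi> $ b" "?J \<xi> $ b = \<xi> $ a" using ab by (auto simp: rot_def axis_def)
    \<comment> \<open>In the plane \<open>\<xi>\<close> and its rotation form an orthogonal basis;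
      by this Lagrange identity a vector orthogonal to both is zero.\<close>
    have "(z \<bullet> \<xi>)\<^sup>2 + (z \<bullet> ?J \<xi>)\<^sup>2 = (z \<bullet> z) * (\<xi> \<bullet> \<xi>)"
      unfolding in2 J by (simp add: power2_eq_square algebra_simps)
    then show ?thesis using 1 2 False unfolding z_def[symmetric] by simp
  qed
qed

text \<open>The data may change with \<open>t\<close>, but their norm has to be exactly
  \<open>\<beta>\<close>, since this is the argument at which \<open>G\<close> is evaluated.\<close>

definition decay_counterexample :: "real \<Rightarrow> real \<Rightarrow> (real^'n \<Rightarrow> real^'n::finite) \<Rightarrow> (real \<Rightarrow> real^'n \<Rightarrow> real^'n) \<Rightarrow> bool" where
  "decay_counterexample \<beta> t u0 u \<longleftrightarrow> u0 \<in> L2 \<and> div_free u0 \<and> (\<forall>\<delta>. mhd_solution \<delta> u0 (\<lambda>_. 0) u (\<lambda>_ _. 0)) \<and>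
     L2_norm u0 = \<beta> \<and> \<beta> / 2 \<le> L2_norm (u t)"

lemma (in frequency_solution) decay_counterexampleI:
  assumes b: "0 \<le> b" and E0: "(\<integral>\<xi>. (norm (c 0 \<xi>))\<^sup>2 \<partial>lborel) = b\<^sup>2" and Et: "b\<^sup>2 / 4 \<le> (\<integral>\<xi>. (norm (c t \<xi>))\<^sup>2 \<partial>lborel)"
  shows "decay_counterexample (gauss_mass TYPE(real^'n) * b) t (sin_vec (c 0)) (\<lambda>t. sin_vec (c t))"
proof -
  let ?Z = "gauss_mass TYPE(real^'n)"
  have Z: "0 \<le> ?Z" using gauss_mass_pos[where 'a = "real^'n"] by simp
  have nn: "0 \<le> L2_norm f" for f :: "real^'n \<Rightarrow> real^'n" by (simp add: L2_norm_def)
  have "(L2_norm (sin_vec (c 0)))\<^sup>2 = (?Z * b)\<^sup>2"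
    unfolding L2_norm_u E0 by (simp add: power_mult_distrib)
  then have 1: "L2_norm (sin_vec (c 0)) = ?Z * b"
    by (rule power2_eq_imp_eq[OF _ nn mult_nonneg_nonneg[OF Z b]])
  have 2: "?Z * b / 2 \<le> L2_norm (sin_vec (c t))"
  proof (rule power2_le_imp_le[OF _ nn])
    have "(?Z * b / 2)\<^sup>2 = ?Z\<^sup>2 * (b\<^sup>2 / 4)" by (simp add: power_mult_distrib power_divide)
    also have "\<dots> \<le> (L2_norm (sin_vec (c t)))\<^sup>2"
      unfolding L2_norm_u using Et by (intro mult_left_mono) auto
    finally show "(?Z * b / 2)\<^sup>2 \<le> (L2_norm (sin_vec (c t)))\<^sup>2" .
  qed
  show ?thesis
    unfolding decay_counterexample_def using 1 2
    by (intro conjI allI u_in_L2 u_div_free mhd_solution_sin_vec)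
qed

text \<open>The initial width is tuned to the time: a vortex with parameter \<open>t\<close> at the
  start has parameter \<open>2 * t\<close> at time \<open>t\<close>. In the plane its energy is
  proportional to the inverse square of the parameter, so whatever \<open>t\<close> is, the norm is
  exactly halved at that moment.\<close>

lemma decay_counterexample_plane:
  fixes a b :: "'n::finite"
  assumes ab: "a \<noteq> b" and U: "UNIV = {a, b}" and t: "0 < t"
  shows "\<exists>(u0 :: real^'n \<Rightarrow> real^'n) u. decay_counterexample (gauss_mass TYPE(real^'n)) t u0 u"
proof -
  define I where "I s = (\<integral>\<xi>. (norm (vortex a b 1 s \<xi>))\<^sup>2 \<partial>lborel)" for s
  have dim: "DIM(real^'n) = 2"
  proof -
    have "CARD('n) = 2" unfolding U using ab by simp
    then show ?thesis by simp
  qed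
  have I_pos: "0 < I t"
    unfolding I_def
  proof (rule integral_pos_of_pos_off_hyperplane[where i = a])
    interpret envelope "\<lambda>\<xi>. norm (vortex a b 1 t \<xi>)" by (rule envelope_vortex[OF ab t])
    show "integrable lborel (\<lambda>\<xi>. (norm (vortex a b 1 t \<xi>))\<^sup>2)" by (rule W_sq)
    show "0 < (norm (vortex a b 1 t x))\<^sup>2" if "x $ a \<noteq> 0" for x
    proof -
      have "0 < (norm (rot a b x))\<^sup>2"
        unfolding norm_rot_power2[OF ab] using that by (simp add: add_pos_nonneg)
      then show ?thesis by (simp add: vortex_def)
    qed
  qed simp
  \<comment> \<open>Rescaling \<open>\<xi>\<close> by \<open>1 / sqrt 2\<close> gives one half as
    the Jacobian in two dimensions and one half from the square of the linear factor
    \<open>rot\<close>.\<close>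
  have I_scale: "I (2 * t) = I t / 4"
  proof -
    have e: "(norm (vortex a b 1 (2 * t) (0 + (1 / sqrt 2) *\<^sub>R \<xi>)))\<^sup>2 = (norm (vortex a b 1 t \<xi>))\<^sup>2 / 2" for \<xi>
      by (simp add: vortex_def rot_scaleR power_mult_distrib power_divide)
    have "I (2 * t) = \<bar>1 / sqrt 2\<bar> ^ DIM(real^'n) *\<^sub>R (\<integral>\<xi>. (norm (vortex a b 1 (2 * t) (0 + (1 / sqrt 2) *\<^sub>R \<xi>)))\<^sup>2 \<partial>lborel)"
      unfolding I_def
    proof (rule lborel_integral_affine)
      show "(\<lambda>\<xi>. (norm (vortex a b 1 (2 * t) \<xi>))\<^sup>2) \<in> borel_measurable borel"
        using vortex_meas[of a b 1 "2 * t"] by measurable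
    qed simp
    also have "\<dots> = I t / 4"
      unfolding e dim I_def by (simp add: power_divide)
    finally show ?thesis .
  qed
  \<comment> \<open>Normalises the initial energy in frequency to one, which makes the norm of the
    data independent of \<open>t\<close>.\<close>
  define \<kappa> where "\<kappa> = 1 / sqrt (I t)"
  \<comment> \<open>Freezing the amplitude at negative times keeps it below its initial value for
    all real \<open>r\<close>, so the initial amplitude can serve as the envelope.\<close>
  define c where "c r = vortex a b \<kappa> (t + max r 0)" for r
  have E: "(\<integral>\<xi>. (norm (vortex a b \<kappa> s \<xi>))\<^sup>2 \<partial>lborel) = I s / I t" for s
  proof -
    have "(norm (vortex a b \<kappa> s \<xi>))\<^sup>2 = (1 / I t) * (norm (vortex a b 1 s \<xi>))\<^sup>2" for \<xi>
      using I_pos by (simp add: vortex_def \<kappa>_def power_mult_distrib power_divide)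
    then show ?thesis unfolding I_def by simp
  qed
  have cpos: "0 < t + max r 0" for r using t by (simp add: max_def)
  interpret envelope "\<lambda>\<xi>. norm (vortex a b \<kappa> t \<xi>)" by (rule envelope_vortex[OF ab t])
  interpret frequency_solution "\<lambda>\<xi>. norm (vortex a b \<kappa> t \<xi>)" c
  proof
    show "case_prod c \<in> borel_measurable (borel \<Otimes>\<^sub>M borel)"
      unfolding c_def vortex_def case_prod_unfold
      using measurable_compose[OF measurable_snd rot_meas[of a b]] by measurable
    show "norm (c r \<xi>) \<le> norm (vortex a b \<kappa> t \<xi>)" for r \<xi>
    proof -
      have "exp (- (t + max r 0) * (norm \<xi>)\<^sup>2) \<le> exp (- t * (norm \<xi>)\<^sup>2)"
        unfolding exp_le_cancel_iff by (rule mult_right_mono) auto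
      then show ?thesis unfolding c_def vortex_def by (simp add: abs_mult mult_left_mono mult_right_mono)
    qed
    show "c r (- \<xi>) = - c r \<xi>" for r \<xi> by (simp add: c_def vortex_def rot_minus)
    show "\<xi> \<bullet> c r \<xi> = 0" for r \<xi> by (simp add: c_def vortex_def inner_rot)
    show "continuous_on {0..} (\<lambda>r. c r \<xi>)" for \<xi>
      unfolding c_def vortex_def by (intro continuous_intros)
    fix r :: real and \<xi> :: "real^'n" assume r: "0 < r"
    have d: "((\<lambda>r. \<kappa> * exp (- (t + r) * (norm \<xi>)\<^sup>2)) has_real_derivative - (norm \<xi>)\<^sup>2 * (\<kappa> * exp (- (t + r) * (norm \<xi>)\<^sup>2))) (at r)"
      by (auto intro!: derivative_eq_intros)
    have "((\<lambda>r. (\<kappa> * exp (- (t + r) * (norm \<xi>)\<^sup>2)) *\<^sub>R rot a b \<xi>) has_vector_derivative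
        (- (norm \<xi>)\<^sup>2 * (\<kappa> * exp (- (t + r) * (norm \<xi>)\<^sup>2))) *\<^sub>R rot a b \<xi>) (at r)"
      using bounded_linear.has_vector_derivative[OF bounded_linear_scaleR_left d[unfolded has_real_derivative_iff_has_vector_derivative]] .
    then have "((\<lambda>r. c r \<xi>) has_vector_derivative (- (norm \<xi>)\<^sup>2 * (\<kappa> * exp (- (t + r) * (norm \<xi>)\<^sup>2))) *\<^sub>R rot a b \<xi>) (at r)"
      by (rule has_vector_derivative_transform_within_open[where S = "{0<..}"])
         (use r in \<open>auto simp: c_def vortex_def\<close>)
    moreover have "(- (norm \<xi>)\<^sup>2 * (\<kappa> * exp (- (t + r) * (norm \<xi>)\<^sup>2))) *\<^sub>R rot a b \<xi> = - (norm \<xi>)\<^sup>2 *\<^sub>R c r \<xi>"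
      using r by (simp add: c_def vortex_def)
    ultimately show "((\<lambda>r. c r \<xi>) has_vector_derivative - (norm \<xi>)\<^sup>2 *\<^sub>R c r \<xi> - leray_proj \<xi> (convect (c r) (c r) \<xi>)) (at r)"
      unfolding c_def vortex_stationary[OF ab U cpos] by simp
  qed
  have "decay_counterexample (gauss_mass TYPE(real^'n) * 1) t (sin_vec (c 0)) (\<lambda>t. sin_vec (c t))"
  proof (rule decay_counterexampleI)
    have "t + max 0 0 = t" "t + max t 0 = 2 * t" using t by simp_all
    then show "(\<integral>\<xi>. (norm (c 0 \<xi>))\<^sup>2 \<partial>lborel) = 1\<^sup>2" "1\<^sup>2 / 4 \<le> (\<integral>\<xi>. (norm (c t \<xi>))\<^sup>2 \<partial>lborel)"
      unfolding c_def E using I_pos I_scale by simp_all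
  qed simp
  then show ?thesis unfolding mult_1_right by (intro exI)
qed


section \<open>Low-frequency solutions in space\<close>

text \<open>The exponent is one third of the \<open>- 2\<close> of a radial function in space, one
  share per coordinate, and it is above \<open>- 1\<close>, hence integrable at zero. Away from zero
  \<open>inverse (1 + x^2)\<close> is a majorant.\<close>

lemma integrable_powr_decay:
  "integrable lborel (\<lambda>x::real. \<bar>x\<bar> powr (- 2 / 3) * (inverse (1 + x\<^sup>2))\<^sup>2)"
proof -
  define f where "f x = indicator {0..1} x * x powr (- 2 / 3)" for x :: real
  have fm[measurable]: "f \<in> borel_measurable borel" unfolding f_def[abs_def] by measurable
  have "(\<lambda>x::real. x powr (- 2 / 3)) integrable_on {0..1}"
    using has_integral_powr_from_0[of "- 2 / 3" 1] by (auto simp: integrable_on_def)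
  then have "(\<lambda>x::real. x powr (- 2 / 3)) absolutely_integrable_on {0..1}"
    by (rule nonnegative_absolutely_integrable_1) simp
  then have "integrable lebesgue f" by (simp add: set_integrable_def f_def[abs_def])
  then have f: "integrable lborel f" using fm by (simp add: integrable_completion)
  have f': "integrable lborel (\<lambda>x. f (0 - x))" using f lborel_integral_reflect(2)[OF fm, of 0] by simp
  have g: "integrable lborel (\<lambda>x::real. inverse (1 + x\<^sup>2))"
    using integrable_inverse_1_plus_square by (simp add: set_integrable_def einterval_def)
  have "integrable lborel (\<lambda>x. f x + f (0 - x) + inverse (1 + x\<^sup>2))"
    by (intro Bochner_Integration.integrable_add f f' g)
  then show ?thesis
  proof (rule integrable_dominated)
    fix x :: real
    define q where "q = inverse (1 + x\<^sup>2)"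
    have q: "0 < q" "q \<le> 1" by (auto simp: q_def add_pos_nonneg intro!: inverse_le_1_iff[THEN iffD2])
    have qq: "q\<^sup>2 \<le> q" "q\<^sup>2 \<le> 1" using q power_le_one[of q 2] by (auto simp: power2_eq_square mult_left_le)
    have p0: "0 \<le> \<bar>x\<bar> powr (- 2 / 3)" by simp
    have "\<bar>x\<bar> powr (- 2 / 3) * q\<^sup>2 \<le> f x + f (0 - x) + q"
    proof (cases "\<bar>x\<bar> \<le> 1")
      case True
      have "\<bar>x\<bar> powr (- 2 / 3) \<le> f x + f (0 - x)"
      proof (cases "0 \<le> x")
        case True
        then show ?thesis using \<open>\<bar>x\<bar> \<le> 1\<close> by (simp add: f_def)
      next
        case False
        then show ?thesis using \<open>\<bar>x\<bar> \<le> 1\<close> by (simp add: f_def)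
      qed
      moreover have "\<bar>x\<bar> powr (- 2 / 3) * q\<^sup>2 \<le> \<bar>x\<bar> powr (- 2 / 3)" using p0 qq by (intro mult_left_le) auto
      ultimately show ?thesis using q by linarith
    next
      case False
      have "\<bar>x\<bar> powr (- 2 / 3) \<le> 1 powr (- 2 / 3)" using False by (intro powr_mono2') auto
      then have "\<bar>x\<bar> powr (- 2 / 3) * q\<^sup>2 \<le> 1 * q" using p0 qq by (intro mult_mono) auto
      moreover have "0 \<le> f x" "0 \<le> f (0 - x)" by (auto simp: f_def)
      ultimately show ?thesis by linarith
    qed
    then show "norm (\<bar>x\<bar> powr (- 2 / 3) * (inverse (1 + x\<^sup>2))\<^sup>2) \<le> f x + f (0 - x) + inverse (1 + x\<^sup>2)"
      by (simp add: q_def abs_mult)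
  qed measurable
qed

text \<open>The inverse square of the Japanese bracket of \<open>x\<close>: bounded at the origin,
  and of the order of \<open>1 / (norm x)^2\<close> at infinity.\<close>

definition bracket :: "'a::real_normed_vector \<Rightarrow> real" where
  "bracket x = inverse (1 + (norm x)\<^sup>2)"

lemma bracket_pos: "0 < bracket x" and bracket_le_1: "bracket x \<le> 1"
  and norm_bracket: "norm x * bracket x \<le> 1" "(norm x)\<^sup>2 * bracket x \<le> 1"
proof -
  have p: "0 < 1 + (norm x)\<^sup>2" by (simp add: add_pos_nonneg)
  show "0 < bracket x" "bracket x \<le> 1" "(norm x)\<^sup>2 * bracket x \<le> 1"
    using p by (simp_all add: bracket_def field_simps)
  have "0 \<le> (norm x - 1)\<^sup>2" by simp
  then have "2 * norm x \<le> 1 + (norm x)\<^sup>2" by (simp add: power2_eq_square algebra_simps)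
  then have "norm x \<le> 1 + (norm x)\<^sup>2" using norm_ge_zero[of x] by linarith
  then show "norm x * bracket x \<le> 1" using p by (simp add: bracket_def field_simps)
qed

lemma bracket_meas[measurable]: "(\<lambda>x :: 'a::euclidean_space. bracket x) \<in> borel_measurable borel"
  unfolding bracket_def by measurable

text \<open>Since \<open>\<bar>x \<bullet> b\<bar> \<le> norm x\<close>, the radial function is dominated off the coordinate planes by a
  product of functions of the three coordinates.\<close>

lemma integrable_inverse_square_decay:
  assumes n: "CARD('n::finite) = 3"
  shows "integrable lborel (\<lambda>x :: real^'n. (inverse (norm x))\<^sup>2 * bracket x ^ 6)"
proof -
  define h where "h x = \<bar>x\<bar> powr (- 2 / 3) * (inverse (1 + x\<^sup>2))\<^sup>2" for x :: real
  have i: "integrable lborel (\<lambda>x::real^'n. \<Prod>b\<in>Basis. h (x \<bullet> b))"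
    by (rule lborel_integral_prod_Basis(1)) (use integrable_powr_decay in \<open>simp add: h_def[abs_def]\<close>)
  \<comment> \<open>On a coordinate plane some factor is \<open>0 powr (- 2 / 3)\<close>, which
    evaluates to zero, and the product is no majorant there. These planes are null sets.\<close>
  have "AE x :: real^'n in lborel. \<forall>i\<in>UNIV. x $ i \<noteq> 0"
    by (intro AE_finite_allI) (auto intro: AE_nth_neq_0)
  then have "AE x :: real^'n in lborel. norm ((inverse (norm x))\<^sup>2 * bracket x ^ 6) \<le> norm (\<Prod>b\<in>Basis. h (x \<bullet> b))"
  proof eventually_elim
    case (elim x)
    \<comment> \<open>The cube root of the radial function: each of the three basis directions
      contributes one such factor.\<close>
    define m where "m = norm x powr (- 2 / 3) * (bracket x)\<^sup>2"
    have x0: "0 < norm x" using elim by (metis UNIV_I norm_eq_zero zero_index zero_less_norm_iff)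
    have "m \<le> h (x \<bullet> b)" if b: "b \<in> Basis" for b
    proof -
      obtain i where bi: "b = axis i 1" using b unfolding Basis_vec_eq by auto
      have xb: "0 < \<bar>x \<bullet> b\<bar>" using elim by (simp add: bi inner_axis)
      have le: "\<bar>x \<bullet> b\<bar> \<le> norm x" by (rule Basis_le_norm[OF b])
      then have "(x \<bullet> b)\<^sup>2 \<le> (norm x)\<^sup>2" using power_mono[OF le, of 2] by simp
      then have "bracket x \<le> inverse (1 + (x \<bullet> b)\<^sup>2)"
        unfolding bracket_def by (intro le_imp_inverse_le) (auto simp: add_pos_nonneg)
      then have "(bracket x)\<^sup>2 \<le> (inverse (1 + (x \<bullet> b)\<^sup>2))\<^sup>2"
        using bracket_pos[of x] by (intro power_mono) auto
      moreover have "norm x powr (- 2 / 3) \<le> \<bar>x \<bullet> b\<bar> powr (- 2 / 3)"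
        using xb le by (intro powr_mono2') auto
      ultimately show ?thesis unfolding m_def h_def by (intro mult_mono) auto
    qed
    moreover have "0 \<le> m" by (simp add: m_def)
    ultimately have "(\<Prod>b\<in>(Basis :: (real^'n) set). m) \<le> (\<Prod>b\<in>Basis. h (x \<bullet> b))"
      by (intro prod_mono) auto
    moreover have "(\<Prod>b\<in>(Basis :: (real^'n) set). m) = (inverse (norm x))\<^sup>2 * bracket x ^ 6"
    proof -
      have "(norm x powr (- 2 / 3)) ^ 3 = norm x powr (- 2)"
        using x0 by (simp add: powr_power)
      also have "\<dots> = (inverse (norm x))\<^sup>2"
        using x0 by (simp add: powr_minus power_inverse)
      finally show ?thesis using n by (simp add: m_def power_mult_distrib flip: power_mult)
    qed
    ultimately show ?case using bracket_pos[of x] by (simp add: abs_mult)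
  qed
  then show ?thesis
    by (intro Bochner_Integration.integrable_bound[OF i]) measurable
qed

text \<open>Near the origin \<open>norm x * weight x\<close> stays away from zero, as it must to
  dominate a convolution that is positive there. The power 7 is one more than the 6 of the
  integrable majorant, and the spare \<open>bracket\<close> pays for two powers of the norm. At the
  origin itself the value is zero.\<close>

definition weight :: "'a::real_normed_vector \<Rightarrow> real" where
  "weight x = inverse (norm x) * bracket x ^ 7"

lemma weight_meas: "(\<lambda>x :: 'a::euclidean_space. weight x) \<in> borel_measurable borel"
  unfolding weight_def by measurable

lemma weight_nonneg: "0 \<le> weight x"
  using bracket_pos[of x] by (simp add: weight_def)

text \<open>One integrable function serves all four envelope conditions: each quantity is
  \<open>G\<close> times factors \<open>r * q\<close>, \<open>r^2 * q\<close> or powers of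
  \<open>q\<close>, which are at most one.\<close>

lemma weight_le:
  fixes x :: "'a::real_normed_vector"
  defines "G \<equiv> (inverse (norm x))\<^sup>2 * bracket x ^ 6"
  shows "weight x \<le> G" "norm x * weight x \<le> G" "(weight x)\<^sup>2 \<le> G" "(norm x * weight x)\<^sup>2 \<le> G"
proof -
  have "weight x \<le> G \<and> norm x * weight x \<le> G \<and> (weight x)\<^sup>2 \<le> G \<and> (norm x * weight x)\<^sup>2 \<le> G"
  proof (cases "x = 0")
    case True
    then show ?thesis by (simp add: weight_def G_def)
  next
    case False
    define r q where "r = norm x" and "q = bracket x"
    have r: "0 < r" using False by (simp add: r_def)
    have q: "0 < q" "q \<le> 1" "r * q \<le> 1" "r\<^sup>2 * q \<le> 1"
      using bracket_pos[of x] bracket_le_1[of x] norm_bracket[of x] by (auto simp: r_def q_def)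
    have G: "G = (inverse r)\<^sup>2 * q ^ 6" and G0: "0 \<le> G" using q by (auto simp: G_def r_def q_def)
    have w: "weight x = inverse r * q ^ 7" by (simp add: weight_def r_def q_def)
    have rw: "r * weight x = q ^ 7" unfolding w using r by simp
    have e1: "weight x = (r * q) * G" unfolding w G using r by (simp add: field_simps power2_eq_square eval_nat_numeral)
    have e2: "r * weight x = (r\<^sup>2 * q) * G" unfolding rw G using r by (simp add: field_simps eval_nat_numeral)
    have e3: "(weight x)\<^sup>2 = q ^ 8 * G" unfolding w G by (simp add: power_mult_distrib flip: power_mult power_add)
    have e4: "(r * weight x)\<^sup>2 = (r\<^sup>2 * q) * (q ^ 7 * G)" unfolding rw G using r by (simp add: field_simps eval_nat_numeral)
    have p: "q ^ 8 \<le> 1" "q ^ 7 \<le> 1" "0 \<le> r * q" "0 \<le> r\<^sup>2 * q" "0 \<le> q ^ 8" "0 \<le> q ^ 7" using q r by (auto intro: power_le_one)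
    have "weight x \<le> G" unfolding e1 using mult_left_le_one_le[OF G0 p(3) q(3)] .
    moreover have "r * weight x \<le> G" unfolding e2 using mult_left_le_one_le[OF G0 p(4) q(4)] .
    moreover have "(weight x)\<^sup>2 \<le> G" unfolding e3 using mult_left_le_one_le[OF G0 p(5) p(1)] .
    moreover have "(r * weight x)\<^sup>2 \<le> G"
      unfolding e4 by (rule order_trans[OF mult_left_le_one_le[OF mult_nonneg_nonneg[OF p(6) G0] p(4) q(4)] mult_left_le_one_le[OF G0 p(6) p(2)]])
    ultimately show ?thesis unfolding r_def by (intro conjI)
  qed
  then show "weight x \<le> G" "norm x * weight x \<le> G" "(weight x)\<^sup>2 \<le> G" "(norm x * weight x)\<^sup>2 \<le> G" by auto
qed

lemma envelope_weight:
  assumes n: "CARD('n::finite) = 3"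
  shows "envelope (weight :: real^'n \<Rightarrow> real)"
proof
  note G = integrable_inverse_square_decay[OF n]
  have [measurable]: "(weight :: real^'n \<Rightarrow> real) \<in> borel_measurable borel" using weight_meas[where 'a = "real^'n"] by simp
  show "(weight :: real^'n \<Rightarrow> real) \<in> borel_measurable borel" by measurable
  show "integrable lborel (weight :: real^'n \<Rightarrow> real)"
    by (rule integrable_dominated[OF G]) (measurable, simp add: weight_nonneg weight_le)
  show "integrable lborel (\<lambda>x :: real^'n. norm x * weight x)"
    by (rule integrable_dominated[OF G]) (measurable, simp add: weight_nonneg weight_le abs_mult)
  show "integrable lborel (\<lambda>x :: real^'n. (weight x)\<^sup>2)"
    by (rule integrable_dominated[OF G]) (measurable, simp add: weight_le)
  show "integrable lborel (\<lambda>x :: real^'n. (norm x * weight x)\<^sup>2)"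
    by (rule integrable_dominated[OF G]) (measurable, simp add: weight_le)
qed (rule weight_nonneg)

text \<open>A frequency at least half as long as \<open>x\<close> costs only constants: a factor 2
  from \<open>inverse (norm z)\<close>, since \<open>norm z\<close> is at least one half, and a
  factor 4 for each \<open>bracket\<close>.\<close>

lemma weight_le_bracket:
  assumes "1 \<le> norm x" "norm x \<le> 2 * norm z"
  shows "weight z \<le> 2 * 4 ^ 7 * bracket x ^ 7"
proof -
  have z: "1 / 2 \<le> norm z" using assms by linarith
  have 1: "inverse (norm z) \<le> 2"
    using le_imp_inverse_le[OF z] by simp
  have "(norm x)\<^sup>2 \<le> (2 * norm z)\<^sup>2" using assms(2) by (intro power_mono) auto
  then have "1 + (norm x)\<^sup>2 \<le> 4 * (1 + (norm z)\<^sup>2)" by (simp add: power_mult_distrib)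
  then have "bracket z \<le> 4 * bracket x"
    unfolding bracket_def by (simp add: field_simps add_pos_nonneg)
  then have "bracket z ^ 7 \<le> (4 * bracket x) ^ 7" using bracket_pos[of z] by (intro power_mono) auto
  then have "weight z \<le> 2 * (4 * bracket x) ^ 7"
    unfolding weight_def using 1 bracket_pos[of z] by (intro mult_mono) auto
  then show ?thesis by (simp add: power_mult_distrib)
qed

text \<open>One of \<open>\<xi> - \<eta>\<close> and \<open>\<eta>\<close> is at least half as long
  as \<open>\<xi>\<close>. For \<open>norm \<xi> \<ge> 1\<close> its weight is estimated by
  \<open>bracket \<xi> ^ 7\<close> and the other is integrated; for smaller \<open>\<xi>\<close> the
  convolution is bounded and \<open>bracket \<xi>\<close> is at least one half. Off the origin
  \<open>bracket \<xi> ^ 7\<close> equals \<open>norm \<xi> * weight \<xi>\<close>, the form that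
  \<open>conv\<close> asks for.\<close>

lemma weight_convolution:
  assumes n: "CARD('n::finite) = 3"
  shows "\<exists>C\<ge>0. \<forall>\<xi> :: real^'n. (\<integral>\<eta>. weight (\<xi> - \<eta>) * weight \<eta> \<partial>lborel) \<le> C * bracket \<xi> ^ 7"
proof -
  interpret envelope "weight :: real^'n \<Rightarrow> real" by (rule envelope_weight[OF n])
  define M :: real where "M = 2 * 4 ^ 7"
  define N where "N = (\<integral>\<eta>. weight (\<eta> :: real^'n) \<partial>lborel)"
  define K where "K = (\<integral>\<eta>. (weight (\<eta> :: real^'n))\<^sup>2 \<partial>lborel)"
  have N: "0 \<le> N" unfolding N_def using weight_nonneg by (intro integral_nonneg_AE) auto
  have K: "0 \<le> K" unfolding K_def by simp
  have M: "0 < M" by (simp add: M_def)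
  have "WW \<xi> \<le> (2 * M * N + 2 ^ 7 * K) * bracket \<xi> ^ 7" for \<xi>
  proof (cases "1 \<le> norm \<xi>")
    case True
    have pw: "weight (\<xi> - \<eta>) * weight \<eta> \<le> M * bracket \<xi> ^ 7 * (weight (\<xi> - \<eta>) + weight \<eta>)" for \<eta>
    proof -
      have B: "0 \<le> M * bracket \<xi> ^ 7" using M bracket_pos[of \<xi>] by simp
      have "norm \<xi> \<le> norm (\<xi> - \<eta>) + norm \<eta>" using norm_triangle_ineq[of "\<xi> - \<eta>" \<eta>] by simp
      then consider "norm \<xi> \<le> 2 * norm \<eta>" | "norm \<xi> \<le> 2 * norm (\<xi> - \<eta>)" by linarith
      then show ?thesis
      proof cases
        case 1
        have "weight (\<xi> - \<eta>) * weight \<eta> \<le> weight (\<xi> - \<eta>) * (M * bracket \<xi> ^ 7)"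
          unfolding M_def by (intro mult_left_mono weight_le_bracket True 1 weight_nonneg)
        also have "\<dots> \<le> M * bracket \<xi> ^ 7 * (weight (\<xi> - \<eta>) + weight \<eta>)"
          using mult_nonneg_nonneg[OF B weight_nonneg[of \<eta>]] by (simp add: algebra_simps)
        finally show ?thesis .
      next
        case 2
        have "weight (\<xi> - \<eta>) * weight \<eta> \<le> (M * bracket \<xi> ^ 7) * weight \<eta>"
          unfolding M_def by (intro mult_right_mono weight_le_bracket True 2 weight_nonneg)
        also have "\<dots> \<le> M * bracket \<xi> ^ 7 * (weight (\<xi> - \<eta>) + weight \<eta>)"
          using mult_nonneg_nonneg[OF B weight_nonneg[of "\<xi> - \<eta>"]] by (simp add: algebra_simps)
        finally show ?thesis .
      qed
    qed
    have r: "integrable lborel (\<lambda>\<eta>. weight (\<xi> - \<eta>))" "(\<integral>\<eta>. weight (\<xi> - \<eta>) \<partial>lborel) = N"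
      using lborel_integral_reflect[OF W_meas, of \<xi>] W_int by (simp_all add: N_def)
    have "WW \<xi> \<le> (\<integral>\<eta>. M * bracket \<xi> ^ 7 * (weight (\<xi> - \<eta>) + weight \<eta>) \<partial>lborel)"
      unfolding WW_def
      by (intro integral_mono integrable_WW pw integrable_mult_right Bochner_Integration.integrable_add r W_int)
    also have "\<dots> = M * bracket \<xi> ^ 7 * (N + N)" using r W_int by (simp add: N_def)
    also have "\<dots> = 2 * M * N * bracket \<xi> ^ 7" by simp
    also have "\<dots> \<le> (2 * M * N + 2 ^ 7 * K) * bracket \<xi> ^ 7"
      using K bracket_pos[of \<xi>] by (intro mult_right_mono) auto
    finally show ?thesis .
  next
    case False
    have "(norm \<xi>)\<^sup>2 \<le> 1" using False power_le_one[of "norm \<xi>" 2] by simp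
    then have "1 / 2 \<le> bracket \<xi>" unfolding bracket_def by (simp add: field_simps add_pos_nonneg)
    then have "(1 / 2) ^ 7 \<le> bracket \<xi> ^ 7" by (rule power_mono) simp
    then have "1 \<le> 2 ^ 7 * bracket \<xi> ^ 7" by (simp add: power_divide)
    from mult_left_mono[OF this K] have "WW \<xi> \<le> 2 ^ 7 * K * bracket \<xi> ^ 7"
      using WW_le[of \<xi>] unfolding K_def by simp
    also have "\<dots> \<le> (2 * M * N + 2 ^ 7 * K) * bracket \<xi> ^ 7"
      using N M bracket_pos[of \<xi>] by (intro mult_right_mono) auto
    finally show ?thesis .
  qed
  then show ?thesis unfolding WW_def
    using N M K by (intro exI[of _ "2 * M * N + 2 ^ 7 * K"]) simp
qed

section \<open>Dilation and the choice of the data\<close>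

lemma lborel_integral_dilate:
  fixes f :: "'a::euclidean_space \<Rightarrow> real"
  assumes f: "f \<in> borel_measurable borel" and l: "0 < l"
  shows "(\<integral>x. f (x /\<^sub>R l) \<partial>lborel) = l ^ DIM('a) * integral\<^sup>L lborel f"
    and "integrable lborel (\<lambda>x. f (x /\<^sub>R l)) \<longleftrightarrow> integrable lborel f"
proof -
  show "integrable lborel (\<lambda>x. f (x /\<^sub>R l)) \<longleftrightarrow> integrable lborel f"
    using lborel_integrable_affine_iff[OF f, of "inverse l" 0] l by simp
  show "(\<integral>x. f (x /\<^sub>R l) \<partial>lborel) = l ^ DIM('a) * integral\<^sup>L lborel f"
    using lborel_integral_affine[OF f, of "inverse l" 0] l by (simp add: power_inverse)
qed

lemma envelope_dilate:
  assumes "envelope (W :: real^'n::finite \<Rightarrow> real)" and l: "0 < l"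
  shows "envelope (\<lambda>\<xi>. W (\<xi> /\<^sub>R l))"
proof -
  interpret envelope W by fact
  have n: "norm \<xi> = l * norm (\<xi> /\<^sub>R l)" for \<xi> :: "real^'n" using l by simp
  show ?thesis
  proof
    show "integrable lborel (\<lambda>\<xi>. W (\<xi> /\<^sub>R l))"
      using lborel_integral_dilate(2)[OF W_meas l] W_int by simp
    have "integrable lborel (\<lambda>\<xi>. l * (norm (\<xi> /\<^sub>R l) * W (\<xi> /\<^sub>R l)))"
      using lborel_integral_dilate(2)[of "\<lambda>\<xi>. norm \<xi> * W \<xi>", OF _ l] W_int1 by (intro integrable_mult_right) simp
    then show "integrable lborel (\<lambda>\<xi>. norm \<xi> * W (\<xi> /\<^sub>R l))"
      by (simp only: mult.assoc[symmetric] n[symmetric])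
    show "integrable lborel (\<lambda>\<xi>. (W (\<xi> /\<^sub>R l))\<^sup>2)"
      using lborel_integral_dilate(2)[of "\<lambda>\<xi>. (W \<xi>)\<^sup>2", OF _ l] W_sq by simp
    have "integrable lborel (\<lambda>\<xi>. l\<^sup>2 * (norm (\<xi> /\<^sub>R l) * W (\<xi> /\<^sub>R l))\<^sup>2)"
      using lborel_integral_dilate(2)[of "\<lambda>\<xi>. (norm \<xi> * W \<xi>)\<^sup>2", OF _ l] W_sq1 by (intro integrable_mult_right) simp
    then show "integrable lborel (\<lambda>\<xi>. (norm \<xi> * W (\<xi> /\<^sub>R l))\<^sup>2)"
      by (simp only: power_mult_distrib[symmetric] mult.assoc[symmetric] n[symmetric])
  qed (use W_nonneg in auto)
qed

text \<open>The eighth power offsets the growth of \<open>rot\<close>: since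
  \<open>(norm \<xi>)^2 * bracket \<xi> \<le> 1\<close>, the profile stays below
  \<open>weight\<close>, whose power is 7.\<close>

definition profile :: "'n \<Rightarrow> 'n \<Rightarrow> real^'n \<Rightarrow> real^'n::finite" where
  "profile a b \<xi> = bracket \<xi> ^ 8 *\<^sub>R rot a b \<xi>"

lemma profile_meas: "profile a b \<in> borel_measurable borel"
  unfolding profile_def[abs_def] using rot_meas[of a b] by measurable

lemma norm_profile_le:
  assumes ab: "a \<noteq> b"
  shows "norm (profile a b \<xi>) \<le> weight \<xi>"
proof (cases "\<xi> = 0")
  case False
  have "norm (profile a b \<xi>) \<le> bracket \<xi> ^ 8 * norm \<xi>"
    using bracket_pos[of \<xi>] norm_rot_le[OF ab, of \<xi>] by (simp add: profile_def mult_left_mono)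
  also have "\<dots> = ((norm \<xi>)\<^sup>2 * bracket \<xi>) * weight \<xi>"
    using False by (simp add: weight_def power2_eq_square eval_nat_numeral)
  also have "\<dots> \<le> 1 * weight \<xi>" by (intro mult_right_mono norm_bracket weight_nonneg)
  finally show ?thesis by simp
qed (simp add: profile_def rot_def weight_def)

lemma decay_counterexample_space:
  assumes n: "CARD('n::finite) = 3" and ab: "a \<noteq> (b :: 'n)"
  shows "\<exists>\<beta>>0. \<forall>t>0. \<exists>(u0 :: real^'n \<Rightarrow> real^'n) u. decay_counterexample \<beta> t u0 u"
proof -
  define w where "w = (weight :: real^'n \<Rightarrow> real)"
  have env: "envelope w" unfolding w_def by (rule envelope_weight[OF n])
  interpret W0: envelope w by (rule env)
  obtain C where C: "0 \<le> C" "\<And>\<xi> :: real^'n. (\<integral>\<eta>. w (\<xi> - \<eta>) * w \<eta> \<partial>lborel) \<le> C * bracket \<xi> ^ 7"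
    using weight_convolution[OF n] unfolding w_def by blast
  define E where "E = (\<integral>\<xi>. (norm (profile a b \<xi>))\<^sup>2 \<partial>lborel)"
  define K where "K = (\<integral>\<xi>. (w \<xi>)\<^sup>2 \<partial>lborel)"
  have K: "0 \<le> K" by (simp add: K_def)
  have [measurable]: "profile a b \<in> borel_measurable borel" by (rule profile_meas)
  have p_sq: "(norm (profile a b \<xi>))\<^sup>2 \<le> (w \<xi>)\<^sup>2" for \<xi>
    unfolding w_def by (intro power_mono norm_profile_le ab) simp
  have iE: "integrable lborel (\<lambda>\<xi>. (norm (profile a b \<xi>))\<^sup>2)"
    by (rule integrable_dominated[OF W0.W_sq]) (use p_sq in auto)
  have E: "0 < E"
    unfolding E_def
  proof (rule integral_pos_of_pos_off_hyperplane[OF iE, where i = a])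
    show "0 < (norm (profile a b x))\<^sup>2" if "x $ a \<noteq> 0" for x
    proof -
      have "0 < (norm (rot a b x))\<^sup>2"
        unfolding norm_rot_power2[OF ab] using that by (simp add: add_pos_nonneg)
      then show ?thesis using bracket_pos[of x] by (simp add: profile_def)
    qed
  qed simp
  have dim: "DIM(real^'n) = 3" using n by simp
  have main: "\<exists>(u0 :: real^'n \<Rightarrow> real^'n) u. decay_counterexample (gauss_mass TYPE(real^'n) * sqrt E) t u0 u" if t: "0 < t" for t
  proof -
    \<comment> \<open>Energy at time \<open>t\<close> of the heat flow from the dilated data, in
      undilated variables: with \<open>l = m^2\<close> the exponent
      \<open>t * (norm \<xi>)^2\<close> becomes \<open>t * m^4 * (norm (\<xi> / l))^2\<close>, and
      squaring the amplitude doubles it.\<close>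
    define H where "H m = (\<integral>\<xi>. exp (- (2 * t * m ^ 4) * (norm \<xi>)\<^sup>2) * (norm (profile a b \<xi>))\<^sup>2 \<partial>lborel)" for m
    define \<mu> where "\<mu> k = 1 / real (Suc k)" for k
    have \<mu>: "\<mu> \<longlonglongrightarrow> 0" unfolding \<mu>_def using LIMSEQ_Suc[OF lim_1_over_n] .
    have "(\<lambda>k. H (\<mu> k)) \<longlonglongrightarrow> E"
      unfolding H_def E_def
    proof (rule integral_dominated_convergence[OF _ _ iE])
      show "AE \<xi> in lborel. (\<lambda>k. exp (- (2 * t * \<mu> k ^ 4) * (norm \<xi>)\<^sup>2) * (norm (profile a b \<xi>))\<^sup>2) \<longlonglongrightarrow> (norm (profile a b \<xi>))\<^sup>2"
      proof (intro AE_I2)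
        fix \<xi>
        have "(\<lambda>k. exp (- (2 * t * \<mu> k ^ 4) * (norm \<xi>)\<^sup>2) * (norm (profile a b \<xi>))\<^sup>2) \<longlonglongrightarrow> exp (- (2 * t * 0 ^ 4) * (norm \<xi>)\<^sup>2) * (norm (profile a b \<xi>))\<^sup>2"
          by (intro tendsto_intros \<mu>)
        then show "(\<lambda>k. exp (- (2 * t * \<mu> k ^ 4) * (norm \<xi>)\<^sup>2) * (norm (profile a b \<xi>))\<^sup>2) \<longlonglongrightarrow> (norm (profile a b \<xi>))\<^sup>2" by simp
      qed
      show "AE \<xi> in lborel. norm (exp (- (2 * t * \<mu> k ^ 4) * (norm \<xi>)\<^sup>2) * (norm (profile a b \<xi>))\<^sup>2) \<le> (norm (profile a b \<xi>))\<^sup>2" for k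
        using t by (intro AE_I2) (simp add: abs_mult mult_left_le_one_le \<mu>_def)
    qed measurable
    then have e1: "\<forall>\<^sub>F k in sequentially. 3 / 4 * E < H (\<mu> k)"
      using E by (intro order_tendstoD(1)) auto
    have l2: "(\<lambda>k. 8 * C * \<mu> k) \<longlonglongrightarrow> 8 * C * 0" and l3: "(\<lambda>k. 32 * C\<^sup>2 * K * (\<mu> k)\<^sup>2) \<longlonglongrightarrow> 32 * C\<^sup>2 * K * 0\<^sup>2"
      by (intro tendsto_intros \<mu>)+
    have e2: "\<forall>\<^sub>F k in sequentially. 8 * C * \<mu> k < 1" and e3: "\<forall>\<^sub>F k in sequentially. 32 * C\<^sup>2 * K * (\<mu> k)\<^sup>2 < E / 4"
      using order_tendstoD(2)[OF l2, of 1] order_tendstoD(2)[OF l3, of "E / 4"] E by simp_all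
    \<comment> \<open>The heat flow keeps three quarters of the energy, the iteration contracts, and
      the nonlinear error takes at most a quarter. As \<open>H m\<close> is bounded by twice the
      energy of the solution plus this error, at least \<open>E / 4\<close> remains, that is half of
      the norm.\<close>
    obtain k where k: "3 / 4 * E < H (\<mu> k)" "8 * C * \<mu> k < 1" "32 * C\<^sup>2 * K * (\<mu> k)\<^sup>2 < E / 4"
      using eventually_happens'[OF sequentially_bot eventually_conj[OF e1 eventually_conj[OF e2 e3]]] by blast
    define m where "m = \<mu> k"
    have m: "0 < m" by (simp add: m_def \<mu>_def)
    \<comment> \<open>The frequency scale. Taking it as a square makes the amplitude
      \<open>l powr (- 3 / 2)\<close>, which keeps the energy fixed, an integer power of
      \<open>m\<close>.\<close>
    define l where "l = m\<^sup>2"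
    have l: "0 < l" using m by (simp add: l_def)
    define A where "A = inverse (m ^ 3)"
    have A: "0 < A" using m by (simp add: A_def)
    have Al: "A\<^sup>2 * l ^ 3 = 1" using m by (simp add: A_def l_def power_inverse flip: power_mult)
    define wl where "wl \<xi> = w (\<xi> /\<^sub>R l)" for \<xi>
    define c0 where "c0 \<xi> = A *\<^sub>R profile a b (\<xi> /\<^sub>R l)" for \<xi>
    have envl: "envelope wl" unfolding wl_def[abs_def] by (rule envelope_dilate[OF env l])
    interpret envelope wl by (rule envl)
    \<comment> \<open>Dilation multiplies the convolution constant by \<open>l^2 = m^4\<close>: the
      Jacobian \<open>l^3\<close>, less one power because \<open>norm \<xi>\<close> is measured in
      units of \<open>l\<close>. Against the amplitude \<open>1 / m^3\<close> a factor
      \<open>m\<close> is left, so the iteration is small although the energy is fixed.\<close>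
    interpret picard wl c0 A "C * m ^ 4"
    proof
      fix \<xi> :: "real^'n"
      show "WW \<xi> \<le> C * m ^ 4 * norm \<xi> * wl \<xi>" if \<xi>: "\<xi> \<noteq> 0"
      proof -
        have me: "(\<lambda>\<eta>. wl (\<xi> - \<eta>) * wl \<eta>) \<in> borel_measurable borel" by measurable
        have "WW \<xi> = l ^ 3 * (\<integral>\<eta>. w (\<xi> /\<^sub>R l - \<eta>) * w \<eta> \<partial>lborel)"
          unfolding WW_def using lborel_integral_affine[OF me, of l 0] l
          by (simp add: wl_def n scaleR_diff_right)
        also have "\<dots> \<le> l ^ 3 * (C * bracket (\<xi> /\<^sub>R l) ^ 7)"
          using l by (intro mult_left_mono C(2)) simp
        also have "\<dots> = C * m ^ 4 * norm \<xi> * wl \<xi>"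
          unfolding wl_def w_def weight_def l_def using \<xi> m
          by (simp add: field_simps eval_nat_numeral)
        finally show ?thesis .
      qed
      show "8 * A * (C * m ^ 4) \<le> 1"
      proof -
        have "8 * A * (C * m ^ 4) = 8 * C * m" using m by (simp add: A_def field_simps eval_nat_numeral)
        then show ?thesis using k(2)[folded m_def] by linarith
      qed
      show "c0 \<in> borel_measurable borel" unfolding c0_def[abs_def] by measurable
      show "norm (c0 \<xi>) \<le> A * wl \<xi>"
        unfolding c0_def wl_def w_def using A norm_profile_le[OF ab] by simp
      show "c0 (- \<xi>) = - c0 \<xi>" by (simp add: c0_def profile_def rot_minus bracket_def)
      show "\<xi> \<bullet> c0 \<xi> = 0"
        by (simp add: c0_def profile_def rot_scaleR inner_rot)
    qed (use A C m in auto)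
    interpret S: frequency_solution "\<lambda>\<xi>. 2 * A * wl \<xi>" sol by (rule frequency_solution_sol)
    have norm_c0: "(norm (c0 \<xi>))\<^sup>2 = A\<^sup>2 * (norm (profile a b (\<xi> /\<^sub>R l)))\<^sup>2" for \<xi>
      by (simp add: c0_def power_mult_distrib)
    have 0: "(\<integral>\<xi>. (norm (sol 0 \<xi>))\<^sup>2 \<partial>lborel) = (sqrt E)\<^sup>2"
    proof -
      have "(\<integral>\<xi>. (norm (profile a b (\<xi> /\<^sub>R l)))\<^sup>2 \<partial>lborel) = l ^ 3 * E"
        unfolding E_def using lborel_integral_dilate(1)[of "\<lambda>\<xi>. (norm (profile a b \<xi>))\<^sup>2", OF _ l] dim by simp
      then have "(\<integral>\<xi>. (norm (sol 0 \<xi>))\<^sup>2 \<partial>lborel) = (A\<^sup>2 * l ^ 3) * E"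
        unfolding sol_0 norm_c0 by simp
      then show ?thesis using Al E by simp
    qed
    have 1: "(sqrt E)\<^sup>2 / 4 \<le> (\<integral>\<xi>. (norm (sol t \<xi>))\<^sup>2 \<partial>lborel)"
    proof -
      define h where "h \<xi> = exp (- t * (norm \<xi>)\<^sup>2) *\<^sub>R c0 \<xi>" for \<xi>
      let ?D = "4 * A\<^sup>2 * (C * m ^ 4)"
      have hh: "(norm (h \<xi>))\<^sup>2 = A\<^sup>2 * (exp (- (2 * t * m ^ 4) * (norm (\<xi> /\<^sub>R l))\<^sup>2) * (norm (profile a b (\<xi> /\<^sub>R l)))\<^sup>2)" for \<xi>
      proof -
        have "(exp (- t * (norm \<xi>)\<^sup>2))\<^sup>2 = exp (- (2 * t * m ^ 4) * (norm (\<xi> /\<^sub>R l))\<^sup>2)"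
          using m by (simp add: l_def power_divide field_simps flip: exp_double power_mult)
        then show ?thesis unfolding h_def norm_scaleR power_mult_distrib norm_c0 by (simp add: mult_ac)
      qed
      have ih0: "integrable lborel (\<lambda>\<xi>. exp (- (2 * t * m ^ 4) * (norm \<xi>)\<^sup>2) * (norm (profile a b \<xi>))\<^sup>2)"
      proof (rule integrable_dominated[OF iE])
        show "norm (exp (- (2 * t * m ^ 4) * (norm \<xi>)\<^sup>2) * (norm (profile a b \<xi>))\<^sup>2) \<le> (norm (profile a b \<xi>))\<^sup>2" for \<xi>
          using t m by (simp add: abs_mult mult_left_le_one_le)
      qed measurable
      have me: "(\<lambda>\<xi>. exp (- (2 * t * m ^ 4) * (norm \<xi>)\<^sup>2) * (norm (profile a b \<xi>))\<^sup>2) \<in> borel_measurable borel" by measurable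
      have ih: "integrable lborel (\<lambda>\<xi>. (norm (h \<xi>))\<^sup>2)"
        unfolding hh using lborel_integral_dilate(2)[OF me l] ih0 by (intro integrable_mult_right) simp
      have "(\<integral>\<xi>. (norm (h \<xi>))\<^sup>2 \<partial>lborel) = A\<^sup>2 * (l ^ 3 * H m)"
        unfolding hh H_def using lborel_integral_dilate(1)[OF me l] dim by simp
      then have Hh: "(\<integral>\<xi>. (norm (h \<xi>))\<^sup>2 \<partial>lborel) = H m" using Al by (simp add: mult.assoc[symmetric])
      have pw: "(norm (h \<xi>))\<^sup>2 \<le> 2 * (norm (sol t \<xi>))\<^sup>2 + 2 * ?D\<^sup>2 * (wl \<xi>)\<^sup>2" for \<xi>
      proof -
        have d: "norm (sol t \<xi> - h \<xi>) \<le> ?D * wl \<xi>" unfolding h_def by (rule sol_heat_diff) (use t in simp)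
        have "norm (h \<xi>) \<le> norm (sol t \<xi>) + norm (sol t \<xi> - h \<xi>)"
          using norm_triangle_ineq4[of "sol t \<xi>" "sol t \<xi> - h \<xi>"] by simp
        also have "\<dots> \<le> norm (sol t \<xi>) + ?D * wl \<xi>" using d by simp
        finally have "(norm (h \<xi>))\<^sup>2 \<le> (norm (sol t \<xi>) + ?D * wl \<xi>)\<^sup>2" by (rule power_mono) simp
        also have "\<dots> \<le> 2 * (norm (sol t \<xi>))\<^sup>2 + 2 * (?D * wl \<xi>)\<^sup>2"
          using square_add_le[of 1 "norm (sol t \<xi>)" "?D * wl \<xi>"] by simp
        finally show ?thesis by (simp add: power_mult_distrib)
      qed
      have "H m \<le> (\<integral>\<xi>. 2 * (norm (sol t \<xi>))\<^sup>2 + 2 * ?D\<^sup>2 * (wl \<xi>)\<^sup>2 \<partial>lborel)"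
        unfolding Hh[symmetric]
        by (rule integral_mono[OF ih _ pw])
           (intro Bochner_Integration.integrable_add integrable_mult_right S.c_square_int W_sq)
      also have "\<dots> = 2 * (\<integral>\<xi>. (norm (sol t \<xi>))\<^sup>2 \<partial>lborel) + 2 * ?D\<^sup>2 * (\<integral>\<xi>. (wl \<xi>)\<^sup>2 \<partial>lborel)"
        using S.c_square_int[of t] W_sq by simp
      also have "(\<integral>\<xi>. (wl \<xi>)\<^sup>2 \<partial>lborel) = l ^ 3 * K"
        unfolding wl_def K_def using lborel_integral_dilate(1)[of "\<lambda>\<xi>. (w \<xi>)\<^sup>2", OF _ l] dim by simp
      \<comment> \<open>Powers of \<open>m\<close>: minus 12 from \<open>A^4\<close>, 8 from the
        squared convolution constant and 6 from \<open>l^3\<close>, so the nonlinear error decays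
        like \<open>m^2\<close>.\<close>
      also have "2 * ?D\<^sup>2 * (l ^ 3 * K) = 32 * C\<^sup>2 * K * m\<^sup>2"
        using m by (simp add: A_def l_def power_mult_distrib field_simps eval_nat_numeral)
      finally have "H m \<le> 2 * (\<integral>\<xi>. (norm (sol t \<xi>))\<^sup>2 \<partial>lborel) + 32 * C\<^sup>2 * K * m\<^sup>2" .
      then have "E / 4 \<le> (\<integral>\<xi>. (norm (sol t \<xi>))\<^sup>2 \<partial>lborel)"
        using k(1,3) unfolding m_def by linarith
      then show ?thesis using E by simp
    qed
    show ?thesis
      using S.decay_counterexampleI[OF _ 0 1] E by (intro exI) simp
  qed
  show ?thesis
    using main E gauss_mass_pos[where 'a = "real^'n"]
    by (intro exI[of _ "gauss_mass TYPE(real^'n) * sqrt E"]) auto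
qed

theorem theorem3:
  fixes \<delta> :: real
  assumes "CARD('n::finite) \<in> {2, 3}" and "\<delta> > 0"
  shows "\<not> (\<exists>(G :: real \<Rightarrow> real \<Rightarrow> real) (H :: real \<Rightarrow> real \<Rightarrow> real).
    (\<forall>(u0 :: real^'n \<Rightarrow> real^'n) B0 u B.
       u0 \<in> L2 \<and> B0 \<in> L2 \<and> div_free u0 \<and> div_free B0 \<and> mhd_solution \<delta> u0 B0 u B \<longrightarrow>
       (\<forall>t>0. L2_norm (u t) \<le> G t (L2_norm u0) \<and> L2_norm (B t) \<le> H t (L2_norm B0))) \<and>
    (\<forall>\<beta>>0. ((\<lambda>t. G t \<beta>) \<longlongrightarrow> 0) at_top) \<and>
    (\<forall>\<gamma>>0. ((\<lambda>t. H t \<gamma>) \<longlongrightarrow> 0) at_top))"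
proof -
  obtain \<beta> where \<beta>: "0 < \<beta>" and ex: "\<forall>t>0. \<exists>(u0 :: real^'n \<Rightarrow> real^'n) u. decay_counterexample \<beta> t u0 u"
  proof (cases "CARD('n) = 2")
    case True
    then obtain a b :: 'n where ab: "UNIV = {a, b}" "a \<noteq> b" unfolding card_2_iff by auto
    show ?thesis
      by (rule that[OF gauss_mass_pos[where 'a = "real^'n"]], intro allI impI, rule decay_counterexample_plane[OF ab(2,1)])
  next
    case False
    then have n: "CARD('n) = 3" using assms(1) by simp
    then obtain a b :: 'n where "a \<noteq> b" unfolding card_3_iff by auto
    from decay_counterexample_space[OF n this] show ?thesis using that by (elim exE conjE)
  qed
  show ?thesis
  proof (rule notI, elim exE conjE)
    fix G H :: "real \<Rightarrow> real \<Rightarrow> real"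
    assume bound: "\<forall>(u0 :: real^'n \<Rightarrow> real^'n) B0 u B.
       u0 \<in> L2 \<and> B0 \<in> L2 \<and> div_free u0 \<and> div_free B0 \<and> mhd_solution \<delta> u0 B0 u B \<longrightarrow>
       (\<forall>t>0. L2_norm (u t) \<le> G t (L2_norm u0) \<and> L2_norm (B t) \<le> H t (L2_norm B0))"
      and G: "\<forall>\<beta>>0. ((\<lambda>t. G t \<beta>) \<longlongrightarrow> 0) at_top"
    \<comment> \<open>Each \<open>t\<close> brings its own data, but all of them have norm
      \<open>\<beta>\<close>. At this one argument \<open>G\<close> is therefore bounded below at
      all positive times, which excludes the limit zero.\<close>
    have lower: "\<beta> / 2 \<le> G t \<beta>" if t: "0 < t" for t
    proof -
      obtain u0 :: "real^'n \<Rightarrow> real^'n" and u where "decay_counterexample \<beta> t u0 u"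
        using ex[rule_format, OF t] by (elim exE)
      then have u: "u0 \<in> L2" "div_free u0" "mhd_solution \<delta> u0 (\<lambda>_. 0) u (\<lambda>_ _. 0)"
        "L2_norm u0 = \<beta>" "\<beta> / 2 \<le> L2_norm (u t)"
        by (simp_all add: decay_counterexample_def)
      have "L2_norm (u t) \<le> G t (L2_norm u0)"
        using bound[rule_format, OF conjI[OF u(1) conjI[OF zero_in_L2 conjI[OF u(2) conjI[OF div_free_zero u(3)]]]] t]
        by (rule conjunct1)
      then show ?thesis using u(4,5) by simp
    qed
    have "((\<lambda>t. G t \<beta>) \<longlongrightarrow> 0) at_top" using G \<beta> by simp
    from order_tendstoD(2)[OF this, of "\<beta> / 2"] have "\<forall>\<^sub>F t in at_top. G t \<beta> < \<beta> / 2" using \<beta> by simp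
    with eventually_gt_at_top[of "0 :: real"] have "\<forall>\<^sub>F t :: real in at_top. False"
    proof eventually_elim
      case (elim t)
      then show ?case using lower[of t] by linarith
    qed
    then show False by simp
  qed
qed

end
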